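(* Let $G\colon\mathcal{A}\to\mathcal{B}$ be a representably small functor between locally small categories, with $\mathcal{B}$ complete, and let $T$ be a monad on $\mathcal{A}$. Let $\varepsilon\colon(G_\#T)G\to GT$ be the counit of the pushforward $G_\#T$ (which exists), and let $G'\colon\mathcal{A}^T\to\mathcal{B}^{G_\#T}$ be the functor that acts as $G$ on morphisms and sends a $T$-algebra $(a,\alpha)$ to $(Ga,\ G\alpha\cdot\varepsilon_a)$, so that $U^{G_\#T}G'=GU^T$. If $\mathcal{A}^T$ has finite connected colimits, then $G'$ is also a representably small functor into a complete category; that is, $\mathcal{B}^{G_\#T}$ is complete and $G'$ is representably small.
   Context: A functor $P\colon\mathcal{A}\to\mathsf{Set}$ is small if it is a small colimit of representables; $G\colon\mathcal{A}\to\mathcal{B}$ is representably small if $\mathcal{B}(b,G-)\colon\mathcal{A}\to\mathsf{Set}$ is small for every $b\in\mathcal{B}$. The pushforward $G_\#T$ is the right Kan extension $(G_\#T,\varepsilon\colon(G_\#T)G\to GT)$ of $GT$ along $G$, with the unique monad structure on $\mathcal{B}$ such that $\varepsilon\cdot\eta^{G_\#T}G=G\eta^T$ and $\varepsilon\cdot\mu^{G_\#T}G=G\mu^T\cdot\varepsilon T\cdot(G_\#T)\varepsilon$. For a monad $S$ on a category $\mathcal{C}$, $\mathcal{C}^S$ is the category of Eilenberg--Moore algebras and $U^S\colon\mathcal{C}^S\to\mathcal{C}$ the forgetful functor. Finite connected colimits are colimits of diagrams indexed by finite (nonempty) connected categories. *)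

theory Defs
  imports "HOL-Library.FuncSet" "HOL-Library.Countable_Set" "HOL-Library.Equipollence"
begin

section \<open>Size\<close>

text \<open>
  Smallness is relative to a type \<open>'u\<close> in which hom-sets and index sets live: a set is small
  if it has fewer elements than \<open>'u\<close>. The axioms on \<open>'u\<close> say that its cardinality is regular and
  uncountable. A Grothendieck universe is the case in which it is moreover a strong limit;
  closure under power sets is not assumed, since HOL alone cannot provide such a type.
\<close>

definition small :: "'u set \<Rightarrow> bool" where
  "small X \<longleftrightarrow> X \<prec> (UNIV :: 'u set)"

definition size_universe :: "'u itself \<Rightarrow> bool" where
  "size_universe (_ :: 'u itself) \<longleftrightarrow>
     uncountable (UNIV :: 'u set) \<and>
     (\<forall>(I :: 'u set) (X :: 'u \<Rightarrow> 'u set).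
        small I \<longrightarrow> (\<forall>i\<in>I. small (X i)) \<longrightarrow> small (\<Union>i\<in>I. X i))"

section \<open>Categories, functors, natural transformations\<close>

text \<open>
  Hom-sets need not be disjoint, so composition and the arrow part of a functor take the
  objects as arguments: \<open>Cmp C x y z g f\<close> is \<open>g \<cdot> f\<close> for \<open>f : x \<rightarrow> y\<close> and \<open>g : y \<rightarrow> z\<close>.
\<close>

record ('o, 'm) cat =
  Ob :: "'o set"
  Hom :: "'o \<Rightarrow> 'o \<Rightarrow> 'm set"
  Ide :: "'o \<Rightarrow> 'm"
  Cmp :: "'o \<Rightarrow> 'o \<Rightarrow> 'o \<Rightarrow> 'm \<Rightarrow> 'm \<Rightarrow> 'm"

locale category =
  fixes C :: "('o, 'm) cat"
  assumes ide_in_hom: "x \<in> Ob C \<Longrightarrow> Ide C x \<in> Hom C x x"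
    and cmp_in_hom: "\<lbrakk>x \<in> Ob C; y \<in> Ob C; z \<in> Ob C; f \<in> Hom C x y; g \<in> Hom C y z\<rbrakk>
      \<Longrightarrow> Cmp C x y z g f \<in> Hom C x z"
    and cmp_ide_left: "\<lbrakk>x \<in> Ob C; y \<in> Ob C; f \<in> Hom C x y\<rbrakk> \<Longrightarrow> Cmp C x y y (Ide C y) f = f"
    and cmp_ide_right: "\<lbrakk>x \<in> Ob C; y \<in> Ob C; f \<in> Hom C x y\<rbrakk> \<Longrightarrow> Cmp C x x y f (Ide C x) = f"
    and cmp_assoc: "\<lbrakk>w \<in> Ob C; x \<in> Ob C; y \<in> Ob C; z \<in> Ob C;
        f \<in> Hom C w x; g \<in> Hom C x y; h \<in> Hom C y z\<rbrakk>
      \<Longrightarrow> Cmp C w y z h (Cmp C w x y g f) = Cmp C w x z (Cmp C x y z h g) f"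

record ('a, 'b, 'm, 'n) func =
  FOb :: "'a \<Rightarrow> 'b"
  FMor :: "'a \<Rightarrow> 'a \<Rightarrow> 'm \<Rightarrow> 'n"

locale is_functor = dom: category C + cod: category D
  for C :: "('a, 'm) cat" and D :: "('b, 'n) cat" +
  fixes F :: "('a, 'b, 'm, 'n) func"
  assumes fob_in: "x \<in> Ob C \<Longrightarrow> FOb F x \<in> Ob D"
    and fmor_in: "\<lbrakk>x \<in> Ob C; y \<in> Ob C; f \<in> Hom C x y\<rbrakk>
      \<Longrightarrow> FMor F x y f \<in> Hom D (FOb F x) (FOb F y)"
    and fmor_ide: "x \<in> Ob C \<Longrightarrow> FMor F x x (Ide C x) = Ide D (FOb F x)"
    and fmor_cmp: "\<lbrakk>x \<in> Ob C; y \<in> Ob C; z \<in> Ob C; f \<in> Hom C x y; g \<in> Hom C y z\<rbrakk>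
      \<Longrightarrow> FMor F x z (Cmp C x y z g f)
          = Cmp D (FOb F x) (FOb F y) (FOb F z) (FMor F y z g) (FMor F x y f)"

definition id_func :: "('a, 'a, 'm, 'm) func" where
  "id_func = \<lparr>FOb = (\<lambda>x. x), FMor = (\<lambda>x y f. f)\<rparr>"

definition comp_func ::
  "('b, 'c, 'n, 'p) func \<Rightarrow> ('a, 'b, 'm, 'n) func \<Rightarrow> ('a, 'c, 'm, 'p) func" (infixl "\<circ>\<^sub>F" 55) where
  "H \<circ>\<^sub>F F = \<lparr>FOb = (\<lambda>x. FOb H (FOb F x)),
            FMor = (\<lambda>x y f. FMor H (FOb F x) (FOb F y) (FMor F x y f))\<rparr>"

locale nat_trans = source: is_functor C D F + target: is_functor C D F'
  for C :: "('a, 'm) cat" and D :: "('b, 'n) cat"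
    and F F' :: "('a, 'b, 'm, 'n) func" +
  fixes \<tau> :: "'a \<Rightarrow> 'n"
  assumes component_in: "x \<in> Ob C \<Longrightarrow> \<tau> x \<in> Hom D (FOb F x) (FOb F' x)"
    and naturality: "\<lbrakk>x \<in> Ob C; y \<in> Ob C; f \<in> Hom C x y\<rbrakk>
      \<Longrightarrow> Cmp D (FOb F x) (FOb F y) (FOb F' y) (\<tau> y) (FMor F x y f)
          = Cmp D (FOb F x) (FOb F' x) (FOb F' y) (FMor F' x y f) (\<tau> x)"

text \<open>Arrows are cut down to \<^const>\<open>extensional\<close> families, so that they are determined by their
  components at the objects of \<open>C\<close>.\<close>

definition functor_cat ::
  "('a, 'm) cat \<Rightarrow> ('b, 'n) cat \<Rightarrow> (('a, 'b, 'm, 'n) func, 'a \<Rightarrow> 'n) cat" where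
  "functor_cat C D =
     \<lparr>Ob = {F. is_functor C D F},
      Hom = (\<lambda>F F'. {\<tau>. nat_trans C D F F' \<tau> \<and> \<tau> \<in> extensional (Ob C)}),
      Ide = (\<lambda>F. \<lambda>x\<in>Ob C. Ide D (FOb F x)),
      Cmp = (\<lambda>F F' F'' \<sigma> \<tau>. \<lambda>x\<in>Ob C. Cmp D (FOb F x) (FOb F' x) (FOb F'' x) (\<sigma> x) (\<tau> x))\<rparr>"

definition isomorphic_in :: "('o, 'm) cat \<Rightarrow> 'o \<Rightarrow> 'o \<Rightarrow> bool" where
  "isomorphic_in C x y \<longleftrightarrow> x \<in> Ob C \<and> y \<in> Ob C \<and>
     (\<exists>f\<in>Hom C x y. \<exists>g\<in>Hom C y x. Cmp C x y x g f = Ide C x \<and> Cmp C y x y f g = Ide C y)"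

definition locally_small :: "('o, 'u) cat \<Rightarrow> bool" where
  "locally_small C \<longleftrightarrow> category C \<and> (\<forall>x\<in>Ob C. \<forall>y\<in>Ob C. small (Hom C x y))"

text \<open>Taking objects in \<open>'u\<close> loses nothing up to isomorphism of categories.\<close>

definition small_cat :: "('u, 'u) cat \<Rightarrow> bool" where
  "small_cat J \<longleftrightarrow> locally_small J \<and> small (Ob J)"

definition finite_cat :: "('u, 'u) cat \<Rightarrow> bool" where
  "finite_cat J \<longleftrightarrow> category J \<and> finite (Ob J) \<and> (\<forall>x\<in>Ob J. \<forall>y\<in>Ob J. finite (Hom J x y))"

definition connected_cat :: "('o, 'm) cat \<Rightarrow> bool" where
  "connected_cat J \<longleftrightarrow> category J \<and> Ob J \<noteq> {} \<and>
     (\<forall>x\<in>Ob J. \<forall>y\<in>Ob J.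
        (x, y) \<in> {(v, w). v \<in> Ob J \<and> w \<in> Ob J \<and> (Hom J v w \<noteq> {} \<or> Hom J w v \<noteq> {})}\<^sup>*)"

section \<open>Limits and colimits\<close>

definition is_cone ::
  "('j, 'k) cat \<Rightarrow> ('o, 'm) cat \<Rightarrow> ('j, 'o, 'k, 'm) func \<Rightarrow> 'o \<Rightarrow> ('j \<Rightarrow> 'm) \<Rightarrow> bool" where
  "is_cone J C D x \<pi> \<longleftrightarrow> x \<in> Ob C \<and> (\<forall>j\<in>Ob J. \<pi> j \<in> Hom C x (FOb D j)) \<and>
     (\<forall>i\<in>Ob J. \<forall>j\<in>Ob J. \<forall>f\<in>Hom J i j. Cmp C x (FOb D i) (FOb D j) (FMor D i j f) (\<pi> i) = \<pi> j)"

definition is_limit ::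
  "('j, 'k) cat \<Rightarrow> ('o, 'm) cat \<Rightarrow> ('j, 'o, 'k, 'm) func \<Rightarrow> 'o \<Rightarrow> ('j \<Rightarrow> 'm) \<Rightarrow> bool" where
  "is_limit J C D x \<pi> \<longleftrightarrow> is_functor J C D \<and> is_cone J C D x \<pi> \<and>
     (\<forall>y \<rho>. is_cone J C D y \<rho> \<longrightarrow>
        (\<exists>!h. h \<in> Hom C y x \<and> (\<forall>j\<in>Ob J. Cmp C y x (FOb D j) (\<pi> j) h = \<rho> j)))"

definition is_cocone ::
  "('j, 'k) cat \<Rightarrow> ('o, 'm) cat \<Rightarrow> ('j, 'o, 'k, 'm) func \<Rightarrow> 'o \<Rightarrow> ('j \<Rightarrow> 'm) \<Rightarrow> bool" where
  "is_cocone J C D x \<iota> \<longleftrightarrow> x \<in> Ob C \<and> (\<forall>j\<in>Ob J. \<iota> j \<in> Hom C (FOb D j) x) \<and>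
     (\<forall>i\<in>Ob J. \<forall>j\<in>Ob J. \<forall>f\<in>Hom J i j. Cmp C (FOb D i) (FOb D j) x (\<iota> j) (FMor D i j f) = \<iota> i)"

definition is_colimit ::
  "('j, 'k) cat \<Rightarrow> ('o, 'm) cat \<Rightarrow> ('j, 'o, 'k, 'm) func \<Rightarrow> 'o \<Rightarrow> ('j \<Rightarrow> 'm) \<Rightarrow> bool" where
  "is_colimit J C D x \<iota> \<longleftrightarrow> is_functor J C D \<and> is_cocone J C D x \<iota> \<and>
     (\<forall>y \<kappa>. is_cocone J C D y \<kappa> \<longrightarrow>
        (\<exists>!h. h \<in> Hom C x y \<and> (\<forall>j\<in>Ob J. Cmp C (FOb D j) x y h (\<iota> j) = \<kappa> j)))"

definition complete :: "('o, 'u) cat \<Rightarrow> bool" where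
  "complete C \<longleftrightarrow> category C \<and>
     (\<forall>(J :: ('u, 'u) cat) D. small_cat J \<longrightarrow> is_functor J C D \<longrightarrow> (\<exists>x \<pi>. is_limit J C D x \<pi>))"

definition has_finite_connected_colimits :: "('o, 'u) cat \<Rightarrow> bool" where
  "has_finite_connected_colimits C \<longleftrightarrow> category C \<and>
     (\<forall>(J :: ('u, 'u) cat) D. finite_cat J \<longrightarrow> connected_cat J \<longrightarrow> is_functor J C D \<longrightarrow>
        (\<exists>x \<iota>. is_colimit J C D x \<iota>))"

section \<open>Small functors\<close>

definition Set_cat :: "('u set, 'u \<Rightarrow> 'u) cat" where
  "Set_cat = \<lparr>Ob = {X. small X}, Hom = (\<lambda>X Y. X \<rightarrow>\<^sub>E Y),
      Ide = (\<lambda>X. \<lambda>x\<in>X. x), Cmp = (\<lambda>X Y Z g f. compose X g f)\<rparr>"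

definition hom_func :: "('o, 'u) cat \<Rightarrow> 'o \<Rightarrow> ('o, 'u set, 'u, 'u \<Rightarrow> 'u) func" where
  "hom_func C c = \<lparr>FOb = (\<lambda>x. Hom C c x), FMor = (\<lambda>x y f. \<lambda>g\<in>Hom C c x. Cmp C c x y f g)\<rparr>"

definition representable :: "('o, 'u) cat \<Rightarrow> ('o, 'u set, 'u, 'u \<Rightarrow> 'u) func \<Rightarrow> bool" where
  "representable C P \<longleftrightarrow> (\<exists>c\<in>Ob C. isomorphic_in (functor_cat C Set_cat) P (hom_func C c))"

definition small_functor :: "('o, 'u) cat \<Rightarrow> ('o, 'u set, 'u, 'u \<Rightarrow> 'u) func \<Rightarrow> bool" where
  "small_functor C P \<longleftrightarrow>
     (\<exists>(J :: ('u, 'u) cat) D \<iota>. small_cat J \<and> (\<forall>j\<in>Ob J. representable C (FOb D j)) \<and>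
        is_colimit J (functor_cat C Set_cat) D P \<iota>)"

definition representably_small ::
  "('a, 'u) cat \<Rightarrow> ('b, 'u) cat \<Rightarrow> ('a, 'b, 'u, 'u) func \<Rightarrow> bool" where
  "representably_small A B G \<longleftrightarrow>
     is_functor A B G \<and> (\<forall>b\<in>Ob B. small_functor A (hom_func B b \<circ>\<^sub>F G))"

section \<open>Monads and their algebras\<close>

record ('o, 'm) mnd =
  Fun :: "('o, 'o, 'm, 'm) func"
  Unit :: "'o \<Rightarrow> 'm"
  Mult :: "'o \<Rightarrow> 'm"

locale monad = category C + unit: nat_trans C C id_func "Fun T" "Unit T"
    + mult: nat_trans C C "Fun T \<circ>\<^sub>F Fun T" "Fun T" "Mult T"
  for C :: "('o, 'm) cat" and T :: "('o, 'm) mnd" +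
  assumes unit_left: "x \<in> Ob C \<Longrightarrow>
      Cmp C (FOb (Fun T) x) (FOb (Fun T) (FOb (Fun T) x)) (FOb (Fun T) x)
        (Mult T x) (Unit T (FOb (Fun T) x)) = Ide C (FOb (Fun T) x)"
    and unit_right: "x \<in> Ob C \<Longrightarrow>
      Cmp C (FOb (Fun T) x) (FOb (Fun T) (FOb (Fun T) x)) (FOb (Fun T) x)
        (Mult T x) (FMor (Fun T) x (FOb (Fun T) x) (Unit T x)) = Ide C (FOb (Fun T) x)"
    and mult_assoc: "x \<in> Ob C \<Longrightarrow>
      Cmp C (FOb (Fun T) (FOb (Fun T) (FOb (Fun T) x))) (FOb (Fun T) (FOb (Fun T) x)) (FOb (Fun T) x)
        (Mult T x) (Mult T (FOb (Fun T) x))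
      = Cmp C (FOb (Fun T) (FOb (Fun T) (FOb (Fun T) x))) (FOb (Fun T) (FOb (Fun T) x)) (FOb (Fun T) x)
        (Mult T x) (FMor (Fun T) (FOb (Fun T) (FOb (Fun T) x)) (FOb (Fun T) x) (Mult T x))"

definition is_algebra :: "('o, 'm) cat \<Rightarrow> ('o, 'm) mnd \<Rightarrow> 'o \<Rightarrow> 'm \<Rightarrow> bool" where
  "is_algebra C T a \<alpha> \<longleftrightarrow> a \<in> Ob C \<and> \<alpha> \<in> Hom C (FOb (Fun T) a) a \<and>
     Cmp C a (FOb (Fun T) a) a \<alpha> (Unit T a) = Ide C a \<and>
     Cmp C (FOb (Fun T) (FOb (Fun T) a)) (FOb (Fun T) a) a \<alpha> (Mult T a)
     = Cmp C (FOb (Fun T) (FOb (Fun T) a)) (FOb (Fun T) a) a \<alpha> (FMor (Fun T) (FOb (Fun T) a) a \<alpha>)"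

definition EM :: "('o, 'm) cat \<Rightarrow> ('o, 'm) mnd \<Rightarrow> ('o \<times> 'm, 'm) cat" where
  "EM C T =
     \<lparr>Ob = {(a, \<alpha>). is_algebra C T a \<alpha>},
      Hom = (\<lambda>(a, \<alpha>) (b, \<beta>). {f \<in> Hom C a b.
        Cmp C (FOb (Fun T) a) a b f \<alpha>
        = Cmp C (FOb (Fun T) a) (FOb (Fun T) b) b \<beta> (FMor (Fun T) a b f)}),
      Ide = (\<lambda>(a, \<alpha>). Ide C a),
      Cmp = (\<lambda>(a, \<alpha>) (b, \<beta>) (c, \<gamma>) g f. Cmp C a b c g f)\<rparr>"

definition forgetful :: "('o \<times> 'm, 'o, 'm, 'm) func" where
  "forgetful = \<lparr>FOb = fst, FMor = (\<lambda>x y f. f)\<rparr>"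

section \<open>Pushforward of a monad\<close>

definition is_right_kan_extension ::
  "('a, 'm) cat \<Rightarrow> ('b, 'n) cat \<Rightarrow> ('c, 'p) cat \<Rightarrow> ('a, 'b, 'm, 'n) func \<Rightarrow> ('a, 'c, 'm, 'p) func \<Rightarrow>
   ('b, 'c, 'n, 'p) func \<Rightarrow> ('a \<Rightarrow> 'p) \<Rightarrow> bool" where
  "is_right_kan_extension A B C G K R \<epsilon> \<longleftrightarrow>
     is_functor A B G \<and> is_functor A C K \<and> is_functor B C R \<and>
     nat_trans A C (R \<circ>\<^sub>F G) K \<epsilon> \<and>
     (\<forall>H \<gamma>. is_functor B C H \<longrightarrow> nat_trans A C (H \<circ>\<^sub>F G) K \<gamma> \<longrightarrow>
        (\<exists>!\<delta>. \<delta> \<in> Hom (functor_cat B C) H R \<and>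
          (\<forall>a\<in>Ob A. Cmp C (FOb H (FOb G a)) (FOb R (FOb G a)) (FOb K a)
             (\<epsilon> a) (\<delta> (FOb G a)) = \<gamma> a)))"

definition is_pushforward ::
  "('a, 'm) cat \<Rightarrow> ('b, 'n) cat \<Rightarrow> ('a, 'b, 'm, 'n) func \<Rightarrow> ('a, 'm) mnd \<Rightarrow>
   ('b, 'n) mnd \<Rightarrow> ('a \<Rightarrow> 'n) \<Rightarrow> bool" where
  "is_pushforward A B G T S \<epsilon> \<longleftrightarrow>
     is_right_kan_extension A B B G (G \<circ>\<^sub>F Fun T) (Fun S) \<epsilon> \<and> monad B S \<and>
     (\<forall>a\<in>Ob A.
        Cmp B (FOb G a) (FOb (Fun S) (FOb G a)) (FOb G (FOb (Fun T) a)) (\<epsilon> a) (Unit S (FOb G a))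
        = FMor G a (FOb (Fun T) a) (Unit T a)) \<and>
     (\<forall>a\<in>Ob A.
        Cmp B (FOb (Fun S) (FOb (Fun S) (FOb G a))) (FOb (Fun S) (FOb G a)) (FOb G (FOb (Fun T) a))
          (\<epsilon> a) (Mult S (FOb G a))
        = Cmp B (FOb (Fun S) (FOb (Fun S) (FOb G a))) (FOb G (FOb (Fun T) (FOb (Fun T) a)))
            (FOb G (FOb (Fun T) a))
            (FMor G (FOb (Fun T) (FOb (Fun T) a)) (FOb (Fun T) a) (Mult T a))
            (Cmp B (FOb (Fun S) (FOb (Fun S) (FOb G a))) (FOb (Fun S) (FOb G (FOb (Fun T) a)))
               (FOb G (FOb (Fun T) (FOb (Fun T) a)))
               (\<epsilon> (FOb (Fun T) a))
               (FMor (Fun S) (FOb (Fun S) (FOb G a)) (FOb G (FOb (Fun T) a)) (\<epsilon> a))))"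

text \<open>The functor \<open>G'\<close> between categories of algebras, \<open>(a, \<alpha>) \<mapsto> (G a, G \<alpha> \<cdot> \<epsilon>\<^sub>a)\<close>.\<close>

definition algebra_lift ::
  "('b, 'n) cat \<Rightarrow> ('a, 'b, 'm, 'n) func \<Rightarrow> ('a, 'm) mnd \<Rightarrow> ('b, 'n) mnd \<Rightarrow> ('a \<Rightarrow> 'n) \<Rightarrow>
   ('a \<times> 'm, 'b \<times> 'n, 'm, 'n) func" where
  "algebra_lift B G T S \<epsilon> =
     \<lparr>FOb = (\<lambda>(a, \<alpha>). (FOb G a,
        Cmp B (FOb (Fun S) (FOb G a)) (FOb G (FOb (Fun T) a)) (FOb G a)
          (FMor G (FOb (Fun T) a) a \<alpha>) (\<epsilon> a))),
      FMor = (\<lambda>x y f. FMor G (fst x) (fst y) f)\<rparr>"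

end

theory Submission
  imports Defs
begin

text \<open>
  A set-valued functor \<open>P\<close> is small iff a small set of elements generates it and any two
  representations of the same element are linked by a zigzag between generators. In a category
  with pushouts, every zigzag can be pushed out step by step, so the pairs \<open>(f, f')\<close> with
  \<open>P f y = P f' y'\<close> all factor through a small set of cospans. Hence, if coequalizers exist as
  well, an equalizer of two maps between small functors is small: its generators come from
  coequalizing such cospans in the codomain, and its zigzags from the domain.

  If \<open>B(b, G -)\<close> is small, so is \<open>B(b, G U -)\<close> on \<open>A\<^sup>T\<close>, with free algebras as generators, and
  \<open>B\<^sup>S((b, \<beta>), G' -)\<close> is an equalizer of two maps from \<open>B(b, G U -)\<close> to \<open>B(S b, G U -)\<close>.
  The same description of small functors reduces the weighted limits that compute the
  right Kan extension to limits over small categories.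
\<close>

text \<open>Equalizers of small functors need not be small: nothing bounds the elements on which two
  maps agree, and a zigzag in \<open>P\<close> between elements of the equalizer may run through
  elements outside it. Pushing out, with a coequalizer on top in the first case, cures both. The
  apex reached from a zigzag receives arrows from both ends, so the element there is an image of an
  element of the equalizer, hence lies in it again, and the long zigzag shrinks to one cospan. Only
  the existence of factorizations enters, so weak colimits do. The colimits are wanted in
  \<open>EM A T\<close> because the equalizer is formed over that category; the passage there from
  \<open>A\<close> goes through free algebras.

  Size is spent sparingly. No power set is formed, as it may fail to be small; classes are
  represented by chosen members coded in \<open>'u\<close>. Regularity bounds what one zigzag step
  can reach, and uncountability lets the lengths of zigzags range over all natural numbers.\<close>

section \<open>Size\<close>

text \<open>\<^const>\<open>small\<close> for sets whose elements do not live in \<open>'u\<close>.\<close>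

definition small_for :: "'u itself \<Rightarrow> 'x set \<Rightarrow> bool" where
  "small_for _ X \<longleftrightarrow> X \<prec> (UNIV :: 'u set)"

lemma small_image: "small X \<Longrightarrow> small (f ` X)" for X :: "'u set" and f :: "'u \<Rightarrow> 'u"
  unfolding small_def using image_lepoll by (rule lesspoll_trans1)

lemma small_for_small_iff: "small_for TYPE('u) (X :: 'u set) \<longleftrightarrow> small X"
  by (simp add: small_for_def small_def)

lemma small_for_lepoll: "small_for TYPE('u) Y \<Longrightarrow> X \<lesssim> Y \<Longrightarrow> small_for TYPE('u) X"
  unfolding small_for_def by (rule lesspoll_trans1)

lemma small_for_subset: "small_for TYPE('u) Y \<Longrightarrow> X \<subseteq> Y \<Longrightarrow> small_for TYPE('u) X"
  by (rule small_for_lepoll) (auto intro: subset_imp_lepoll)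

lemma small_for_image: "small_for TYPE('u) X \<Longrightarrow> small_for TYPE('u) (f ` X)"
  by (rule small_for_lepoll) (auto intro: image_lepoll)

text \<open>Generators have type \<open>'o \<times> 'u\<close>, whereas a \<open>small_cat\<close>
  has its objects in \<open>'u\<close>; an injection into \<open>'u\<close>, inverted on its image,
  renames them.\<close>

lemma small_for_index:
  assumes "small_for TYPE('u) X"
  obtains I :: "'u set" and f where "small I" "inj_on f I" "X = f ` I"
proof -
  have "X \<lesssim> (UNIV :: 'u set)"
    using assms unfolding small_for_def by (rule lesspoll_imp_lepoll)
  then obtain g :: "_ \<Rightarrow> 'u" where g: "inj_on g X"
    unfolding lepoll_def by blast
  show thesis
  proof
    show "small (g ` X)"
      using small_for_image[OF assms, of g] by (simp add: small_for_small_iff)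
    show "inj_on (the_inv_into X g) (g ` X)"
      by (intro inj_on_the_inv_into g)
    show "X = the_inv_into X g ` (g ` X)"
      using g by (auto simp: the_inv_into_f_f image_iff)
  qed
qed

lemma small_for_inj:
  assumes "small_for TYPE('u) X"
  obtains f :: "'x \<Rightarrow> 'u" where "inj_on f (X :: 'x set)"
  using assms lesspoll_imp_lepoll unfolding small_for_def lepoll_def by blast

context
  fixes u :: "'u itself"
  assumes univ: "size_universe TYPE('u)"
begin

lemma infinite_universe: "infinite (UNIV :: 'u set)"
  using univ unfolding size_universe_def by (auto dest: countable_finite)

text \<open>Strictly fewer elements than \<open>'u\<close> are required, so this rests on
  \<open>'u\<close> being uncountable and not merely infinite.\<close>

lemma small_for_countable: "countable X \<Longrightarrow> small_for TYPE('u) X"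
proof -
  assume X: "countable X"
  have "X \<lesssim> (UNIV :: nat set)"
    using X unfolding countable_def lepoll_def by blast
  also have "\<dots> \<lesssim> (UNIV :: 'u set)"
    using infinite_universe by (simp add: infinite_le_lepoll)
  finally have "X \<lesssim> (UNIV :: 'u set)" .
  moreover have "\<not> (UNIV :: 'u set) \<lesssim> X"
    using X univ unfolding size_universe_def by (auto dest: countable_lepoll)
  ultimately show ?thesis
    unfolding small_for_def lesspoll_def by (meson eqpoll_imp_lepoll eqpoll_sym)
qed

lemma small_for_finite: "finite X \<Longrightarrow> small_for TYPE('u) X"
  by (rule small_for_countable) (rule countable_finite)

text \<open>\<open>size_universe\<close> speaks of families inside \<open>'u\<close>; an arbitrary
  family is renamed into \<open>'u\<close> before regularity applies.\<close>

lemma small_for_Union: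
  assumes I: "small_for TYPE('u) I" and X: "\<And>i. i \<in> I \<Longrightarrow> small_for TYPE('u) (X i)"
  shows "small_for TYPE('u) (\<Union>i\<in>I. X i)"
proof -
  obtain I' :: "'u set" and f where I': "small I'" "I = f ` I'"
    using I by (rule small_for_index)
  have "\<forall>i\<in>I'. \<exists>(Y :: 'u set) g. small Y \<and> X (f i) = g ` Y"
  proof
    fix i assume "i \<in> I'"
    then have "small_for TYPE('u) (X (f i))" using X I'(2) by blast
    then show "\<exists>(Y :: 'u set) g. small Y \<and> X (f i) = g ` Y" by (rule small_for_index) blast
  qed
  then obtain Y :: "'u \<Rightarrow> 'u set" and g where Y: "\<And>i. i \<in> I' \<Longrightarrow> small (Y i) \<and> X (f i) = g i ` Y i"
    by metis
  \<comment> \<open>The coded members \<open>Y i\<close> may overlap while their decodings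
    \<open>g i\<close> differ, so each code is tagged with its index; this takes an injection of
    pairs over \<open>'u\<close> into \<open>'u\<close>.\<close>
  have "(UNIV :: 'u set) \<times> (UNIV :: 'u set) \<approx> (UNIV :: 'u set)"
    using infinite_universe card_of_Times_same_infinite card_of_ordIso
    unfolding eqpoll_def by blast
  then obtain e :: "'u \<times> 'u \<Rightarrow> 'u" where e: "inj e"
    unfolding eqpoll_def bij_betw_def by auto
  define Z where "Z = (\<Union>i\<in>I'. (\<lambda>y. e (i, y)) ` Y i)"
  have "small ((\<lambda>y. e (i, y)) ` Y i)" if "i \<in> I'" for i
    using Y[OF that] by (blast intro: small_image)
  moreover have "\<forall>(I :: 'u set) X. small I \<longrightarrow> (\<forall>i\<in>I. small (X i)) \<longrightarrow> small (\<Union>i\<in>I. X i :: 'u set)"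
    using univ unfolding size_universe_def by blast
  ultimately have "small Z"
    using I'(1) unfolding Z_def by simp
  then have "small_for TYPE('u) ((\<lambda>z. case inv e z of (i, y) \<Rightarrow> g i y) ` Z)"
    by (intro small_for_image) (simp add: small_for_small_iff)
  moreover have "(\<Union>i\<in>I. X i) \<subseteq> (\<lambda>z. case inv e z of (i, y) \<Rightarrow> g i y) ` Z"
  proof
    fix w assume "w \<in> (\<Union>i\<in>I. X i)"
    then obtain i y where "i \<in> I'" "y \<in> Y i" "w = g i y" using Y I'(2) by auto
    then show "w \<in> (\<lambda>z. case inv e z of (i, y) \<Rightarrow> g i y) ` Z"
      unfolding Z_def by (intro image_eqI[of _ _ "e (i, y)"]) (auto simp: inv_f_f[OF e])
  qed
  ultimately show ?thesis by (rule small_for_subset)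
qed

lemma small_for_Un:
  "small_for TYPE('u) X \<Longrightarrow> small_for TYPE('u) Y \<Longrightarrow> small_for TYPE('u) (X \<union> Y)"
proof -
  assume "small_for TYPE('u) X" "small_for TYPE('u) Y"
  then have "small_for TYPE('u) (\<Union>Z\<in>{X, Y}. Z)"
    by (intro small_for_Union[OF small_for_finite]) auto
  then show ?thesis by simp
qed

text \<open>Paths of a fixed length reach a small set, by induction and regularity, and there are
  only countably many lengths.\<close>

lemma small_for_rtrancl:
  assumes "\<And>x. small_for TYPE('u) (R `` {x})"
  shows "small_for TYPE('u) (R\<^sup>* `` {x})"
proof -
  have "small_for TYPE('u) ((R ^^ n) `` {x})" for n
  proof (induction n)
    case 0
    then show ?case by (intro small_for_finite) simp
  next
    case (Suc n)
    have "(R ^^ Suc n) `` {x} = (\<Union>y\<in>(R ^^ n) `` {x}. R `` {y})"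
      unfolding relpow.simps by blast
    then show ?case using small_for_Union[OF Suc assms] by (simp only:)
  qed
  then have "small_for TYPE('u) (\<Union>n\<in>(UNIV :: nat set). (R ^^ n) `` {x})"
    by (intro small_for_Union[OF small_for_countable]) simp_all
  moreover have "R\<^sup>* `` {x} = (\<Union>n\<in>(UNIV :: nat set). (R ^^ n) `` {x})"
    unfolding rtrancl_is_UN_relpow by blast
  ultimately show ?thesis by (simp only:)
qed

end

section \<open>Categories and functors\<close>

context category
begin

lemmas cat_simps [simp] = ide_in_hom cmp_in_hom cmp_ide_left cmp_ide_right

text \<open>Reverses \<open>cmp_assoc\<close>, so that simp nests composites to the right. An
  equation whose left side is itself a composite then matches only after regrouping, which is why
  later proofs flip this rule or carry a trailing arrow along.\<close>

lemma assoc [simp]: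
  "\<lbrakk>w \<in> Ob C; x \<in> Ob C; y \<in> Ob C; z \<in> Ob C; f \<in> Hom C w x; g \<in> Hom C x y; h \<in> Hom C y z\<rbrakk>
    \<Longrightarrow> Cmp C w x z (Cmp C x y z h g) f = Cmp C w y z h (Cmp C w x y g f)"
  by (simp add: cmp_assoc)

end

context is_functor
begin

lemmas functor_simps [simp] = fob_in fmor_in fmor_ide fmor_cmp

end

context nat_trans
begin

lemmas component_simps [simp] = component_in

end

lemma id_func_simps [simp]: "FOb id_func x = x" "FMor id_func x y f = f"
  by (simp_all add: id_func_def)

lemma comp_func_simps [simp]:
  "FOb (H \<circ>\<^sub>F F) x = FOb H (FOb F x)"
  "FMor (H \<circ>\<^sub>F F) x y f = FMor H (FOb F x) (FOb F y) (FMor F x y f)"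
  by (simp_all add: comp_func_def)

lemma forgetful_simps [simp]: "FOb forgetful x = fst x" "FMor forgetful x y f = f"
  by (simp_all add: forgetful_def)

lemma is_functor_comp:
  assumes "is_functor A B F" "is_functor B C H"
  shows "is_functor A C (H \<circ>\<^sub>F F)"
proof -
  interpret F: is_functor A B F by fact
  interpret H: is_functor B C H by fact
  show ?thesis by unfold_locales auto
qed

lemma is_functor_id: "category C \<Longrightarrow> is_functor C C id_func"
  by (simp add: is_functor_def is_functor_axioms_def)

text \<open>Representables depend contravariantly on the representing object, so a diagram of them
  lives on the opposite of a category of elements.\<close>

definition op_cat :: "('o, 'm) cat \<Rightarrow> ('o, 'm) cat" where
  "op_cat C = \<lparr>Ob = Ob C, Hom = (\<lambda>x y. Hom C y x), Ide = Ide C,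
     Cmp = (\<lambda>x y z g f. Cmp C z y x f g)\<rparr>"

lemma op_cat_simps [simp]:
  "Ob (op_cat C) = Ob C" "Hom (op_cat C) x y = Hom C y x" "Ide (op_cat C) = Ide C"
  "Cmp (op_cat C) x y z g f = Cmp C z y x f g"
  by (simp_all add: op_cat_def)

lemma category_op_cat: "category C \<Longrightarrow> category (op_cat C)"
proof -
  assume "category C"
  then interpret category C .
  show ?thesis by unfold_locales auto
qed

lemma small_cat_op_cat: "small_cat J \<Longrightarrow> small_cat (op_cat J)"
  by (simp add: small_cat_def locally_small_def category_op_cat)

subsection \<open>Set-valued functors\<close>

lemma Set_cat_simps [simp]:
  "Ob Set_cat = {X. small X}" "Hom Set_cat X Y = X \<rightarrow>\<^sub>E Y" "Ide Set_cat X = (\<lambda>x\<in>X. x)"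
  "Cmp Set_cat X Y Z g f = compose X g f"
  by (simp_all add: Set_cat_def)

lemma category_Set_cat: "category (Set_cat :: ('u set, 'u \<Rightarrow> 'u) cat)"
proof
  fix x y :: "'u set" and f assume "f \<in> Hom Set_cat x y"
  then show "Cmp Set_cat x y y (Ide Set_cat y) f = f"
    and "Cmp Set_cat x x y f (Ide Set_cat x) = f"
    by (auto simp: compose_def fun_eq_iff restrict_def PiE_iff extensional_def)
qed (auto simp: compose_def fun_eq_iff restrict_def PiE_iff extensional_def Pi_iff)

text \<open>Set-valued functors are handled through elements. The inherited simp rules about whole
  arrows of \<open>Set_cat\<close> are switched off at the end of the context, in favour of
  \<open>act_ide\<close> and \<open>act_cmp\<close>.\<close>

locale set_functor = is_functor C Set_cat P 
  for C :: "('o, 'u) cat" and P :: "('o, 'u set, 'u, 'u \<Rightarrow> 'u) func"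
begin

lemma fmor_PiE: "\<lbrakk>x \<in> Ob C; y \<in> Ob C; f \<in> Hom C x y\<rbrakk> \<Longrightarrow> FMor P x y f \<in> FOb P x \<rightarrow>\<^sub>E FOb P y"
  using fmor_in by simp

lemma act_in [simp]:
  "\<lbrakk>x \<in> Ob C; y \<in> Ob C; f \<in> Hom C x y; p \<in> FOb P x\<rbrakk> \<Longrightarrow> FMor P x y f p \<in> FOb P y"
  using fmor_PiE by blast

lemma act_ide [simp]: "\<lbrakk>x \<in> Ob C; p \<in> FOb P x\<rbrakk> \<Longrightarrow> FMor P x x (Ide C x) p = p"
  by simp

lemma act_cmp [simp]:
  "\<lbrakk>x \<in> Ob C; y \<in> Ob C; z \<in> Ob C; f \<in> Hom C x y; g \<in> Hom C y z; p \<in> FOb P x\<rbrakk>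
    \<Longrightarrow> FMor P x z (Cmp C x y z g f) p = FMor P y z g (FMor P x y f p)"
  by (simp add: compose_def del: PiE_iff)

declare functor_simps [simp del]

end

text \<open>Arrows of \<open>Set_cat\<close> are extensional functions, so both functor laws may be
  checked on elements.\<close>

lemma set_functorI:
  assumes "category C"
    and "\<And>x. x \<in> Ob C \<Longrightarrow> small (FOb P x)"
    and "\<And>x y f. \<lbrakk>x \<in> Ob C; y \<in> Ob C; f \<in> Hom C x y\<rbrakk> \<Longrightarrow> FMor P x y f \<in> FOb P x \<rightarrow>\<^sub>E FOb P y"
    and "\<And>x p. \<lbrakk>x \<in> Ob C; p \<in> FOb P x\<rbrakk> \<Longrightarrow> FMor P x x (Ide C x) p = p"
    and "\<And>x y z f g p. \<lbrakk>x \<in> Ob C; y \<in> Ob C; z \<in> Ob C; f \<in> Hom C x y; g \<in> Hom C y z; p \<in> FOb P x\<rbrakk>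
      \<Longrightarrow> FMor P x z (Cmp C x y z g f) p = FMor P y z g (FMor P x y f p)"
  shows "set_functor C P"
proof -
  interpret C: category C by fact
  interpret S: category Set_cat by (rule category_Set_cat)
  show ?thesis
  proof
    fix x assume x: "x \<in> Ob C"
    have "FMor P x x (Ide C x) \<in> FOb P x \<rightarrow>\<^sub>E FOb P x"
      using assms(3)[OF x x] x by simp
    then show "FMor P x x (Ide C x) = Ide Set_cat (FOb P x)"
      using assms(4)[OF x] by (intro ext) (auto simp: restrict_def PiE_def extensional_def)
  next
    fix x y z f g
    assume *: "x \<in> Ob C" "y \<in> Ob C" "z \<in> Ob C" "f \<in> Hom C x y" "g \<in> Hom C y z"
    have "FMor P x z (Cmp C x y z g f) \<in> FOb P x \<rightarrow>\<^sub>E FOb P z"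
      using * by (intro assms(3)) auto
    then show "FMor P x z (Cmp C x y z g f)
        = Cmp Set_cat (FOb P x) (FOb P y) (FOb P z) (FMor P y z g) (FMor P x y f)"
      using assms(5)[OF *] by (intro ext) (auto simp: compose_def restrict_def PiE_def extensional_def)
  qed (use assms in auto)
qed

lemma hom_func_simps [simp]:
  "FOb (hom_func C c) x = Hom C c x"
  "FMor (hom_func C c) x y f = (\<lambda>g\<in>Hom C c x. Cmp C c x y f g)"
  by (simp_all add: hom_func_def)

lemma set_functor_hom_func:
  assumes "locally_small C" "c \<in> Ob C"
  shows "set_functor C (hom_func C c)"
proof -
  interpret category C using assms by (simp add: locally_small_def)
  show ?thesis
    using assms by (intro set_functorI) (auto simp: locally_small_def category_axioms)
qed

lemma set_functor_comp:
  "is_functor A B F \<Longrightarrow> set_functor B P \<Longrightarrow> set_functor A (P \<circ>\<^sub>F F)"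
  by (simp add: set_functor_def is_functor_comp)

subsection \<open>Functor categories\<close>

lemma functor_cat_simps [simp]:
  "Ob (functor_cat C D) = {F. is_functor C D F}"
  "Hom (functor_cat C D) F F' = {\<tau>. nat_trans C D F F' \<tau> \<and> \<tau> \<in> extensional (Ob C)}"
  "Ide (functor_cat C D) F = (\<lambda>x\<in>Ob C. Ide D (FOb F x))"
  "Cmp (functor_cat C D) F F' F'' \<sigma> \<tau>
    = (\<lambda>x\<in>Ob C. Cmp D (FOb F x) (FOb F' x) (FOb F'' x) (\<sigma> x) (\<tau> x))"
  by (simp_all add: functor_cat_def)

lemma category_functor_cat:
  fixes C :: "('a, 'm) cat" and D :: "('b, 'n) cat"
  assumes "category C" "category D"
  shows "category (functor_cat C D)"
proof -
  interpret C: category C by fact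
  interpret D: category D by fact
  show ?thesis
  proof
    fix F :: "('a, 'b, 'm, 'n) func" assume "F \<in> Ob (functor_cat C D)"
    then interpret F: is_functor C D F by simp
    show "Ide (functor_cat C D) F \<in> Hom (functor_cat C D) F F"
      by (auto intro!: nat_trans.intro F.is_functor_axioms nat_trans_axioms.intro)
  next
    fix F F' F'' :: "('a, 'b, 'm, 'n) func" and \<sigma> \<tau>
    assume "\<tau> \<in> Hom (functor_cat C D) F F'" "\<sigma> \<in> Hom (functor_cat C D) F' F''"
    then interpret \<tau>: nat_trans C D F F' \<tau> + \<sigma>: nat_trans C D F' F'' \<sigma> by simp_all
    have "nat_trans C D F F'' (Cmp (functor_cat C D) F F' F'' \<sigma> \<tau>)"
    proof
      fix x y f assume *: "x \<in> Ob C" "y \<in> Ob C" "f \<in> Hom C x y"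
      have "Cmp D (FOb F x) (FOb F' y) (FOb F'' y) (\<sigma> y) (Cmp D (FOb F x) (FOb F y) (FOb F' y) (\<tau> y) (FMor F x y f))
        = Cmp D (FOb F x) (FOb F'' x) (FOb F'' y) (FMor F'' x y f) (Cmp D (FOb F x) (FOb F' x) (FOb F'' x) (\<sigma> x) (\<tau> x))"
        using * \<sigma>.naturality[OF *] by (simp add: \<tau>.naturality flip: D.assoc)
      then show "Cmp D (FOb F x) (FOb F y) (FOb F'' y) (Cmp (functor_cat C D) F F' F'' \<sigma> \<tau> y) (FMor F x y f)
        = Cmp D (FOb F x) (FOb F'' x) (FOb F'' y) (FMor F'' x y f) (Cmp (functor_cat C D) F F' F'' \<sigma> \<tau> x)"
        using * by simp
    qed auto
    then show "Cmp (functor_cat C D) F F' F'' \<sigma> \<tau> \<in> Hom (functor_cat C D) F F''" by simp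
  next
    fix F F' :: "('a, 'b, 'm, 'n) func" and \<tau>
    assume "\<tau> \<in> Hom (functor_cat C D) F F'"
    then interpret nat_trans C D F F' \<tau> by simp
    have [simp]: "\<tau> \<in> extensional (Ob C)" using \<open>\<tau> \<in> _\<close> by simp
    show "Cmp (functor_cat C D) F F' F' (Ide (functor_cat C D) F') \<tau> = \<tau>"
      by (rule extensionalityI[of _ "Ob C"]) auto
    show "Cmp (functor_cat C D) F F F' \<tau> (Ide (functor_cat C D) F) = \<tau>"
      by (rule extensionalityI[of _ "Ob C"]) auto
  next
    fix F1 F2 F3 F4 :: "('a, 'b, 'm, 'n) func" and \<sigma> \<tau> \<rho>
    assume "\<rho> \<in> Hom (functor_cat C D) F1 F2" "\<tau> \<in> Hom (functor_cat C D) F2 F3"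
      "\<sigma> \<in> Hom (functor_cat C D) F3 F4"
    then interpret \<rho>: nat_trans C D F1 F2 \<rho> + \<tau>: nat_trans C D F2 F3 \<tau> + \<sigma>: nat_trans C D F3 F4 \<sigma>
      by simp_all
    show "Cmp (functor_cat C D) F1 F3 F4 \<sigma> (Cmp (functor_cat C D) F1 F2 F3 \<tau> \<rho>) =
       Cmp (functor_cat C D) F1 F2 F4 (Cmp (functor_cat C D) F2 F3 F4 \<sigma> \<tau>) \<rho>"
      by (rule extensionalityI[of _ "Ob C"]) auto
  qed
qed

lemma isomorphic_in_refl: "category C \<Longrightarrow> x \<in> Ob C \<Longrightarrow> isomorphic_in C x x"
  unfolding isomorphic_in_def
  by (intro conjI bexI[of _ "Ide C x"]) (auto intro: category.ide_in_hom category.cmp_ide_left)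

lemma set_nat_trans_iff:
  assumes "set_functor C P" "set_functor C Q"
  shows "nat_trans C Set_cat P Q \<tau> \<longleftrightarrow>
    (\<forall>x\<in>Ob C. \<tau> x \<in> FOb P x \<rightarrow>\<^sub>E FOb Q x) \<and>
    (\<forall>x\<in>Ob C. \<forall>y\<in>Ob C. \<forall>f\<in>Hom C x y. \<forall>p\<in>FOb P x. \<tau> y (FMor P x y f p) = FMor Q x y f (\<tau> x p))"
    (is "_ \<longleftrightarrow> ?R")
proof -
  interpret P: set_functor C P by fact
  interpret Q: set_functor C Q by fact
  have *: "compose X g f = compose X g' f' \<longleftrightarrow> (\<forall>p\<in>X. g (f p) = g' (f' p))" for X :: "'b set" and g f g' f'
    by (auto simp: compose_def restrict_def fun_eq_iff)
  show ?thesis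
    unfolding nat_trans_def nat_trans_axioms_def
    using P.is_functor_axioms Q.is_functor_axioms by (auto simp: *)
qed

lemma set_hom_iff:
  assumes "set_functor C P" "set_functor C Q"
  shows "\<tau> \<in> Hom (functor_cat C Set_cat) P Q \<longleftrightarrow> \<tau> \<in> extensional (Ob C) \<and>
    (\<forall>x\<in>Ob C. \<tau> x \<in> FOb P x \<rightarrow>\<^sub>E FOb Q x) \<and>
    (\<forall>x\<in>Ob C. \<forall>y\<in>Ob C. \<forall>f\<in>Hom C x y. \<forall>p\<in>FOb P x. \<tau> y (FMor P x y f p) = FMor Q x y f (\<tau> x p))"
  using set_nat_trans_iff[OF assms] by auto

lemma set_homD:
  fixes C :: "('o, 'u) cat" and P Q :: "('o, 'u set, 'u, 'u \<Rightarrow> 'u) func"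
  assumes "\<tau> \<in> Hom (functor_cat C Set_cat) P Q" "x \<in> Ob C"
  shows "\<tau> x \<in> FOb P x \<rightarrow>\<^sub>E FOb Q x"
    and "p \<in> FOb P x \<Longrightarrow> \<tau> x p \<in> FOb Q x"
    and "\<lbrakk>p \<in> FOb P x; y \<in> Ob C; f \<in> Hom C x y\<rbrakk> \<Longrightarrow> \<tau> y (FMor P x y f p) = FMor Q x y f (\<tau> x p)"
proof -
  interpret nat_trans C Set_cat P Q \<tau> using assms(1) by simp
  have "set_functor C P" "set_functor C Q"
    by (simp_all add: set_functor_def source.is_functor_axioms target.is_functor_axioms)
  note * = iffD1[OF set_hom_iff[OF this] assms(1)]
  show "\<tau> x \<in> FOb P x \<rightarrow>\<^sub>E FOb Q x"
    and "p \<in> FOb P x \<Longrightarrow> \<tau> x p \<in> FOb Q x"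
    and "\<lbrakk>p \<in> FOb P x; y \<in> Ob C; f \<in> Hom C x y\<rbrakk> \<Longrightarrow> \<tau> y (FMor P x y f p) = FMor Q x y f (\<tau> x p)"
    using * assms(2) by auto
qed

text \<open>Extensionality acts twice, in the object and in the element; this is what reduces every
  commuting triangle of transformations to an elementwise equation.\<close>

lemma set_cmp_eq_iff:
  assumes "\<rho> \<in> extensional (Ob C)" "\<And>z. z \<in> Ob C \<Longrightarrow> \<rho> z \<in> extensional (FOb F z)"
  shows "Cmp (functor_cat C Set_cat) F F' F'' \<sigma> \<tau> = \<rho> \<longleftrightarrow>
    (\<forall>z\<in>Ob C. \<forall>p\<in>FOb F z. \<sigma> z (\<tau> z p) = \<rho> z p)"
proof
  assume L: "Cmp (functor_cat C Set_cat) F F' F'' \<sigma> \<tau> = \<rho>"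
  show "\<forall>z\<in>Ob C. \<forall>p\<in>FOb F z. \<sigma> z (\<tau> z p) = \<rho> z p"
    unfolding L[symmetric] by (simp add: compose_def)
next
  assume R: "\<forall>z\<in>Ob C. \<forall>p\<in>FOb F z. \<sigma> z (\<tau> z p) = \<rho> z p"
  show "Cmp (functor_cat C Set_cat) F F' F'' \<sigma> \<tau> = \<rho>"
  proof (rule extensionalityI[of _ "Ob C"])
    fix z assume z: "z \<in> Ob C"
    show "Cmp (functor_cat C Set_cat) F F' F'' \<sigma> \<tau> z = \<rho> z"
      by (rule extensionalityI[of _ "FOb F z"]) (use z R assms in \<open>auto simp: compose_def\<close>)
  qed (use assms in auto)
qed

lemma set_cmp_apply [simp]:
  "z \<in> Ob C \<Longrightarrow> p \<in> FOb F z \<Longrightarrow>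
    Cmp (functor_cat C Set_cat) F F' F'' \<sigma> \<tau> z p = \<sigma> z (\<tau> z p)"
  by (simp add: compose_def)

section \<open>Small functors through their elements\<close>

text \<open>A pair \<open>(m, k)\<close> is an element at \<open>z\<close> of the coproduct of the
  representables on \<open>M\<close>. The relation is the one by which the colimit formula
  identifies such elements along arrows \<open>t\<close> of the category of elements.\<close>

definition step ::
  "('o, 'u) cat \<Rightarrow> ('o, 'u set, 'u, 'u \<Rightarrow> 'u) func \<Rightarrow> ('o \<times> 'u) set \<Rightarrow> 'o \<Rightarrow> (('o \<times> 'u) \<times> 'u) rel" where
  "step C P M z = {((m, k), (m', k')). m \<in> M \<and> m' \<in> M \<and>
     k \<in> Hom C (fst m) z \<and> k' \<in> Hom C (fst m') z \<and>
     (\<exists>t\<in>Hom C (fst m) (fst m'). FMor P (fst m) (fst m') t (snd m) = snd m' \<and>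
        k = Cmp C (fst m) (fst m') z k' t)}"

definition zigzag ::
  "('o, 'u) cat \<Rightarrow> ('o, 'u set, 'u, 'u \<Rightarrow> 'u) func \<Rightarrow> ('o \<times> 'u) set \<Rightarrow> 'o \<Rightarrow> (('o \<times> 'u) \<times> 'u) rel" where
  "zigzag C P M z = (step C P M z \<union> (step C P M z)\<inverse>)\<^sup>*"

text \<open>\<open>P\<close> is the colimit of the representables on the objects underlying \<open>M\<close>, taken over the
  full subcategory on \<open>M\<close> of the category of elements of \<open>P\<close>.\<close>

definition presents ::
  "('o, 'u) cat \<Rightarrow> ('o, 'u set, 'u, 'u \<Rightarrow> 'u) func \<Rightarrow> ('o \<times> 'u) set \<Rightarrow> bool" where
  "presents C P M \<longleftrightarrow> small_for TYPE('u) M \<and>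
     (\<forall>m\<in>M. fst m \<in> Ob C \<and> snd m \<in> FOb P (fst m)) \<and>
     (\<forall>z\<in>Ob C. \<forall>p\<in>FOb P z. \<exists>m\<in>M. \<exists>k\<in>Hom C (fst m) z. FMor P (fst m) z k (snd m) = p) \<and>
     (\<forall>z\<in>Ob C. \<forall>m\<in>M. \<forall>m'\<in>M. \<forall>k\<in>Hom C (fst m) z. \<forall>k'\<in>Hom C (fst m') z.
        FMor P (fst m) z k (snd m) = FMor P (fst m') z k' (snd m') \<longrightarrow>
        ((m, k), (m', k')) \<in> zigzag C P M z)"

lemma presents_generates:
  assumes "presents C P M" "z \<in> Ob C" "p \<in> FOb P z"
  obtains m k where "m \<in> M" "fst m \<in> Ob C" "snd m \<in> FOb P (fst m)" "k \<in> Hom C (fst m) z"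
    "FMor P (fst m) z k (snd m) = p"
  using assms unfolding presents_def by metis

lemma presents_zigzag:
  assumes "presents C P M" "z \<in> Ob C" "m \<in> M" "m' \<in> M" "k \<in> Hom C (fst m) z" "k' \<in> Hom C (fst m') z"
    "FMor P (fst m) z k (snd m) = FMor P (fst m') z k' (snd m')"
  shows "((m, k), (m', k')) \<in> zigzag C P M z"
  using assms unfolding presents_def by blast

lemma presents_element:
  "presents C P M \<Longrightarrow> m \<in> M \<Longrightarrow> fst m \<in> Ob C \<and> snd m \<in> FOb P (fst m)"
  by (simp add: presents_def)

lemma zigzag_refl: "(p, p) \<in> zigzag C P M z"
  by (simp add: zigzag_def)

lemma zigzag_sym: "(p, q) \<in> zigzag C P M z \<Longrightarrow> (q, p) \<in> zigzag C P M z"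
  unfolding zigzag_def by (metis sym_Un_converse sym_rtrancl symD)

lemma zigzag_trans:
  "(p, q) \<in> zigzag C P M z \<Longrightarrow> (q, r) \<in> zigzag C P M z \<Longrightarrow> (p, r) \<in> zigzag C P M z"
  unfolding zigzag_def by (rule rtrancl_trans)

lemma zigzag_step: "(p, q) \<in> step C P M z \<Longrightarrow> (p, q) \<in> zigzag C P M z"
  unfolding zigzag_def by blast

lemma zigzag_map:
  assumes "(p, q) \<in> zigzag C P M z"
    and step: "\<And>p q. (p, q) \<in> step C P M z \<Longrightarrow> (\<phi> p, \<phi> q) \<in> zigzag C' P' M' z'"
  shows "(\<phi> p, \<phi> q) \<in> zigzag C' P' M' z'"
  using assms(1) unfolding zigzag_def[of C]
proof (induction rule: rtrancl_induct)
  case base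
  then show ?case by (rule zigzag_refl)
next
  case (step q r)
  then show ?case by (metis Un_iff assms(2) converseD zigzag_sym zigzag_trans)
qed

text \<open>The source of well-definedness: what is prescribed on pairs \<open>(m, k)\<close> and
  respects single steps descends to the elements that they represent.\<close>

lemma zigzag_invariant:
  assumes "(p, q) \<in> zigzag C P M z"
    and step: "\<And>p q. (p, q) \<in> step C P M z \<Longrightarrow> \<phi> p = \<phi> q"
  shows "\<phi> p = \<phi> q"
  using assms(1) unfolding zigzag_def[of C]
  by (induction rule: rtrancl_induct) (use step in force)+

text \<open>A full subcategory of the category of elements. Its objects are codes in
  \<open>'u\<close>, with \<open>e\<close> naming the element, so that it can be a
  \<open>small_cat\<close>; its opposite indexes colimits of representables, and it indexes itself
  the limits of Kan extensions.\<close>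

definition elements_cat ::
  "('o, 'u) cat \<Rightarrow> ('o, 'u set, 'u, 'u \<Rightarrow> 'u) func \<Rightarrow> 'u set \<Rightarrow> ('u \<Rightarrow> 'o \<times> 'u) \<Rightarrow> ('u, 'u) cat" where
  "elements_cat C P I e =
     \<lparr>Ob = I,
      Hom = (\<lambda>i j. {t \<in> Hom C (fst (e i)) (fst (e j)).
        FMor P (fst (e i)) (fst (e j)) t (snd (e i)) = snd (e j)}),
      Ide = (\<lambda>i. Ide C (fst (e i))),
      Cmp = (\<lambda>i j k. Cmp C (fst (e i)) (fst (e j)) (fst (e k)))\<rparr>"

lemma elements_cat_simps [simp]:
  "Ob (elements_cat C P I e) = I"
  "Hom (elements_cat C P I e) i j = {t \<in> Hom C (fst (e i)) (fst (e j)).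
     FMor P (fst (e i)) (fst (e j)) t (snd (e i)) = snd (e j)}"
  "Ide (elements_cat C P I e) i = Ide C (fst (e i))"
  "Cmp (elements_cat C P I e) i j k g f = Cmp C (fst (e i)) (fst (e j)) (fst (e k)) g f"
  by (simp_all add: elements_cat_def)

section \<open>From presentations to colimits of representables\<close>

context set_functor
begin

lemma category_elements_cat:
  assumes "\<And>i. i \<in> I \<Longrightarrow> fst (e i) \<in> Ob C \<and> snd (e i) \<in> FOb P (fst (e i))"
  shows "category (elements_cat C P I e)"
  by unfold_locales (use assms in auto)

lemma small_cat_elements_cat:
  assumes "locally_small C" "small I"
    and "\<And>i. i \<in> I \<Longrightarrow> fst (e i) \<in> Ob C \<and> snd (e i) \<in> FOb P (fst (e i))"
  shows "small_cat (elements_cat C P I e)"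
proof -
  have "small (Hom (elements_cat C P I e) i j)" if "i \<in> I" "j \<in> I" for i j
  proof -
    have "small_for TYPE('u) (Hom C (fst (e i)) (fst (e j)))"
      using assms(1) assms(3)[OF that(1)] assms(3)[OF that(2)]
      by (simp add: locally_small_def small_for_small_iff)
    then have "small_for TYPE('u) (Hom (elements_cat C P I e) i j)"
      by (rule small_for_subset) auto
    then show ?thesis by (simp add: small_for_small_iff)
  qed
  then show ?thesis
    using category_elements_cat[of I e] assms by (simp add: small_cat_def locally_small_def)
qed

text \<open>The two conditions on \<open>M\<close> are the two halves of the universal property:
  generation makes a map out of \<open>P\<close> unique, and zigzags make the map prescribed by a
  cocone well defined.\<close>

theorem small_functor_of_presents:
  assumes C: "locally_small C" and M: "presents C P M"
  shows "small_functor C P"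
proof -
  have "small_for TYPE('u) M" using M by (simp add: presents_def)
  then obtain I :: "'u set" and e where I: "small I" "inj_on e I" "M = e ` I"
    by (rule small_for_index)
  define c where "c i = fst (e i)" for i
  define x where "x i = snd (e i)" for i
  have cx [simp]: "c i \<in> Ob C" "x i \<in> FOb P (c i)" if "i \<in> I" for i
    using presents_element[OF M] that unfolding I(3) c_def x_def by auto
  have el: "fst (e i) \<in> Ob C \<and> snd (e i) \<in> FOb P (fst (e i))" if "i \<in> I" for i
    using presents_element[OF M] that unfolding I(3) by auto
  define J where "J = op_cat (elements_cat C P I e)"
  have J: "small_cat J"
    unfolding J_def using small_cat_elements_cat[OF C I(1) el] by (rule small_cat_op_cat)
  interpret J: category J
    using J by (simp add: small_cat_def locally_small_def)
  have J_simps [simp]: "Ob J = I" "Hom J i j = {t \<in> Hom C (c j) (c i). FMor P (c j) (c i) t (x j) = x i}"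
    "Ide J i = Ide C (c i)" "Cmp J i j k g f = Cmp C (c k) (c j) (c i) f g" for i j k f g
    by (simp_all add: J_def c_def x_def)
  \<comment> \<open>An arrow \<open>t : c j -> c i\<close> between elements acts by precomposition,
    from the representable on \<open>c i\<close> to the one on \<open>c j\<close>; hence the
    opposite category in \<open>J\<close>.\<close>
  define D :: "('u, _, 'u, _) func" where
    "D = \<lparr>FOb = (\<lambda>i. hom_func C (c i)), FMor = (\<lambda>i j t. \<lambda>z\<in>Ob C. \<lambda>k\<in>Hom C (c i) z. Cmp C (c j) (c i) z k t)\<rparr>"
  have D_simps [simp]: "FOb D i = hom_func C (c i)"
    "FMor D i j t = (\<lambda>z\<in>Ob C. \<lambda>k\<in>Hom C (c i) z. Cmp C (c j) (c i) z k t)" for i j t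
    by (simp_all add: D_def)
  have sf: "set_functor C (hom_func C (c i))" if "i \<in> I" for i
    using set_functor_hom_func[OF C] that by simp
  have P: "set_functor C P" by unfold_locales
  let ?F = "functor_cat C (Set_cat :: ('u set, 'u \<Rightarrow> 'u) cat)"
  interpret F: category ?F
    using category_functor_cat[OF dom.category_axioms category_Set_cat] .
  have D: "is_functor J ?F D"
  proof
    fix i assume "i \<in> Ob J" then show "FOb D i \<in> Ob ?F"
      using sf by (simp add: set_functor_def)
  next
    fix i j t assume "i \<in> Ob J" "j \<in> Ob J" "t \<in> Hom J i j"
    then show "FMor D i j t \<in> Hom ?F (FOb D i) (FOb D j)"
      using sf by (subst set_hom_iff) auto
  next
    fix i assume i: "i \<in> Ob J"
    show "FMor D i i (Ide J i) = Ide ?F (FOb D i)"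
      using i by (auto intro!: restrict_ext)
  next
    fix i j k t s assume *: "i \<in> Ob J" "j \<in> Ob J" "k \<in> Ob J" "t \<in> Hom J i j" "s \<in> Hom J j k"
    show "FMor D i k (Cmp J i j k s t) = Cmp ?F (FOb D i) (FOb D j) (FOb D k) (FMor D j k s) (FMor D i j t)"
      by (rule sym, subst set_cmp_eq_iff) (use * in auto)
  qed
  \<comment> \<open>The map out of a representable that Yoneda assigns to the element
    \<open>x i\<close>.\<close>
  define \<iota> where "\<iota> i = (\<lambda>z\<in>Ob C. \<lambda>k\<in>Hom C (c i) z. FMor P (c i) z k (x i))" for i
  have cocone: "is_cocone J ?F D P \<iota>"
    unfolding is_cocone_def
  proof (intro conjI ballI)
    show "P \<in> Ob ?F" using P by (simp add: set_functor_def)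
  next
    fix j assume "j \<in> Ob J" then show "\<iota> j \<in> Hom ?F (FOb D j) P"
      using sf P by (subst set_hom_iff) (auto simp: \<iota>_def)
  next
    fix i j t assume *: "i \<in> Ob J" "j \<in> Ob J" "t \<in> Hom J i j"
    show "Cmp ?F (FOb D i) (FOb D j) P (\<iota> j) (FMor D i j t) = \<iota> i"
      by (subst set_cmp_eq_iff) (use * in \<open>auto simp: \<iota>_def\<close>)
  qed
  have "\<exists>!h. h \<in> Hom ?F P Y \<and> (\<forall>j\<in>Ob J. Cmp ?F (FOb D j) P Y h (\<iota> j) = \<kappa> j)"
    if Y: "is_cocone J ?F D Y \<kappa>" for Y \<kappa>
  proof -
    have YF: "set_functor C Y"
      using Y by (simp add: is_cocone_def set_functor_def)
    interpret Y: set_functor C Y by fact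
    have \<kappa>: "\<kappa> i \<in> Hom ?F (hom_func C (c i)) Y" if "i \<in> I" for i
      using Y that by (simp add: is_cocone_def)
    have \<kappa>_in [simp]: "\<kappa> i z k \<in> FOb Y z" if "i \<in> I" "z \<in> Ob C" "k \<in> Hom C (c i) z" for i z k
      using set_homD(2)[OF \<kappa>] that by simp
    have \<kappa>_nat: "\<kappa> i z' (Cmp C (c i) z z' f k) = FMor Y z z' f (\<kappa> i z k)"
      if "i \<in> I" "z \<in> Ob C" "z' \<in> Ob C" "k \<in> Hom C (c i) z" "f \<in> Hom C z z'" for i z z' f k
      using set_homD(3)[OF \<kappa>, of i z k z' f] that by simp
    have \<kappa>_coc: "\<kappa> j z (Cmp C (c j) (c i) z k t) = \<kappa> i z k"
      if *: "i \<in> I" "j \<in> I" "t \<in> Hom C (c j) (c i)" "FMor P (c j) (c i) t (x j) = x i"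
        and z: "z \<in> Ob C" "k \<in> Hom C (c i) z" for i j t z k
    proof -
      have "Cmp ?F (FOb D i) (FOb D j) Y (\<kappa> j) (FMor D i j t) = \<kappa> i"
        using Y * unfolding is_cocone_def by simp
      then have "Cmp ?F (FOb D i) (FOb D j) Y (\<kappa> j) (FMor D i j t) z k = \<kappa> i z k" by simp
      then show ?thesis using z by (subst (asm) set_cmp_apply) auto
    qed
    \<comment> \<open>Defined on a generator and an arrow instead of an index and an arrow, so that
      \<open>zigzag_invariant\<close> applies; injectivity of \<open>e\<close> recovers the
      index.\<close>
    define val where "val z = (\<lambda>(m, k). \<kappa> (inv_into I e m) z k)" for z
    have val: "val z (e i, k) = \<kappa> i z k" if "i \<in> I" for i z k
      using that I(2) by (simp add: val_def)
    have well: "\<kappa> i z k = \<kappa> i' z k'"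
      if *: "i \<in> I" "i' \<in> I" "z \<in> Ob C" "k \<in> Hom C (c i) z" "k' \<in> Hom C (c i') z"
        and eq: "FMor P (c i) z k (x i) = FMor P (c i') z k' (x i')" for i i' z k k'
    proof -
      have "((e i, k), (e i', k')) \<in> zigzag C P M z"
        using * eq by (intro presents_zigzag[OF M]) (auto simp: I(3) c_def x_def)
      then have "val z (e i, k) = val z (e i', k')"
      proof (rule zigzag_invariant)
        fix p q assume "(p, q) \<in> step C P M z"
        then obtain j j' k k' t where "j \<in> I" "j' \<in> I" "p = (e j, k)" "q = (e j', k')"
          "k \<in> Hom C (c j) z" "k' \<in> Hom C (c j') z" "t \<in> Hom C (c j) (c j')"
          "FMor P (c j) (c j') t (x j) = x j'" "k = Cmp C (c j) (c j') z k' t"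
          unfolding step_def I(3) c_def x_def by auto
        then show "val z p = val z q"
          using \<kappa>_coc[of j' j t z k'] \<open>z \<in> Ob C\<close> by (simp add: val)
      qed
      then show ?thesis using * by (simp add: val)
    qed
    \<comment> \<open>Generation provides some representative of \<open>p\<close>, and
      \<open>well\<close> makes the value independent of it.\<close>
    define h where "h = (\<lambda>z\<in>Ob C. \<lambda>p\<in>FOb P z.
      val z (SOME q. \<exists>i k. q = (e i, k) \<and> i \<in> I \<and> k \<in> Hom C (c i) z \<and> FMor P (c i) z k (x i) = p))"
    have h: "h z (FMor P (c i) z k (x i)) = \<kappa> i z k"
      if *: "i \<in> I" "z \<in> Ob C" "k \<in> Hom C (c i) z" for i z k
    proof -
      let ?p = "FMor P (c i) z k (x i)"
      let ?R = "\<lambda>q. \<exists>i k. q = (e i, k) \<and> i \<in> I \<and> k \<in> Hom C (c i) z \<and> FMor P (c i) z k (x i) = ?p"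
      have "?R (Eps ?R)" by (rule someI[of ?R "(e i, k)"]) (use * in blast)
      then obtain i' k' where "Eps ?R = (e i', k')" "i' \<in> I" "k' \<in> Hom C (c i') z"
        "FMor P (c i') z k' (x i') = ?p" by blast
      then show ?thesis using * well[of i' i z k' k] by (simp add: h_def val)
    qed
    have gen: "\<exists>i k. i \<in> I \<and> k \<in> Hom C (c i) z \<and> FMor P (c i) z k (x i) = p"
      if "z \<in> Ob C" "p \<in> FOb P z" for z p
      using presents_generates[OF M that] unfolding I(3) c_def x_def by (metis imageE)
    show ?thesis
    proof (rule ex1I[of _ h], intro conjI ballI)
      show "h \<in> Hom ?F P Y"
        unfolding set_hom_iff[OF P YF]
      proof (intro conjI ballI)
        show "h \<in> extensional (Ob C)" by (simp add: h_def)
        fix z assume z: "z \<in> Ob C"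
        show "h z \<in> FOb P z \<rightarrow>\<^sub>E FOb Y z"
        proof
          fix p assume "p \<in> FOb P z"
          then obtain i k where "i \<in> I" "k \<in> Hom C (c i) z" "FMor P (c i) z k (x i) = p"
            using gen z by blast
          then show "h z p \<in> FOb Y z" using h[of i z k] z by auto
        qed (use z in \<open>simp add: h_def\<close>)
        fix z' f p assume *: "z' \<in> Ob C" "f \<in> Hom C z z'" "p \<in> FOb P z"
        then obtain i k where "i \<in> I" "k \<in> Hom C (c i) z" "FMor P (c i) z k (x i) = p"
          using gen z by blast
        then show "h z' (FMor P z z' f p) = FMor Y z z' f (h z p)"
          using h[of i z k] h[of i z' "Cmp C (c i) z z' f k"] * z \<kappa>_nat by auto
      qed
    next
      fix j assume j: "j \<in> Ob J"
      have "\<kappa> j \<in> extensional (Ob C)" "\<And>z. z \<in> Ob C \<Longrightarrow> \<kappa> j z \<in> extensional (Hom C (c j) z)"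
        using \<kappa>[of j] j set_homD(1)[OF \<kappa>, of j] by (auto simp: PiE_iff)
      then show "Cmp ?F (FOb D j) P Y h (\<iota> j) = \<kappa> j"
        by (subst set_cmp_eq_iff) (use j h in \<open>auto simp: \<iota>_def\<close>)
    next
      fix h' assume h': "h' \<in> Hom ?F P Y \<and> (\<forall>j\<in>Ob J. Cmp ?F (FOb D j) P Y h' (\<iota> j) = \<kappa> j)"
      have h'_eq: "h' z p = h z p" if zp: "z \<in> Ob C" "p \<in> FOb P z" for z p
      proof -
        obtain i k where *: "i \<in> I" "k \<in> Hom C (c i) z" "FMor P (c i) z k (x i) = p"
          using gen zp by blast
        then have "Cmp ?F (FOb D i) P Y h' (\<iota> i) z k = \<kappa> i z k" using h' by simp
        then have "h' z (\<iota> i z k) = \<kappa> i z k" using * zp by (subst (asm) set_cmp_apply) auto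
        then show ?thesis using h * zp by (auto simp: \<iota>_def)
      qed
      have ext: "h' \<in> extensional (Ob C)" "\<And>z. z \<in> Ob C \<Longrightarrow> h' z \<in> extensional (FOb P z)"
        using h' set_homD(1)[of h' C P Y] by (auto simp: PiE_iff)
      show "h' = h"
      proof (rule extensionalityI[OF ext(1)])
        show "h \<in> extensional (Ob C)" by (simp add: h_def)
        fix z assume z: "z \<in> Ob C"
        show "h' z = h z"
          by (rule extensionalityI[OF ext(2)[OF z]]) (use z h'_eq in \<open>auto simp: h_def\<close>)
      qed
    qed
  qed
  then have "is_colimit J ?F D P \<iota>" using D cocone unfolding is_colimit_def by blast
  moreover have "\<forall>j\<in>Ob J. representable C (FOb D j)"
  proof
    fix j assume "j \<in> Ob J"
    moreover have "isomorphic_in ?F (hom_func C (c j)) (hom_func C (c j))"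
      using sf \<open>j \<in> Ob J\<close> by (intro isomorphic_in_refl F.category_axioms) (simp add: set_functor_def)
    ultimately show "representable C (FOb D j)"
      unfolding representable_def by auto
  qed
  ultimately show ?thesis using J unfolding small_functor_def by blast
qed

end

section \<open>From colimits of representables to presentations\<close>

context set_functor
begin

lemma step_act:
  assumes "\<And>m. m \<in> M \<Longrightarrow> fst m \<in> Ob C \<and> snd m \<in> FOb P (fst m)" "z \<in> Ob C"
    and "((m, k), (m', k')) \<in> step C P M z"
  shows "FMor P (fst m) z k (snd m) = FMor P (fst m') z k' (snd m')"
proof -
  obtain t where "m \<in> M" "m' \<in> M" "k \<in> Hom C (fst m) z" "k' \<in> Hom C (fst m') z"
    "t \<in> Hom C (fst m) (fst m')" "FMor P (fst m) (fst m') t (snd m) = snd m'"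
    "k = Cmp C (fst m) (fst m') z k' t"
    using assms(3) unfolding step_def by auto
  then show ?thesis using assms(1)[of m] assms(1)[of m'] assms(2) by simp
qed

lemma zigzag_act:
  assumes "\<And>m. m \<in> M \<Longrightarrow> fst m \<in> Ob C \<and> snd m \<in> FOb P (fst m)" "z \<in> Ob C"
    and "((m, k), (m', k')) \<in> zigzag C P M z"
  shows "FMor P (fst m) z k (snd m) = FMor P (fst m') z k' (snd m')"
  using zigzag_invariant[OF assms(3), of "\<lambda>(m, k). FMor P (fst m) z k (snd m)"]
    step_act[OF assms(1,2)] by auto

definition arrows_from :: "('o \<times> 'u) set \<Rightarrow> 'o \<Rightarrow> (('o \<times> 'u) \<times> 'u) set" where
  "arrows_from M z = (SIGMA m : M. Hom C (fst m) z)"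

lemma small_for_arrows_from:
  assumes "size_universe TYPE('u)" "locally_small C" "small_for TYPE('u) M" "z \<in> Ob C"
    "\<And>m. m \<in> M \<Longrightarrow> fst m \<in> Ob C"
  shows "small_for TYPE('u) (arrows_from M z)"
proof -
  have "arrows_from M z = (\<Union>m\<in>M. Pair m ` Hom C (fst m) z)"
    by (auto simp: arrows_from_def)
  moreover have "small_for TYPE('u) (Pair m ` Hom C (fst m) z)" if "m \<in> M" for m
    using assms that by (intro small_for_image) (simp add: small_for_small_iff locally_small_def)
  ultimately show ?thesis
    using small_for_Union[OF assms(1,3), of "\<lambda>m. Pair m ` Hom C (fst m) z"] by (simp only:)
qed

text \<open>The set of zigzag classes has to be coded inside \<open>'u\<close> to become the value of a functor to
  \<^const>\<open>Set_cat\<close>.\<close>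

lemma zigzag_classes:
  assumes "size_universe TYPE('u)" "locally_small C" "small_for TYPE('u) M"
    "\<And>m. m \<in> M \<Longrightarrow> fst m \<in> Ob C"
  obtains cls :: "'o \<Rightarrow> ('o \<times> 'u) \<times> 'u \<Rightarrow> 'u"
  where "\<And>z p q. \<lbrakk>z \<in> Ob C; p \<in> arrows_from M z; q \<in> arrows_from M z\<rbrakk>
    \<Longrightarrow> cls z p = cls z q \<longleftrightarrow> (p, q) \<in> zigzag C P M z"
proof -
  have "\<exists>f :: ('o \<times> 'u) \<times> 'u \<Rightarrow> 'u. inj_on f (arrows_from M z)" if "z \<in> Ob C" for z
    using small_for_inj[OF small_for_arrows_from[OF assms(1-3) that assms(4)]] by blast
  then obtain f :: "'o \<Rightarrow> ('o \<times> 'u) \<times> 'u \<Rightarrow> 'u"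
    where f: "\<And>z. z \<in> Ob C \<Longrightarrow> inj_on (f z) (arrows_from M z)" by metis
  \<comment> \<open>Related \<open>p\<close> and \<open>q\<close> give the same predicate, hence the
    same choice. Coding a chosen member of each class asks only for an injection on pairs and not on
    sets of pairs.\<close>
  define r where "r z p = (SOME q. q \<in> arrows_from M z \<and> (p, q) \<in> zigzag C P M z)" for z p
  have r: "r z p \<in> arrows_from M z \<and> (p, r z p) \<in> zigzag C P M z" if "p \<in> arrows_from M z" for z p
    unfolding r_def by (rule someI[of _ p]) (use that in \<open>simp add: zigzag_refl\<close>)
  have r_eq: "r z p = r z q" if "(p, q) \<in> zigzag C P M z" for z p q
  proof -
    have "(p, s) \<in> zigzag C P M z \<longleftrightarrow> (q, s) \<in> zigzag C P M z" for s
      using that zigzag_sym zigzag_trans by metis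
    then show ?thesis unfolding r_def by simp
  qed
  show thesis
  proof (rule that[of "\<lambda>z p. f z (r z p)"])
    fix z p q assume *: "z \<in> Ob C" "p \<in> arrows_from M z" "q \<in> arrows_from M z"
    show "f z (r z p) = f z (r z q) \<longleftrightarrow> (p, q) \<in> zigzag C P M z"
      using f[OF *(1)] r[OF *(2)] r[OF *(3)] r_eq zigzag_sym zigzag_trans
      by (metis inj_onD)
  qed
qed

end

text \<open>The functor \<open>Q\<close> of zigzag classes carries the same cocone as \<open>P\<close> and maps to \<open>P\<close> over it,
  so the universal property makes \<open>P\<close> a retract of \<open>Q\<close>, and \<open>P \<rightarrow> Q\<close> detects zigzags.\<close>

theorem presents_of_small_functor:
  fixes C :: "('o, 'u) cat" and P :: "('o, 'u set, 'u, 'u \<Rightarrow> 'u) func"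
  assumes U: "size_universe TYPE('u)" and C: "locally_small C" and P_small: "small_functor C P"
  obtains M where "presents C P M"
proof -
  let ?F = "functor_cat C (Set_cat :: ('u set, 'u \<Rightarrow> 'u) cat)"
  obtain J :: "('u, 'u) cat" and D \<iota> where J: "small_cat J"
    and rep: "\<And>j. j \<in> Ob J \<Longrightarrow> representable C (FOb D j)"
    and colim: "is_colimit J ?F D P \<iota>"
    using P_small unfolding small_functor_def by blast
  interpret C: category C using C by (simp add: locally_small_def)
  interpret S: category "Set_cat :: ('u set, 'u \<Rightarrow> 'u) cat" by (rule category_Set_cat)
  interpret D: is_functor J ?F D using colim by (simp add: is_colimit_def)
  have cocone: "is_cocone J ?F D P \<iota>" using colim by (simp add: is_colimit_def)
  have P: "set_functor C P" using cocone by (simp add: is_cocone_def set_functor_def)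
  interpret P: set_functor C P by fact
  have FD: "set_functor C (FOb D j)" if "j \<in> Ob J" for j
    using D.fob_in[OF that] by (simp add: set_functor_def)
  have "\<forall>j\<in>Ob J. \<exists>c \<theta> \<theta>'. c \<in> Ob C \<and> \<theta> \<in> Hom ?F (hom_func C c) (FOb D j) \<and>
      \<theta>' \<in> Hom ?F (FOb D j) (hom_func C c) \<and>
      Cmp ?F (hom_func C c) (FOb D j) (hom_func C c) \<theta>' \<theta> = Ide ?F (hom_func C c) \<and>
      Cmp ?F (FOb D j) (hom_func C c) (FOb D j) \<theta> \<theta>' = Ide ?F (FOb D j)"
    using rep unfolding representable_def isomorphic_in_def by blast
  then obtain c \<theta> \<theta>' where c: "\<And>j. j \<in> Ob J \<Longrightarrow> c j \<in> Ob C"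
    and \<theta>: "\<And>j. j \<in> Ob J \<Longrightarrow> \<theta> j \<in> Hom ?F (hom_func C (c j)) (FOb D j)"
    and \<theta>': "\<And>j. j \<in> Ob J \<Longrightarrow> \<theta>' j \<in> Hom ?F (FOb D j) (hom_func C (c j))"
    and inv: "\<And>j. j \<in> Ob J \<Longrightarrow> Cmp ?F (hom_func C (c j)) (FOb D j) (hom_func C (c j)) (\<theta>' j) (\<theta> j) = Ide ?F (hom_func C (c j))"
      "\<And>j. j \<in> Ob J \<Longrightarrow> Cmp ?F (FOb D j) (hom_func C (c j)) (FOb D j) (\<theta> j) (\<theta>' j) = Ide ?F (FOb D j)"
    by metis
  note [simp] = c
  have \<theta>_in [simp]: "\<theta> j z k \<in> FOb (FOb D j) z" if "j \<in> Ob J" "z \<in> Ob C" "k \<in> Hom C (c j) z" for j z k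
    using set_homD(2)[OF \<theta>] that by simp
  have \<theta>'_in [simp]: "\<theta>' j z y \<in> Hom C (c j) z" if "j \<in> Ob J" "z \<in> Ob C" "y \<in> FOb (FOb D j) z" for j z y
    using set_homD(2)[OF \<theta>'] that by simp
  have \<theta>_nat: "\<theta> j z' (Cmp C (c j) z z' f k) = FMor (FOb D j) z z' f (\<theta> j z k)"
    if "j \<in> Ob J" "z \<in> Ob C" "z' \<in> Ob C" "k \<in> Hom C (c j) z" "f \<in> Hom C z z'" for j z z' k f
    using set_homD(3)[OF \<theta>, of j z k z' f] that by simp
  have \<theta>'_nat: "\<theta>' j z' (FMor (FOb D j) z z' f y) = Cmp C (c j) z z' f (\<theta>' j z y)"
    if "j \<in> Ob J" "z \<in> Ob C" "z' \<in> Ob C" "y \<in> FOb (FOb D j) z" "f \<in> Hom C z z'" for j z z' y f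
    using set_homD(3)[OF \<theta>', of j z y z' f] that by simp
  have \<theta>'\<theta> [simp]: "\<theta>' j z (\<theta> j z k) = k" if "j \<in> Ob J" "z \<in> Ob C" "k \<in> Hom C (c j) z" for j z k
  proof -
    have "Cmp ?F (hom_func C (c j)) (FOb D j) (hom_func C (c j)) (\<theta>' j) (\<theta> j) z k = k"
      using that by (subst inv) auto
    then show ?thesis using that by (subst (asm) set_cmp_apply) auto
  qed
  have \<theta>\<theta>' [simp]: "\<theta> j z (\<theta>' j z y) = y" if "j \<in> Ob J" "z \<in> Ob C" "y \<in> FOb (FOb D j) z" for j z y
  proof -
    have "Cmp ?F (FOb D j) (hom_func C (c j)) (FOb D j) (\<theta> j) (\<theta>' j) z y = y"
      using that by (subst inv) auto
    then show ?thesis using that by (subst (asm) set_cmp_apply) auto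
  qed
  have \<iota>: "\<iota> j \<in> Hom ?F (FOb D j) P" if "j \<in> Ob J" for j
    using cocone that by (simp add: is_cocone_def)
  have \<iota>_in [simp]: "\<iota> j z y \<in> FOb P z" if "j \<in> Ob J" "z \<in> Ob C" "y \<in> FOb (FOb D j) z" for j z y
    using set_homD(2)[OF \<iota>] that by simp
  have \<iota>_nat: "\<iota> j z' (FMor (FOb D j) z z' f y) = FMor P z z' f (\<iota> j z y)"
    if "j \<in> Ob J" "z \<in> Ob C" "z' \<in> Ob C" "y \<in> FOb (FOb D j) z" "f \<in> Hom C z z'" for j z z' y f
    using set_homD(3)[OF \<iota>, of j z y z' f] that by simp
  have Df: "FMor D i j f \<in> Hom ?F (FOb D i) (FOb D j)" if "i \<in> Ob J" "j \<in> Ob J" "f \<in> Hom J i j" for i j f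
    using D.fmor_in that by blast
  have D_in [simp]: "FMor D i j f z y \<in> FOb (FOb D j) z"
    if "i \<in> Ob J" "j \<in> Ob J" "f \<in> Hom J i j" "z \<in> Ob C" "y \<in> FOb (FOb D i) z" for i j f z y
    using set_homD(2)[OF Df] that by simp
  have D_nat: "FMor D i j f z' (FMor (FOb D i) z z' g y) = FMor (FOb D j) z z' g (FMor D i j f z y)"
    if "i \<in> Ob J" "j \<in> Ob J" "f \<in> Hom J i j" "z \<in> Ob C" "z' \<in> Ob C" "g \<in> Hom C z z'" "y \<in> FOb (FOb D i) z"
    for i j f z z' g y
    using set_homD(3)[OF Df] that by simp
  have \<iota>_coc: "\<iota> j z (FMor D i j f z y) = \<iota> i z y"
    if *: "i \<in> Ob J" "j \<in> Ob J" "f \<in> Hom J i j" "z \<in> Ob C" "y \<in> FOb (FOb D i) z" for i j f z y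
  proof -
    have "Cmp ?F (FOb D i) (FOb D j) P (\<iota> j) (FMor D i j f) = \<iota> i"
      using cocone * unfolding is_cocone_def by blast
    then have "Cmp ?F (FOb D i) (FOb D j) P (\<iota> j) (FMor D i j f) z y = \<iota> i z y" by (simp only:)
    then show ?thesis using * by (subst (asm) set_cmp_apply) auto
  qed
  \<comment> \<open>The Yoneda element of the composite from the representable on \<open>c j\<close>
    through \<open>FOb D j\<close> to \<open>P\<close>.\<close>
  define x where "x j = \<iota> j (c j) (\<theta> j (c j) (Ide C (c j)))" for j
  have x_in [simp]: "x j \<in> FOb P (c j)" if "j \<in> Ob J" for j
    using that by (simp add: x_def)
  have act_x: "FMor P (c j) z k (x j) = \<iota> j z (\<theta> j z k)" if "j \<in> Ob J" "z \<in> Ob C" "k \<in> Hom C (c j) z" for j z k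
    using that \<theta>_nat[of j "c j" z "Ide C (c j)" k] by (simp add: x_def \<iota>_nat)
  \<comment> \<open>The full subcategory on these elements may have more arrows than
    \<open>J\<close>. That is harmless as long as each arrow of \<open>J\<close> yields a step,
    which is shown when \<open>\<kappa>\<close> is checked to be a cocone.\<close>
  define M where "M = (\<lambda>j. (c j, x j)) ` Ob J"
  have M_el: "fst m \<in> Ob C \<and> snd m \<in> FOb P (fst m)" if "m \<in> M" for m
    using that by (auto simp: M_def)
  have M_small: "small_for TYPE('u) M"
    using J unfolding M_def small_cat_def by (intro small_for_image) (simp add: small_for_small_iff)
  obtain cls :: "'o \<Rightarrow> ('o \<times> 'u) \<times> 'u \<Rightarrow> 'u"
    where cls: "\<And>z p q. \<lbrakk>z \<in> Ob C; p \<in> P.arrows_from M z; q \<in> P.arrows_from M z\<rbrakk>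
      \<Longrightarrow> cls z p = cls z q \<longleftrightarrow> (p, q) \<in> zigzag C P M z"
    using P.zigzag_classes[OF U C M_small] M_el by metis
  have arr: "((c j, x j), k) \<in> P.arrows_from M z" if "j \<in> Ob J" "k \<in> Hom C (c j) z" for j k z
    using that by (auto simp: P.arrows_from_def M_def)
  define push where "push z z' f = (\<lambda>(m :: 'o \<times> 'u, k). (m, Cmp C (fst m) z z' f k))" for z z' f
  have push_in: "push z z' f p \<in> P.arrows_from M z'"
    if "p \<in> P.arrows_from M z" "z \<in> Ob C" "z' \<in> Ob C" "f \<in> Hom C z z'" for z z' f p
    using that M_el by (auto simp: P.arrows_from_def push_def)
  have push_zz: "(push z z' f p, push z z' f q) \<in> zigzag C P M z'"
    if "(p, q) \<in> zigzag C P M z" and *: "z \<in> Ob C" "z' \<in> Ob C" "f \<in> Hom C z z'" for z z' f p q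
    using that(1)
  proof (rule zigzag_map)
    fix p q assume "(p, q) \<in> step C P M z"
    then obtain m k m' k' t where **: "p = (m, k)" "q = (m', k')" "m \<in> M" "m' \<in> M"
      "k \<in> Hom C (fst m) z" "k' \<in> Hom C (fst m') z" "t \<in> Hom C (fst m) (fst m')"
      "FMor P (fst m) (fst m') t (snd m) = snd m'" "k = Cmp C (fst m) (fst m') z k' t"
      unfolding step_def by auto
    then have "(push z z' f p, push z z' f q) \<in> step C P M z'"
      using * M_el[of m] M_el[of m'] by (auto simp: step_def push_def)
    then show "(push z z' f p, push z z' f q) \<in> zigzag C P M z'" by (rule zigzag_step)
  qed
  define rp where "rp z u = (SOME p. p \<in> P.arrows_from M z \<and> cls z p = u)" for z u
  have rp: "rp z (cls z p) \<in> P.arrows_from M z \<and> cls z (rp z (cls z p)) = cls z p"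
    if "p \<in> P.arrows_from M z" for z p
    unfolding rp_def by (rule someI[of _ p]) (use that in simp)
  \<comment> \<open>The values are codes of classes; \<open>rp\<close> decodes one to some
    representative, and \<open>push_zz\<close> makes the code of the result independent of
    which.\<close>
  define Q :: "('o, 'u set, 'u, 'u \<Rightarrow> 'u) func" where
    "Q = \<lparr>FOb = (\<lambda>z. cls z ` P.arrows_from M z),
          FMor = (\<lambda>z z' f. \<lambda>u\<in>cls z ` P.arrows_from M z. cls z' (push z z' f (rp z u)))\<rparr>"
  have Q_ob: "FOb Q z = cls z ` P.arrows_from M z" for z by (simp add: Q_def)
  have Q_cls: "FMor Q z z' f (cls z p) = cls z' (push z z' f p)"
    if "p \<in> P.arrows_from M z" "z \<in> Ob C" "z' \<in> Ob C" "f \<in> Hom C z z'" for z z' f p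
  proof -
    note r = conjunct1[OF rp[OF that(1)]] conjunct2[OF rp[OF that(1)]]
    have "(rp z (cls z p), p) \<in> zigzag C P M z"
      using cls[OF that(2) r(1) that(1)] r(2) by (rule iffD1)
    then have "(push z z' f (rp z (cls z p)), push z z' f p) \<in> zigzag C P M z'"
      using push_zz that(2-4) by blast
    then have "cls z' (push z z' f (rp z (cls z p))) = cls z' (push z z' f p)"
      using cls[OF that(3) push_in[OF r(1) that(2-4)] push_in[OF that]] by simp
    then show ?thesis using that by (simp add: Q_def)
  qed
  have Q: "set_functor C Q"
  proof (rule set_functorI)
    fix z assume z: "z \<in> Ob C"
    show "small (FOb Q z)"
      using small_for_image[OF P.small_for_arrows_from[OF U C M_small z]] M_el
      unfolding Q_ob by (simp flip: small_for_small_iff)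
    fix p assume "p \<in> FOb Q z"
    then obtain q where q: "q \<in> P.arrows_from M z" "p = cls z q" by (auto simp: Q_ob)
    moreover have "push z z (Ide C z) q = q"
      using q z M_el by (auto simp: push_def P.arrows_from_def)
    ultimately show "FMor Q z z (Ide C z) p = p" using Q_cls z by simp
  next
    fix z z' f assume *: "z \<in> Ob C" "z' \<in> Ob C" "f \<in> Hom C z z'"
    have "FMor Q z z' f \<in> extensional (FOb Q z)" by (simp add: Q_def)
    then show "FMor Q z z' f \<in> FOb Q z \<rightarrow>\<^sub>E FOb Q z'"
      using * Q_cls push_in by (auto simp: Q_ob PiE_iff)
  next
    fix z z' z'' f g p
    assume *: "z \<in> Ob C" "z' \<in> Ob C" "z'' \<in> Ob C" "f \<in> Hom C z z'" "g \<in> Hom C z' z''" "p \<in> FOb Q z"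
    then obtain q where q: "q \<in> P.arrows_from M z" "p = cls z q" by (auto simp: Q_ob)
    moreover have "push z z'' (Cmp C z z' z'' g f) q = push z' z'' g (push z z' f q)"
      using q * M_el by (auto simp: push_def P.arrows_from_def)
    ultimately show "FMor Q z z'' (Cmp C z z' z'' g f) p = FMor Q z' z'' g (FMor Q z z' f p)"
      using * Q_cls push_in by simp
  qed (rule C.category_axioms)
  define \<kappa> where "\<kappa> j = (\<lambda>z\<in>Ob C. \<lambda>y\<in>FOb (FOb D j) z. cls z ((c j, x j), \<theta>' j z y))" for j
  have \<kappa>: "is_cocone J ?F D Q \<kappa>"
    unfolding is_cocone_def
  proof (intro conjI ballI)
    show "Q \<in> Ob ?F" using Q by (simp add: set_functor_def)
  next
    fix j assume j: "j \<in> Ob J"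
    interpret Dj: set_functor C "FOb D j" using FD j .
    show "\<kappa> j \<in> Hom ?F (FOb D j) Q"
      unfolding set_hom_iff[OF FD[OF j] Q]
    proof (intro conjI ballI)
      show "\<kappa> j \<in> extensional (Ob C)" by (simp add: \<kappa>_def)
      fix z assume z: "z \<in> Ob C"
      show "\<kappa> j z \<in> FOb (FOb D j) z \<rightarrow>\<^sub>E FOb Q z"
        using j z arr by (simp add: \<kappa>_def Q_ob)
      fix z' f y assume *: "z' \<in> Ob C" "f \<in> Hom C z z'" "y \<in> FOb (FOb D j) z"
      then show "\<kappa> j z' (FMor (FOb D j) z z' f y) = FMor Q z z' f (\<kappa> j z y)"
        using j z \<theta>'_nat[OF j] Q_cls[OF arr] by (simp add: \<kappa>_def push_def)
    qed
  next
    fix i j f assume *: "i \<in> Ob J" "j \<in> Ob J" "f \<in> Hom J i j"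
    show "Cmp ?F (FOb D i) (FOb D j) Q (\<kappa> j) (FMor D i j f) = \<kappa> i"
    proof (subst set_cmp_eq_iff, safe)
      fix z y assume zy: "z \<in> Ob C" "y \<in> FOb (FOb D i) z"
      \<comment> \<open>Transported along \<open>\<theta>\<close>, \<open>FMor D i j f\<close> is a
        map between representables, hence precomposition with the image \<open>t\<close> of the
        identity.\<close>
      define t where "t = \<theta>' j (c i) (FMor D i j f (c i) (\<theta> i (c i) (Ide C (c i))))"
      have t: "t \<in> Hom C (c j) (c i)" using * by (simp add: t_def)
      have "FMor P (c j) (c i) t (x j) = x i"
        using * t by (simp add: act_x t_def \<iota>_coc) (simp add: x_def)
      moreover have "\<theta>' j z (FMor D i j f z y) = Cmp C (c j) (c i) z (\<theta>' i z y) t"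
      proof -
        have "y = FMor (FOb D i) (c i) z (\<theta>' i z y) (\<theta> i (c i) (Ide C (c i)))"
          using * zy \<theta>_nat[of i "c i" z "Ide C (c i)" "\<theta>' i z y"] by simp
        then have "FMor D i j f z y = FMor (FOb D j) (c i) z (\<theta>' i z y) (FMor D i j f (c i) (\<theta> i (c i) (Ide C (c i))))"
          using D_nat[of i j f "c i" z "\<theta>' i z y" "\<theta> i (c i) (Ide C (c i))"] * zy by simp
        then show ?thesis using * zy \<theta>'_nat by (simp add: t_def)
      qed
      ultimately have "(((c j, x j), \<theta>' j z (FMor D i j f z y)), ((c i, x i), \<theta>' i z y)) \<in> step C P M z"
        using * zy t unfolding step_def M_def by auto
      then have "cls z ((c j, x j), \<theta>' j z (FMor D i j f z y)) = cls z ((c i, x i), \<theta>' i z y)"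
        using cls[OF zy(1)] arr * zy by (simp add: zigzag_step)
      then show "\<kappa> j z (FMor D i j f z y) = \<kappa> i z y"
        using * zy by (simp add: \<kappa>_def)
    qed (use * in \<open>auto simp: \<kappa>_def\<close>)
  qed
  then obtain h where h: "h \<in> Hom ?F P Q" "\<And>j. j \<in> Ob J \<Longrightarrow> Cmp ?F (FOb D j) P Q h (\<iota> j) = \<kappa> j"
    using colim unfolding is_colimit_def by blast
  have h_in: "h z p \<in> FOb Q z" if "z \<in> Ob C" "p \<in> FOb P z" for z p
    using set_homD(2)[OF h(1)] that by simp
  have h_\<iota>: "h z (\<iota> j z y) = cls z ((c j, x j), \<theta>' j z y)"
    if "j \<in> Ob J" "z \<in> Ob C" "y \<in> FOb (FOb D j) z" for j z y
  proof -
    have "Cmp ?F (FOb D j) P Q h (\<iota> j) z y = \<kappa> j z y" using h(2) that by (simp only:)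
    then show ?thesis using that by (subst (asm) set_cmp_apply) (auto simp: \<kappa>_def)
  qed
  \<comment> \<open>Evaluation of a class at any of its members; \<open>zigzag_act\<close> is the
    reason that the member does not matter.\<close>
  define g where "g = (\<lambda>z\<in>Ob C. \<lambda>u\<in>FOb Q z. case rp z u of (m, k) \<Rightarrow> FMor P (fst m) z k (snd m))"
  have g_cls: "g z (cls z (m, k)) = FMor P (fst m) z k (snd m)"
    if "z \<in> Ob C" "(m, k) \<in> P.arrows_from M z" for z m k
  proof -
    obtain m' k' where rp': "rp z (cls z (m, k)) = (m', k')" by fastforce
    then have "((m', k'), (m, k)) \<in> zigzag C P M z"
      using rp[OF that(2)] cls[OF that(1)] that by metis
    then show ?thesis
      using P.zigzag_act[OF M_el that(1)] that rp' by (simp add: g_def Q_ob)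
  qed
  have g: "g \<in> Hom ?F Q P"
    unfolding set_hom_iff[OF Q P]
  proof (intro conjI ballI)
    show "g \<in> extensional (Ob C)" by (simp add: g_def)
    fix z assume z: "z \<in> Ob C"
    show "g z \<in> FOb Q z \<rightarrow>\<^sub>E FOb P z"
    proof
      fix u assume "u \<in> FOb Q z"
      then obtain m k where "(m, k) \<in> P.arrows_from M z" "u = cls z (m, k)" by (auto simp: Q_ob)
      then show "g z u \<in> FOb P z"
        using g_cls z M_el[of m] by (simp add: P.arrows_from_def)
    qed (use z in \<open>simp add: g_def\<close>)
    fix z' f u assume *: "z' \<in> Ob C" "f \<in> Hom C z z'" "u \<in> FOb Q z"
    then obtain m k where mk: "(m, k) \<in> P.arrows_from M z" "u = cls z (m, k)" by (auto simp: Q_ob)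
    then have "m \<in> M" "k \<in> Hom C (fst m) z" by (auto simp: P.arrows_from_def)
    then show "g z' (FMor Q z z' f u) = FMor P z z' f (g z u)"
      using mk * z M_el[of m] Q_cls[of "(m, k)" z z' f] g_cls push_in[of "(m, k)" z z' f]
      by (simp add: push_def)
  qed
  have uniq: "\<exists>!h. h \<in> Hom ?F P P \<and> (\<forall>j\<in>Ob J. Cmp ?F (FOb D j) P P h (\<iota> j) = \<iota> j)"
    using colim cocone unfolding is_colimit_def by blast
  have ext_\<iota>: "\<iota> j \<in> extensional (Ob C)" "z \<in> Ob C \<Longrightarrow> \<iota> j z \<in> extensional (FOb (FOb D j) z)"
    if "j \<in> Ob J" for j z
    using \<iota>[OF that] set_homD(1)[OF \<iota>[OF that], of z] by (auto simp: PiE_iff)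
  have obs: "P \<in> Ob ?F" "Q \<in> Ob ?F" using P Q by (auto simp: set_functor_def)
  \<comment> \<open>Both sides factor the colimit cocone through itself. This yields generation:
    \<open>h z p\<close> is the class of some \<open>(m, k)\<close>, and \<open>g\<close> evaluates
    it back to \<open>p\<close>.\<close>
  have gh: "Cmp ?F P Q P g h = Ide ?F P"
  proof -
    have "Cmp ?F P Q P g h \<in> Hom ?F P P" using D.cod.cmp_in_hom obs h g by blast
    moreover have "Cmp ?F (FOb D j) P P (Cmp ?F P Q P g h) (\<iota> j) = \<iota> j" if "j \<in> Ob J" for j
      using that h_\<iota> g_cls arr ext_\<iota>
      by (subst set_cmp_eq_iff) (auto simp: act_x simp del: functor_cat_simps)
    moreover have "Ide ?F P \<in> Hom ?F P P" using D.cod.ide_in_hom obs by blast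
    moreover have "Cmp ?F (FOb D j) P P (Ide ?F P) (\<iota> j) = \<iota> j" if "j \<in> Ob J" for j
      using that ext_\<iota> by (subst set_cmp_eq_iff) auto
    ultimately show ?thesis using uniq by blast
  qed
  have gh': "g z (h z p) = p" if "z \<in> Ob C" "p \<in> FOb P z" for z p
  proof -
    have "Cmp ?F P Q P g h z p = p" unfolding gh using that by simp
    then show ?thesis using that by (subst (asm) set_cmp_apply) auto
  qed
  have "presents C P M"
    unfolding presents_def
  proof (intro conjI ballI impI)
    show "small_for TYPE('u) M" by fact
    show "fst m \<in> Ob C" "snd m \<in> FOb P (fst m)" if "m \<in> M" for m
      using M_el that by auto
  next
    fix z p assume zp: "z \<in> Ob C" "p \<in> FOb P z"
    then obtain m k where "(m, k) \<in> P.arrows_from M z" "h z p = cls z (m, k)"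
      using h_in[of z p] by (auto simp: Q_ob)
    then show "\<exists>m\<in>M. \<exists>k\<in>Hom C (fst m) z. FMor P (fst m) z k (snd m) = p"
      using gh'[OF zp] g_cls[OF zp(1)] by (auto simp: P.arrows_from_def)
  next
    fix z m m' k k'
    assume *: "z \<in> Ob C" "m \<in> M" "m' \<in> M" "k \<in> Hom C (fst m) z" "k' \<in> Hom C (fst m') z"
      and eq: "FMor P (fst m) z k (snd m) = FMor P (fst m') z k' (snd m')"
    \<comment> \<open>\<open>h\<close> reads the class off the element alone, so two representations
      of one element lie in one class.\<close>
    have "h z (FMor P (fst m) z k (snd m)) = cls z (m, k)" if "m \<in> M" "k \<in> Hom C (fst m) z" for m k
      using that * by (auto simp: M_def act_x h_\<iota>)
    then have "cls z (m, k) = cls z (m', k')" using * eq by metis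
    then show "((m, k), (m', k')) \<in> zigzag C P M z"
      using cls * by (auto simp: P.arrows_from_def)
  qed
  then show thesis by (rule that)
qed

section \<open>Equalizers of small functors\<close>

text \<open>Weak colimits of the diagrams \<open>q \<leftleftarrows> p \<rightarrow> r\<close>, which comprise
  pushouts and coequalizers.\<close>

definition span_cocone :: "('o, 'm) cat \<Rightarrow> 'o \<Rightarrow> 'o \<Rightarrow> 'o \<Rightarrow> 'm \<Rightarrow> 'm \<Rightarrow> 'm \<Rightarrow> 'o \<Rightarrow> 'm \<Rightarrow> 'm \<Rightarrow> bool" where
  "span_cocone C p q r f g n z u v \<longleftrightarrow> z \<in> Ob C \<and> u \<in> Hom C q z \<and> v \<in> Hom C r z \<and>
     Cmp C p q z u f = Cmp C p r z v n \<and> Cmp C p q z u g = Cmp C p r z v n"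

definition has_span_colimits :: "('o, 'm) cat \<Rightarrow> bool" where
  "has_span_colimits C \<longleftrightarrow>
     (\<forall>p\<in>Ob C. \<forall>q\<in>Ob C. \<forall>r\<in>Ob C. \<forall>f\<in>Hom C p q. \<forall>g\<in>Hom C p q. \<forall>n\<in>Hom C p r.
        \<exists>z u v. span_cocone C p q r f g n z u v \<and>
          (\<forall>z' u' v'. span_cocone C p q r f g n z' u' v' \<longrightarrow>
             (\<exists>h\<in>Hom C z z'. Cmp C q z z' h u = u' \<and> Cmp C r z z' h v = v')))"

context category
begin

text \<open>Taking both parallel arrows to be \<open>f\<close> leaves just a span.\<close>

lemma weak_pushout:
  assumes "has_span_colimits C" "p \<in> Ob C" "q \<in> Ob C" "r \<in> Ob C" "f \<in> Hom C p q" "n \<in> Hom C p r"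
  shows "\<exists>z u v. z \<in> Ob C \<and> u \<in> Hom C q z \<and> v \<in> Hom C r z \<and> Cmp C p q z u f = Cmp C p r z v n \<and>
    (\<forall>z' u' v'. z' \<in> Ob C \<longrightarrow> u' \<in> Hom C q z' \<longrightarrow> v' \<in> Hom C r z' \<longrightarrow>
       Cmp C p q z' u' f = Cmp C p r z' v' n \<longrightarrow>
       (\<exists>h\<in>Hom C z z'. Cmp C q z z' h u = u' \<and> Cmp C r z z' h v = v'))"
proof -
  obtain z u v where *: "span_cocone C p q r f f n z u v"
    "\<forall>z' u' v'. span_cocone C p q r f f n z' u' v' \<longrightarrow>
       (\<exists>h\<in>Hom C z z'. Cmp C q z z' h u = u' \<and> Cmp C r z z' h v = v')"
    using assms unfolding has_span_colimits_def by blast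
  show ?thesis
    by (rule exI[of _ z], rule exI[of _ u], rule exI[of _ v]) (use * in \<open>simp add: span_cocone_def\<close>)
qed

text \<open>With the identity as third arrow, the second leg is forced to be the common composite,
  so that coequalizing is the only condition left.\<close>

lemma weak_coequalizer:
  assumes "has_span_colimits C" "p \<in> Ob C" "q \<in> Ob C" "f \<in> Hom C p q" "g \<in> Hom C p q"
  shows "\<exists>z u. z \<in> Ob C \<and> u \<in> Hom C q z \<and> Cmp C p q z u f = Cmp C p q z u g \<and>
    (\<forall>z' u'. z' \<in> Ob C \<longrightarrow> u' \<in> Hom C q z' \<longrightarrow> Cmp C p q z' u' f = Cmp C p q z' u' g \<longrightarrow>
       (\<exists>h\<in>Hom C z z'. Cmp C q z z' h u = u'))"
proof -
  obtain z u v where *: "span_cocone C p q p f g (Ide C p) z u v"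
    "\<forall>z' u' v'. span_cocone C p q p f g (Ide C p) z' u' v' \<longrightarrow>
       (\<exists>h\<in>Hom C z z'. Cmp C q z z' h u = u' \<and> Cmp C p z z' h v = v')"
    using assms ide_in_hom[of p] unfolding has_span_colimits_def by blast
  have "\<exists>h\<in>Hom C z z'. Cmp C q z z' h u = u'"
    if "z' \<in> Ob C" "u' \<in> Hom C q z'" "Cmp C p q z' u' f = Cmp C p q z' u' g" for z' u'
    using *(2)[rule_format, of z' u' "Cmp C p q z' u' f"] that assms by (auto simp: span_cocone_def)
  then show ?thesis
    using *(1) assms by (intro exI[of _ z] exI[of _ u]) (auto simp: span_cocone_def)
qed

end

section \<open>Small sets of cospans that cover all coincidences\<close>

context set_functor
begin

text \<open>A zigzag starting at \<open>f \<cdot> k\<^sub>0\<close> is followed step by step by pushing out along it,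
  so that everything reached factors through one of a small set of cospans.\<close>

lemma pair_cover:
  assumes U: "size_universe TYPE('u)" and C: "locally_small C" "has_span_colimits C"
    and M: "presents C P M" and c: "c \<in> Ob C" "c' \<in> Ob C" and y: "y \<in> FOb P c" "y' \<in> FOb P c'"
  obtains W :: "('o \<times> 'u \<times> 'u) set"
  where "small_for TYPE('u) W"
    and "\<And>z g g'. (z, g, g') \<in> W \<Longrightarrow>
      z \<in> Ob C \<and> g \<in> Hom C c z \<and> g' \<in> Hom C c' z \<and> FMor P c z g y = FMor P c' z g' y'"
    and "\<And>w f f'. \<lbrakk>w \<in> Ob C; f \<in> Hom C c w; f' \<in> Hom C c' w; FMor P c w f y = FMor P c' w f' y'\<rbrakk>
      \<Longrightarrow> \<exists>z g g' h. (z, g, g') \<in> W \<and> h \<in> Hom C z w \<and> Cmp C c z w h g = f \<and> Cmp C c' z w h g' = f'"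
proof -
  note el = presents_element[OF M]
  \<comment> \<open>Zigzags connect generators, so \<open>y\<close> and \<open>y'\<close> are first
    written as images of generators.\<close>
  obtain m0 k0 where m0: "m0 \<in> M" "k0 \<in> Hom C (fst m0) c" "FMor P (fst m0) c k0 (snd m0) = y"
    using presents_generates[OF M c(1) y(1)] by blast
  obtain m1 k1 where m1: "m1 \<in> M" "k1 \<in> Hom C (fst m1) c'" "FMor P (fst m1) c' k1 (snd m1) = y'"
    using presents_generates[OF M c(2) y(2)] by blast
  \<comment> \<open>One weak pushout is fixed per span, so that a state has no more successors
    through pushouts than there are pairs \<open>(m', t)\<close>.\<close>
  define PO where "PO p q r f n s \<longleftrightarrow> (case s of (z, u, v) \<Rightarrow>
    z \<in> Ob C \<and> u \<in> Hom C q z \<and> v \<in> Hom C r z \<and> Cmp C p q z u f = Cmp C p r z v n \<and>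
    (\<forall>z' u' v'. z' \<in> Ob C \<longrightarrow> u' \<in> Hom C q z' \<longrightarrow> v' \<in> Hom C r z' \<longrightarrow>
       Cmp C p q z' u' f = Cmp C p r z' v' n \<longrightarrow>
       (\<exists>h\<in>Hom C z z'. Cmp C q z z' h u = u' \<and> Cmp C r z z' h v = v')))" for p q r f n and s :: "'o \<times> 'u \<times> 'u"
  define oz where "oz p q r f n = fst (SOME s. PO p q r f n s)" for p q r f n
  define ou where "ou p q r f n = fst (snd (SOME s. PO p q r f n s))" for p q r f n
  define ov where "ov p q r f n = snd (snd (SOME s. PO p q r f n s))" for p q r f n
  have PO: "PO p q r f n (oz p q r f n, ou p q r f n, ov p q r f n)"
    if *: "p \<in> Ob C" "q \<in> Ob C" "r \<in> Ob C" "f \<in> Hom C p q" "n \<in> Hom C p r" for p q r f n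
  proof -
    have "\<exists>s. PO p q r f n s"
      using dom.weak_pushout[OF C(2) *] by (simp add: PO_def)
    then show ?thesis unfolding oz_def ou_def ov_def prod.collapse by (rule someI_ex)
  qed
  have po: "oz p q r f n \<in> Ob C \<and> ou p q r f n \<in> Hom C q (oz p q r f n) \<and> ov p q r f n \<in> Hom C r (oz p q r f n) \<and>
      Cmp C p q (oz p q r f n) (ou p q r f n) f = Cmp C p r (oz p q r f n) (ov p q r f n) n"
    if "p \<in> Ob C" "q \<in> Ob C" "r \<in> Ob C" "f \<in> Hom C p q" "n \<in> Hom C p r" for p q r f n
    using PO[OF that] by (simp add: PO_def)
  have po_univ: "\<exists>h\<in>Hom C (oz p q r f n) z'. Cmp C q (oz p q r f n) z' h (ou p q r f n) = u' \<and>
        Cmp C r (oz p q r f n) z' h (ov p q r f n) = v'"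
    if "p \<in> Ob C" "q \<in> Ob C" "r \<in> Ob C" "f \<in> Hom C p q" "n \<in> Hom C p r"
      "z' \<in> Ob C" "u' \<in> Hom C q z'" "v' \<in> Hom C r z'" "Cmp C p q z' u' f = Cmp C p r z' v' n"
    for p q r f n z' u' v'
    using PO[OF that(1-5)] that(6-9) by (simp add: PO_def)
  \<comment> \<open>A state \<open>((z, g), (m, k))\<close> is a cospan
    \<open>c -> z <- fst m\<close> under which \<open>y\<close> and the generator \<open>m\<close>
    become equal. Moving to \<open>m'\<close> against \<open>t : fst m' -> fst m\<close> only
    precomposes \<open>k\<close>; the apex stays.\<close>
  define down where "down z g m k = (\<lambda>(m' :: 'o \<times> 'u, t). ((z, g), (m', Cmp C (fst m') (fst m) z k t)))"
    for z :: 'o and g k :: 'u and m :: "'o \<times> 'u"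
  \<comment> \<open>Moving along \<open>t : fst m -> fst m'\<close> calls for an arrow out of
    \<open>fst m'\<close>, so the apex is enlarged to the pushout of \<open>k\<close> and
    \<open>t\<close>.\<close>
  define up where "up z g m k = (\<lambda>(m' :: 'o \<times> 'u, t).
      let z' = oz (fst m) z (fst m') k t
      in ((z', Cmp C c z z' (ou (fst m) z (fst m') k t) g), (m', ov (fst m) z (fst m') k t)))"
    for z :: 'o and g k :: 'u and m :: "'o \<times> 'u"
  define good where "good = {((z, g), (m, k)). z \<in> Ob C \<and> g \<in> Hom C c z \<and> m \<in> M \<and>
      k \<in> Hom C (fst m) z \<and> FMor P c z g y = FMor P (fst m) z k (snd m)}"
  define downs where "downs m = (SIGMA m' : M. {t \<in> Hom C (fst m') (fst m). FMor P (fst m') (fst m) t (snd m') = snd m})" for m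
  define ups where "ups m = (SIGMA m' : M. {t \<in> Hom C (fst m) (fst m'). FMor P (fst m) (fst m') t (snd m) = snd m'})" for m
  \<comment> \<open>Cut down to good states because \<open>small_for_rtrancl\<close> asks for small
    images at every point of the type, and outside of good states there is no bound on the
    hom-sets.\<close>
  define R where "R = {(((z, g), (m, k)), s). ((z, g), (m, k)) \<in> good \<and>
      s \<in> down z g m k ` downs m \<union> up z g m k ` ups m}"
  have small_Sigma: "small_for TYPE('u) (SIGMA m' : M. T m')"
    if "\<And>m'. m' \<in> M \<Longrightarrow> T m' \<subseteq> Hom C (a m') (b m') \<and> a m' \<in> Ob C \<and> b m' \<in> Ob C" for T a b
  proof -
    have "small_for TYPE('u) (\<Union>m'\<in>M. Pair m' ` T m')"
    proof (rule small_for_Union[OF U])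
      show "small_for TYPE('u) M" using M by (simp add: presents_def)
      fix m' assume "m' \<in> M"
      then show "small_for TYPE('u) (Pair m' ` T m')"
        using C(1) that[of m']
        by (intro small_for_image small_for_subset[of "Hom C (a m') (b m')" "T m'"])
          (auto simp: locally_small_def small_for_small_iff)
    qed
    moreover have "(SIGMA m' : M. T m') = (\<Union>m'\<in>M. Pair m' ` T m')" by auto
    ultimately show ?thesis by (simp only:)
  qed
  have small_R: "small_for TYPE('u) (R `` {s})" for s
  proof (cases "s \<in> good")
    case True
    obtain z g m k where s: "s = ((z, g), (m, k))" by (metis surj_pair)
    have m: "m \<in> M" using True s by (simp add: good_def)
    have "R `` {s} = down z g m k ` downs m \<union> up z g m k ` ups m"
      using True s by (auto simp: R_def)
    moreover have "small_for TYPE('u) (downs m)"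
      unfolding downs_def using el m by (intro small_Sigma[of _ fst "\<lambda>_. fst m"]) auto
    moreover have "small_for TYPE('u) (ups m)"
      unfolding ups_def using el m by (intro small_Sigma[of _ "\<lambda>_. fst m" fst]) auto
    ultimately show ?thesis by (simp only: small_for_Un[OF U] small_for_image)
  next
    case False
    then have "R `` {s} = {}" by (auto simp: R_def)
    then show ?thesis by (simp add: small_for_finite[OF U])
  qed
  define start where "start = ((c, Ide C c), (m0, k0))"
  define \<Phi> where "\<Phi> = R\<^sup>* `` {start}"
  have \<Phi>_small: "small_for TYPE('u) \<Phi>"
    unfolding \<Phi>_def by (rule small_for_rtrancl[OF U small_R])
  have start_\<Phi>: "start \<in> \<Phi>" by (simp add: \<Phi>_def)
  have \<Phi>_closed: "s' \<in> \<Phi>" if "s \<in> \<Phi>" "(s, s') \<in> R" for s s'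
    using that unfolding \<Phi>_def by auto
  have \<Phi>_good: "s \<in> good" if "s \<in> \<Phi>" for s
  proof -
    have "(start, s) \<in> R\<^sup>*" using that by (simp add: \<Phi>_def)
    then show ?thesis
    proof induction
      case base
      show ?case using m0 c y by (simp add: start_def good_def)
    next
      case (step s s')
      obtain z g m k where s: "s = ((z, g), (m, k))" by (metis surj_pair)
      have gd: "z \<in> Ob C" "g \<in> Hom C c z" "m \<in> M" "k \<in> Hom C (fst m) z"
        "FMor P c z g y = FMor P (fst m) z k (snd m)"
        using step.IH s by (auto simp: good_def)
      note elm = el[OF gd(3)]
      consider m' t where "s' = down z g m k (m', t)" "(m', t) \<in> downs m"
        | m' t where "s' = up z g m k (m', t)" "(m', t) \<in> ups m"
        using step.hyps(2) unfolding s R_def by auto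
      then show ?case
      proof cases
        case (1 m' t)
        then have "m' \<in> M" "t \<in> Hom C (fst m') (fst m)" "FMor P (fst m') (fst m) t (snd m') = snd m"
          by (auto simp: downs_def)
        then show ?thesis using 1 gd elm el[of m'] by (simp add: down_def good_def)
      next
        case (2 m' t)
        then have t: "m' \<in> M" "t \<in> Hom C (fst m) (fst m')" "FMor P (fst m) (fst m') t (snd m) = snd m'"
          by (auto simp: ups_def)
        define z' u v where "z' = oz (fst m) z (fst m') k t" "u = ou (fst m) z (fst m') k t"
          "v = ov (fst m) z (fst m') k t"
        note p = po[of "fst m" z "fst m'" k t, folded z'_u_v_def]
        have p: "z' \<in> Ob C" "u \<in> Hom C z z'" "v \<in> Hom C (fst m') z'"
          "Cmp C (fst m) z z' u k = Cmp C (fst m) (fst m') z' v t"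
          using p gd elm el[OF t(1)] t by auto
        have "FMor P c z' (Cmp C c z z' u g) y = FMor P (fst m) z' (Cmp C (fst m) z z' u k) (snd m)"
          using p(1-3) gd elm c y by simp
        also have "\<dots> = FMor P (fst m') z' v (snd m')"
          unfolding p(4) using p gd elm t el[OF t(1)] by simp
        finally show ?thesis
          using 2 p gd t c by (simp add: up_def Let_def good_def flip: z'_u_v_def)
      qed
    qed
  qed
  \<comment> \<open>The invariant along a zigzag in \<open>w\<close>: its current position is the
    image under some \<open>h : z -> w\<close> of a reachable state with \<open>f = h g\<close>. A
    step along \<open>t\<close> replaces \<open>h\<close> by a factorization through the pushout; a
    step against \<open>t\<close> keeps \<open>h\<close>.\<close>
  have lift: "\<exists>z g m k h. ((z, g), (m, k)) \<in> \<Phi> \<and> h \<in> Hom C z w \<and> Cmp C c z w h g = f \<and>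
      q = (m, Cmp C (fst m) z w h k)"
    if zz: "((m0, Cmp C (fst m0) c w f k0), q) \<in> zigzag C P M w" and w: "w \<in> Ob C" "f \<in> Hom C c w" for w f q
    using zz unfolding zigzag_def
  proof induction
    case base
    show ?case
      using start_\<Phi> w c unfolding start_def by (intro exI[of _ c] exI[of _ "Ide C c"] exI[of _ m0] exI[of _ k0] exI[of _ f]) simp
  next
    case (step q q')
    then obtain z g m k h where *: "((z, g), (m, k)) \<in> \<Phi>" "h \<in> Hom C z w" "Cmp C c z w h g = f"
      "q = (m, Cmp C (fst m) z w h k)" by blast
    have gd: "z \<in> Ob C" "g \<in> Hom C c z" "m \<in> M" "k \<in> Hom C (fst m) z" "((z, g), (m, k)) \<in> good"
      using \<Phi>_good[OF *(1)] by (auto simp: good_def)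
    note elm = el[OF gd(3)]
    show ?case
    proof (cases "(q, q') \<in> step C P M w")
      case True
      then obtain m' k' t where t: "q' = (m', k')" "m' \<in> M" "k' \<in> Hom C (fst m') w" "t \<in> Hom C (fst m) (fst m')"
        "FMor P (fst m) (fst m') t (snd m) = snd m'" "Cmp C (fst m) z w h k = Cmp C (fst m) (fst m') w k' t"
        unfolding step_def *(4) by auto
      note elm' = el[OF t(2)]
      define z' u v where "z' = oz (fst m) z (fst m') k t" "u = ou (fst m) z (fst m') k t"
        "v = ov (fst m) z (fst m') k t"
      have p: "z' \<in> Ob C" "u \<in> Hom C z z'" "v \<in> Hom C (fst m') z'"
        using po[of "fst m" z "fst m'" k t, folded z'_u_v_def] gd elm elm' t by auto
      have "\<exists>h'\<in>Hom C z' w. Cmp C z z' w h' u = h \<and> Cmp C (fst m') z' w h' v = k'"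
        using po_univ[of "fst m" z "fst m'" k t w h k', folded z'_u_v_def] gd elm elm' t * w by auto
      then obtain h' where h': "h' \<in> Hom C z' w" "Cmp C z z' w h' u = h" "Cmp C (fst m') z' w h' v = k'"
        by blast
      have "(m', t) \<in> ups m" using t by (auto simp: ups_def)
      then have "(((z, g), (m, k)), up z g m k (m', t)) \<in> R" using gd by (auto simp: R_def)
      then have "((z', Cmp C c z z' u g), (m', v)) \<in> \<Phi>"
        using \<Phi>_closed[OF *(1)] by (simp add: up_def Let_def flip: z'_u_v_def)
      moreover have "Cmp C c z' w h' (Cmp C c z z' u g) = f"
        using h' p gd c w *(3) by (simp flip: dom.assoc)
      ultimately show ?thesis using h' t(1) by blast
    next
      case False
      then have "(q', q) \<in> step C P M w" using step.hyps by auto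
      then obtain m' k' t where t: "q' = (m', k')" "m' \<in> M" "t \<in> Hom C (fst m') (fst m)"
        "FMor P (fst m') (fst m) t (snd m') = snd m" "k' = Cmp C (fst m') (fst m) w (Cmp C (fst m) z w h k) t"
        unfolding step_def *(4) by auto
      note elm' = el[OF t(2)]
      have "(m', t) \<in> downs m" using t by (auto simp: downs_def)
      then have "(((z, g), (m, k)), down z g m k (m', t)) \<in> R" using gd by (auto simp: R_def)
      then have "((z, g), (m', Cmp C (fst m') (fst m) z k t)) \<in> \<Phi>"
        using \<Phi>_closed[OF *(1)] by (simp add: down_def)
      moreover have "k' = Cmp C (fst m') z w h (Cmp C (fst m') (fst m) z k t)"
        using t gd * w elm elm' by simp
      ultimately show ?thesis using *(2,3) t(1) by blast
    qed
  qed
  \<comment> \<open>States that have arrived at the generator \<open>m1\<close> of \<open>y'\<close>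
    are closed off by one more pushout, of \<open>k\<close> with \<open>k1 : fst m1 -> c'\<close>,
    which turns the leg from the generator into a leg from \<open>c'\<close>.\<close>
  define W where "W = (\<lambda>((z, g), (m, k)).
      let z' = oz (fst m1) z c' k k1
      in (z', Cmp C c z z' (ou (fst m1) z c' k k1) g, ov (fst m1) z c' k k1)) ` (\<Phi> \<inter> {((z, g), (m, k)). m = m1})"
  show thesis
  proof (rule that[of W])
    show "small_for TYPE('u) W"
      unfolding W_def by (rule small_for_image, rule small_for_subset[OF \<Phi>_small]) blast
  next
    fix z' a b assume "(z', a, b) \<in> W"
    then obtain z g k where \<Phi>: "((z, g), (m1, k)) \<in> \<Phi>"
      and W: "z' = oz (fst m1) z c' k k1" "a = Cmp C c z z' (ou (fst m1) z c' k k1) g" "b = ov (fst m1) z c' k k1"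
      unfolding W_def by (auto simp: Let_def)
    define u where "u = ou (fst m1) z c' k k1"
    note elm = el[OF m1(1)]
    have gd: "z \<in> Ob C" "g \<in> Hom C c z" "k \<in> Hom C (fst m1) z" "FMor P c z g y = FMor P (fst m1) z k (snd m1)"
      using \<Phi>_good[OF \<Phi>] by (auto simp: good_def)
    have p: "z' \<in> Ob C" "u \<in> Hom C z z'" "b \<in> Hom C c' z'"
      "Cmp C (fst m1) z z' u k = Cmp C (fst m1) c' z' b k1"
      using po[of "fst m1" z c' k k1, folded W u_def] gd elm m1 c by auto
    have a: "a = Cmp C c z z' u g" using W by (simp add: u_def)
    have "FMor P c z' a y = FMor P (fst m1) z' (Cmp C (fst m1) z z' u k) (snd m1)"
      unfolding a using p(1-3) gd elm c y by simp
    also have "\<dots> = FMor P c' z' b y'"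
      unfolding p(4) using p gd elm m1 c by simp
    finally show "z' \<in> Ob C \<and> a \<in> Hom C c z' \<and> b \<in> Hom C c' z' \<and> FMor P c z' a y = FMor P c' z' b y'"
      using p gd c a by simp
  next
    fix w f f' assume w: "w \<in> Ob C" "f \<in> Hom C c w" "f' \<in> Hom C c' w" "FMor P c w f y = FMor P c' w f' y'"
    note elm = el[OF m0(1)] el[OF m1(1)]
    have "((m0, Cmp C (fst m0) c w f k0), (m1, Cmp C (fst m1) c' w f' k1)) \<in> zigzag C P M w"
      using w c m0 m1 elm by (intro presents_zigzag[OF M]) auto
    from lift[OF this w(1,2)] obtain z g k h where *: "((z, g), (m1, k)) \<in> \<Phi>" "h \<in> Hom C z w"
      "Cmp C c z w h g = f" "Cmp C (fst m1) z w h k = Cmp C (fst m1) c' w f' k1" by auto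
    have gd: "z \<in> Ob C" "g \<in> Hom C c z" "k \<in> Hom C (fst m1) z"
      using \<Phi>_good[OF *(1)] by (auto simp: good_def)
    define z' u v where "z' = oz (fst m1) z c' k k1" "u = ou (fst m1) z c' k k1" "v = ov (fst m1) z c' k k1"
    have p: "z' \<in> Ob C" "u \<in> Hom C z z'" "v \<in> Hom C c' z'"
      using po[of "fst m1" z c' k k1, folded z'_u_v_def] gd elm m1 c by auto
    have "\<exists>h'\<in>Hom C z' w. Cmp C z z' w h' u = h \<and> Cmp C c' z' w h' v = f'"
      using po_univ[of "fst m1" z c' k k1 w h f', folded z'_u_v_def] gd elm m1 c * w by auto
    then obtain h' where h': "h' \<in> Hom C z' w" "Cmp C z z' w h' u = h" "Cmp C c' z' w h' v = f'" by blast
    have "(z', Cmp C c z z' u g, v) \<in> W"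
      unfolding W_def z'_u_v_def by (rule image_eqI[of _ _ "((z, g), (m1, k))"]) (use *(1) in \<open>auto simp: Let_def\<close>)
    moreover have "Cmp C c z' w h' (Cmp C c z z' u g) = f"
      using h' p gd c w *(3) by (simp flip: dom.assoc)
    ultimately show "\<exists>z g g' h. (z, g, g') \<in> W \<and> h \<in> Hom C z w \<and> Cmp C c z w h g = f \<and> Cmp C c' z w h g' = f'"
      using h' by blast
  qed
qed

end

text \<open>If \<open>p = P k m\<close> is equalized, then \<open>Q k (u m) = Q k (v m)\<close>, so
  the pair \<open>(k, k)\<close> factors through some \<open>(g, g')\<close> of a small set as
  \<open>k = h g = h g'\<close>. Thus \<open>h\<close> factors through the coequalizer
  \<open>e\<close> of \<open>g\<close> and \<open>g'\<close>, and \<open>p\<close> is an image of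
  \<open>P (e g) m\<close>.\<close>

theorem presents_equalizer:
  fixes C :: "('o, 'u) cat" and E P Q :: "('o, 'u set, 'u, 'u \<Rightarrow> 'u) func"
  assumes U: "size_universe TYPE('u)" and C: "locally_small C" "has_span_colimits C"
    and P: "set_functor C P" "presents C P M" and Q: "set_functor C Q" "presents C Q N"
    and u: "\<And>z p. \<lbrakk>z \<in> Ob C; p \<in> FOb P z\<rbrakk> \<Longrightarrow> u z p \<in> FOb Q z"
      "\<And>z z' f p. \<lbrakk>z \<in> Ob C; z' \<in> Ob C; f \<in> Hom C z z'; p \<in> FOb P z\<rbrakk>
        \<Longrightarrow> u z' (FMor P z z' f p) = FMor Q z z' f (u z p)"
    and v: "\<And>z p. \<lbrakk>z \<in> Ob C; p \<in> FOb P z\<rbrakk> \<Longrightarrow> v z p \<in> FOb Q z"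
      "\<And>z z' f p. \<lbrakk>z \<in> Ob C; z' \<in> Ob C; f \<in> Hom C z z'; p \<in> FOb P z\<rbrakk>
        \<Longrightarrow> v z' (FMor P z z' f p) = FMor Q z z' f (v z p)"
    and E: "\<And>z. z \<in> Ob C \<Longrightarrow> FOb E z = {p \<in> FOb P z. u z p = v z p}"
      "\<And>z z' f p. \<lbrakk>z \<in> Ob C; z' \<in> Ob C; f \<in> Hom C z z'; p \<in> FOb E z\<rbrakk>
        \<Longrightarrow> FMor E z z' f p = FMor P z z' f p"
  obtains L where "presents C E L"
proof -
  interpret P: set_functor C P by fact
  interpret Q: set_functor C Q by fact
  note el = presents_element[OF P(2)]
  \<comment> \<open>\<open>pair_cover\<close> in \<open>Q\<close>, for the elements
    \<open>u m\<close> and \<open>v m\<close> over one and the same object.\<close>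
  have "\<forall>m. \<exists>W. m \<in> M \<longrightarrow> small_for TYPE('u) W \<and>
    (\<forall>z g g'. (z, g, g') \<in> W \<longrightarrow> z \<in> Ob C \<and> g \<in> Hom C (fst m) z \<and> g' \<in> Hom C (fst m) z \<and>
      FMor Q (fst m) z g (u (fst m) (snd m)) = FMor Q (fst m) z g' (v (fst m) (snd m))) \<and>
    (\<forall>w f f'. w \<in> Ob C \<longrightarrow> f \<in> Hom C (fst m) w \<longrightarrow> f' \<in> Hom C (fst m) w \<longrightarrow>
      FMor Q (fst m) w f (u (fst m) (snd m)) = FMor Q (fst m) w f' (v (fst m) (snd m)) \<longrightarrow>
      (\<exists>z g g' h. (z, g, g') \<in> W \<and> h \<in> Hom C z w \<and> Cmp C (fst m) z w h g = f \<and> Cmp C (fst m) z w h g' = f'))"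
    (is "\<forall>m. \<exists>W. m \<in> M \<longrightarrow> ?W m W")
  proof (intro allI)
    fix m
    show "\<exists>W. m \<in> M \<longrightarrow> ?W m W"
    proof (cases "m \<in> M")
      case True
      then have m: "fst m \<in> Ob C" "snd m \<in> FOb P (fst m)" using el by auto
      show ?thesis
        by (rule Q.pair_cover[OF U C Q(2) m(1) m(1) u(1)[OF m] v(1)[OF m]]) blast
    qed blast
  qed
  from choice[OF this] obtain W where WW: "\<forall>m. m \<in> M \<longrightarrow> ?W m (W m)" ..
  have W_small: "\<And>m. m \<in> M \<Longrightarrow> small_for TYPE('u) (W m)" using WW by blast
  have W: "\<And>m z g g'. \<lbrakk>m \<in> M; (z, g, g') \<in> W m\<rbrakk> \<Longrightarrow> z \<in> Ob C \<and> g \<in> Hom C (fst m) z \<and> g' \<in> Hom C (fst m) z \<and>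
      FMor Q (fst m) z g (u (fst m) (snd m)) = FMor Q (fst m) z g' (v (fst m) (snd m))" using WW by blast
  have W_cover: "\<And>m w f f'. \<lbrakk>m \<in> M; w \<in> Ob C; f \<in> Hom C (fst m) w; f' \<in> Hom C (fst m) w;
      FMor Q (fst m) w f (u (fst m) (snd m)) = FMor Q (fst m) w f' (v (fst m) (snd m))\<rbrakk> \<Longrightarrow>
      \<exists>z g g' h. (z, g, g') \<in> W m \<and> h \<in> Hom C z w \<and> Cmp C (fst m) z w h g = f \<and> Cmp C (fst m) z w h g' = f'" using WW by blast
  define CE where "CE p q f g s \<longleftrightarrow> (case s of (z, e) \<Rightarrow>
    z \<in> Ob C \<and> e \<in> Hom C q z \<and> Cmp C p q z e f = Cmp C p q z e g \<and>
    (\<forall>z' e'. z' \<in> Ob C \<longrightarrow> e' \<in> Hom C q z' \<longrightarrow> Cmp C p q z' e' f = Cmp C p q z' e' g \<longrightarrow>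
       (\<exists>h\<in>Hom C z z'. Cmp C q z z' h e = e')))" for p q f g and s :: "'o \<times> 'u"
  define qz where "qz p q f g = fst (SOME s. CE p q f g s)" for p q f g
  define qe where "qe p q f g = snd (SOME s. CE p q f g s)" for p q f g
  have CE: "CE p q f g (qz p q f g, qe p q f g)"
    if *: "p \<in> Ob C" "q \<in> Ob C" "f \<in> Hom C p q" "g \<in> Hom C p q" for p q f g
  proof -
    have "\<exists>s. CE p q f g s"
      using P.dom.weak_coequalizer[OF C(2) *] by (simp add: CE_def)
    then show ?thesis unfolding qz_def qe_def prod.collapse by (rule someI_ex)
  qed
  have coeq: "qz p q f g \<in> Ob C \<and> qe p q f g \<in> Hom C q (qz p q f g) \<and>
      Cmp C p q (qz p q f g) (qe p q f g) f = Cmp C p q (qz p q f g) (qe p q f g) g"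
    if "p \<in> Ob C" "q \<in> Ob C" "f \<in> Hom C p q" "g \<in> Hom C p q" for p q f g
    using CE[OF that] by (simp add: CE_def)
  have coeq_univ: "\<exists>h\<in>Hom C (qz p q f g) z'. Cmp C q (qz p q f g) z' h (qe p q f g) = e'"
    if "p \<in> Ob C" "q \<in> Ob C" "f \<in> Hom C p q" "g \<in> Hom C p q" "z' \<in> Ob C"
      "e' \<in> Hom C q z'" "Cmp C p q z' e' f = Cmp C p q z' e' g" for p q f g z' e'
    using CE[OF that(1-4)] that(5-7) by (simp add: CE_def)
  \<comment> \<open>Composing with \<open>g\<close> or with \<open>g'\<close> gives the same arrow
    into the coequalizer. That is why this element is equalized: \<open>u\<close> sees it through
    \<open>g\<close> and \<open>v\<close> through \<open>g'\<close>.\<close>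
  define gen where "gen m = (\<lambda>(z, g, g'). (qz (fst m) z g g',
      FMor P (fst m) (qz (fst m) z g g') (Cmp C (fst m) z (qz (fst m) z g g') (qe (fst m) z g g') g) (snd m)))" for m
  define X where "X = (\<Union>m\<in>M. gen m ` W m)"
  have X_small: "small_for TYPE('u) X"
    unfolding X_def using P(2) W_small
    by (intro small_for_Union[OF U] small_for_image) (auto simp: presents_def)
  have E_sub: "p \<in> FOb P z" if "z \<in> Ob C" "p \<in> FOb E z" for z p using E(1) that by auto
  have E_act: "FMor P z z' f p \<in> FOb E z'" if "z \<in> Ob C" "z' \<in> Ob C" "f \<in> Hom C z z'" "p \<in> FOb E z" for z z' f p
    using that E(1) u(2) v(2) by auto
  have X_el: "fst x \<in> Ob C \<and> snd x \<in> FOb E (fst x)" if x_X: "x \<in> X" for x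
  proof -
    obtain m s where "m \<in> M" "s \<in> W m" "x = gen m s"
      using x_X unfolding X_def by blast
    then obtain z g g' where m: "m \<in> M" "(z, g, g') \<in> W m" "x = gen m (z, g, g')"
      by (cases s) auto
    define q e where "q = qz (fst m) z g g'" "e = qe (fst m) z g g'"
    note * = W[OF m(1,2)] el[OF m(1)]
    have q: "q \<in> Ob C" "e \<in> Hom C z q" "Cmp C (fst m) z q e g = Cmp C (fst m) z q e g'"
      using coeq[of "fst m" z g g', folded q_e_def] * by auto
    have x: "x = (q, FMor P (fst m) q (Cmp C (fst m) z q e g) (snd m))"
      using m(3) by (simp add: gen_def q_e_def)
    have "u q (FMor P (fst m) q (Cmp C (fst m) z q e g) (snd m))
        = FMor Q z q e (FMor Q (fst m) z g (u (fst m) (snd m)))"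
      using * q(1,2) u by simp
    also have "\<dots> = FMor Q (fst m) q (Cmp C (fst m) z q e g') (v (fst m) (snd m))"
      using * q(1,2) u v by simp
    also have "\<dots> = v q (FMor P (fst m) q (Cmp C (fst m) z q e g) (snd m))"
      unfolding q(3) using * q(1,2) v by simp
    finally show ?thesis unfolding x using * q by (simp add: E(1))
  qed
  have X_gen: "\<exists>x\<in>X. \<exists>k\<in>Hom C (fst x) z. FMor P (fst x) z k (snd x) = p"
    if z: "z \<in> Ob C" "p \<in> FOb E z" for z p
  proof -
    obtain m k where m: "m \<in> M" "fst m \<in> Ob C" "snd m \<in> FOb P (fst m)" "k \<in> Hom C (fst m) z"
      "FMor P (fst m) z k (snd m) = p"
      using presents_generates[OF P(2) z(1) E_sub[OF z]] by blast
    have "FMor Q (fst m) z k (u (fst m) (snd m)) = FMor Q (fst m) z k (v (fst m) (snd m))"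
      using m z E(1) u(2)[of "fst m" z k "snd m"] v(2)[of "fst m" z k "snd m"] by simp
    then obtain w g g' h where w: "(w, g, g') \<in> W m" "h \<in> Hom C w z" "Cmp C (fst m) w z h g = k"
      "Cmp C (fst m) w z h g' = k"
      using W_cover[OF m(1) z(1) m(4) m(4)] by blast
    note * = W[OF m(1) w(1)]
    define q e where "q = qz (fst m) w g g'" "e = qe (fst m) w g g'"
    have q: "q \<in> Ob C" "e \<in> Hom C w q"
      using coeq[of "fst m" w g g', folded q_e_def] * m by auto
    obtain h' where h': "h' \<in> Hom C q z" "Cmp C w q z h' e = h"
      using coeq_univ[of "fst m" w g g' z h, folded q_e_def] * m w z by auto
    define x where "x = (q, FMor P (fst m) q (Cmp C (fst m) w q e g) (snd m))"
    have "x \<in> X"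
      unfolding X_def x_def by (rule UN_I[OF m(1)], rule image_eqI[OF _ w(1)]) (simp add: gen_def q_e_def)
    moreover have "FMor P (fst x) z h' (snd x) = p"
    proof -
      have "FMor P (fst x) z h' (snd x) = FMor P (fst m) z (Cmp C (fst m) q z h' (Cmp C (fst m) w q e g)) (snd m)"
        unfolding x_def using q h' * m z by simp
      also have "Cmp C (fst m) q z h' (Cmp C (fst m) w q e g) = k"
        using q h' * m z w(3) by (simp flip: P.dom.assoc)
      finally show ?thesis using m by simp
    qed
    moreover have "h' \<in> Hom C (fst x) z" using h' by (simp add: x_def)
    ultimately show ?thesis by blast
  qed
  \<comment> \<open>A second use of \<open>pair_cover\<close>, now in \<open>P\<close>, for each
    pair of the generators just found.\<close>
  have "\<forall>x x'. \<exists>V. x \<in> X \<longrightarrow> x' \<in> X \<longrightarrow> small_for TYPE('u) V \<and>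
    (\<forall>z g g'. (z, g, g') \<in> V \<longrightarrow> z \<in> Ob C \<and> g \<in> Hom C (fst x) z \<and> g' \<in> Hom C (fst x') z \<and>
      FMor P (fst x) z g (snd x) = FMor P (fst x') z g' (snd x')) \<and>
    (\<forall>w f f'. w \<in> Ob C \<longrightarrow> f \<in> Hom C (fst x) w \<longrightarrow> f' \<in> Hom C (fst x') w \<longrightarrow>
      FMor P (fst x) w f (snd x) = FMor P (fst x') w f' (snd x') \<longrightarrow>
      (\<exists>z g g' h. (z, g, g') \<in> V \<and> h \<in> Hom C z w \<and> Cmp C (fst x) z w h g = f \<and> Cmp C (fst x') z w h g' = f'))"
    (is "\<forall>x x'. \<exists>V. x \<in> X \<longrightarrow> x' \<in> X \<longrightarrow> ?V x x' V")
  proof (intro allI)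
    fix x x'
    show "\<exists>V. x \<in> X \<longrightarrow> x' \<in> X \<longrightarrow> ?V x x' V"
    proof (cases "x \<in> X \<and> x' \<in> X")
      case True
      then have *: "fst x \<in> Ob C" "fst x' \<in> Ob C" "snd x \<in> FOb P (fst x)" "snd x' \<in> FOb P (fst x')"
        using X_el E_sub by auto
      show ?thesis by (rule P.pair_cover[OF U C P(2) *]) blast
    qed blast
  qed
  then have "\<exists>V. \<forall>x'. x \<in> X \<longrightarrow> x' \<in> X \<longrightarrow> ?V x x' (V x')" for x
    by (intro choice) (erule spec)
  then have "\<forall>x. \<exists>V. \<forall>x'. x \<in> X \<longrightarrow> x' \<in> X \<longrightarrow> ?V x x' (V x')" ..
  from choice[OF this] obtain V where VV: "\<forall>x x'. x \<in> X \<longrightarrow> x' \<in> X \<longrightarrow> ?V x x' (V x x')" ..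
  have V_small: "\<And>x x'. \<lbrakk>x \<in> X; x' \<in> X\<rbrakk> \<Longrightarrow> small_for TYPE('u) (V x x')" using VV by blast
  have V: "\<And>x x' z g g'. \<lbrakk>x \<in> X; x' \<in> X; (z, g, g') \<in> V x x'\<rbrakk> \<Longrightarrow>
      z \<in> Ob C \<and> g \<in> Hom C (fst x) z \<and> g' \<in> Hom C (fst x') z \<and>
      FMor P (fst x) z g (snd x) = FMor P (fst x') z g' (snd x')" using VV by blast
  have V_cover: "\<And>x x' w f f'. \<lbrakk>x \<in> X; x' \<in> X; w \<in> Ob C; f \<in> Hom C (fst x) w; f' \<in> Hom C (fst x') w;
      FMor P (fst x) w f (snd x) = FMor P (fst x') w f' (snd x')\<rbrakk> \<Longrightarrow>
      \<exists>z g g' h. (z, g, g') \<in> V x x' \<and> h \<in> Hom C z w \<and> Cmp C (fst x) z w h g = f \<and> Cmp C (fst x') z w h g' = f'" using VV by blast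
  define rel where "rel x = (\<lambda>(z, g, g' :: 'u). (z, FMor P (fst x) z g (snd x)))" for x
  \<comment> \<open>The elements at the apices join the generators, so that two representations of
    an element become linked by \<open>x -> l <- x'\<close>. They belong to the equalizer because it
    is closed under the action of arrows.\<close>
  define L where "L = X \<union> (\<Union>x\<in>X. \<Union>x'\<in>X. rel x ` V x x')"
  have L_small: "small_for TYPE('u) L"
    unfolding L_def
    by (intro small_for_Un[OF U] X_small small_for_Union[OF U X_small] small_for_image V_small)
  have X_L: "X \<subseteq> L" by (auto simp: L_def)
  have L_el: "fst l \<in> Ob C \<and> snd l \<in> FOb E (fst l)" if l: "l \<in> L" for l
  proof (cases "l \<in> X")
    case False
    then obtain x x' z g g' where *: "x \<in> X" "x' \<in> X" "(z, g, g') \<in> V x x'" "l = (z, FMor P (fst x) z g (snd x))"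
      using l unfolding L_def by (auto simp: rel_def)
    then show ?thesis using V[OF *(1-3)] E_act X_el by auto
  qed (use X_el in blast)
  have zz_X: "((x, k), (x', k')) \<in> zigzag C E L z"
    if z: "z \<in> Ob C" and x: "x \<in> X" "x' \<in> X" "k \<in> Hom C (fst x) z" "k' \<in> Hom C (fst x') z"
      and eq: "FMor P (fst x) z k (snd x) = FMor P (fst x') z k' (snd x')" for z x x' k k'
  proof -
    obtain w g g' h where w: "(w, g, g') \<in> V x x'" "h \<in> Hom C w z" "Cmp C (fst x) w z h g = k"
      "Cmp C (fst x') w z h g' = k'"
      using V_cover[OF x(1,2) z x(3,4) eq] by blast
    define l where "l = (w, FMor P (fst x) w g (snd x))"
    have "l \<in> L" unfolding L_def l_def using x w(1) by (force simp: rel_def)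
    note * = V[OF x(1,2) w(1)] X_el[OF x(1)] X_el[OF x(2)]
    have "((x, k), (l, h)) \<in> step C E L z"
      using w x X_L \<open>l \<in> L\<close> * E(2) unfolding step_def l_def by auto
    moreover have "((x', k'), (l, h)) \<in> step C E L z"
      using w x X_L \<open>l \<in> L\<close> * E(2) unfolding step_def l_def by auto
    ultimately show ?thesis by (meson zigzag_step zigzag_sym zigzag_trans)
  qed
  \<comment> \<open>The added generators call for no further relations: each receives an arrow from
    an element of \<open>X\<close>, which moves every comparison back into \<open>X\<close>.\<close>
  have to_X: "\<exists>x\<in>X. \<exists>k'\<in>Hom C (fst x) z. ((x, k'), (l, k)) \<in> zigzag C E L z \<and>
      FMor P (fst x) z k' (snd x) = FMor P (fst l) z k (snd l)"
    if z: "z \<in> Ob C" and l: "l \<in> L" "k \<in> Hom C (fst l) z" for z l k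
  proof -
    note le = L_el[OF l(1)]
    then obtain x t where x: "x \<in> X" "t \<in> Hom C (fst x) (fst l)" "FMor P (fst x) (fst l) t (snd x) = snd l"
      using X_gen[of "fst l" "snd l"] by blast
    note xe = X_el[OF x(1)]
    have "((x, Cmp C (fst x) (fst l) z k t), (l, k)) \<in> step C E L z"
      using x l X_L xe le z E(2) unfolding step_def by auto
    then have "((x, Cmp C (fst x) (fst l) z k t), (l, k)) \<in> zigzag C E L z"
      by (rule zigzag_step)
    moreover have "FMor P (fst x) z (Cmp C (fst x) (fst l) z k t) (snd x) = FMor P (fst l) z k (snd l)"
      using x l xe le z E_sub by simp
    moreover have "Cmp C (fst x) (fst l) z k t \<in> Hom C (fst x) z"
      using x l xe le z by simp
    ultimately show ?thesis using x(1) by (intro bexI conjI)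
  qed
  have "presents C E L"
    unfolding presents_def
  proof (intro conjI ballI impI)
    show "small_for TYPE('u) L" by fact
    show "fst l \<in> Ob C" "snd l \<in> FOb E (fst l)" if "l \<in> L" for l using L_el that by auto
  next
    fix z p assume z: "z \<in> Ob C" "p \<in> FOb E z"
    then obtain x k where x: "x \<in> X" "k \<in> Hom C (fst x) z" "FMor P (fst x) z k (snd x) = p"
      using X_gen by blast
    then have "FMor E (fst x) z k (snd x) = p" using E(2) X_el z by simp
    then show "\<exists>m\<in>L. \<exists>k\<in>Hom C (fst m) z. FMor E (fst m) z k (snd m) = p"
      using x X_L by blast
  next
    fix z l l' k k' assume z: "z \<in> Ob C" and l: "l \<in> L" "l' \<in> L" "k \<in> Hom C (fst l) z" "k' \<in> Hom C (fst l') z"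
      and eq: "FMor E (fst l) z k (snd l) = FMor E (fst l') z k' (snd l')"
    have eq': "FMor P (fst l) z k (snd l) = FMor P (fst l') z k' (snd l')"
      using eq l z L_el[OF l(1)] L_el[OF l(2)] by (simp add: E(2))
    obtain x a where x: "x \<in> X" "a \<in> Hom C (fst x) z" "((x, a), (l, k)) \<in> zigzag C E L z"
      "FMor P (fst x) z a (snd x) = FMor P (fst l) z k (snd l)"
      using to_X[OF z l(1,3)] by blast
    obtain x' a' where x': "x' \<in> X" "a' \<in> Hom C (fst x') z" "((x', a'), (l', k')) \<in> zigzag C E L z"
      "FMor P (fst x') z a' (snd x') = FMor P (fst l') z k' (snd l')"
      using to_X[OF z l(2,4)] by blast
    have "((x, a), (x', a')) \<in> zigzag C E L z"
      using zz_X[OF z x(1) x'(1) x(2) x'(2)] x(4) x'(4) eq' by simp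
    then show "((l, k), (l', k')) \<in> zigzag C E L z"
      using x(3) x'(3) by (meson zigzag_sym zigzag_trans)
  qed
  then show thesis by (rule that)
qed

text \<open>The shape with two arrows from \<open>o0\<close> to \<open>o1\<close> and one from
  \<open>o0\<close> to \<open>o2\<close> is finite and connected, and every arrow other than an
  identity starts at \<open>o0\<close>.\<close>

lemma has_span_colimits_of_finite_connected:
  fixes C :: "('o, 'u) cat"
  assumes U: "size_universe TYPE('u)" and C: "has_finite_connected_colimits C"
  shows "has_span_colimits C"
  unfolding has_span_colimits_def
proof (intro ballI)
  fix p q r f g n
  assume *: "p \<in> Ob C" "q \<in> Ob C" "r \<in> Ob C" "f \<in> Hom C p q" "g \<in> Hom C p q" "n \<in> Hom C p r"
  interpret category C using C by (simp add: has_finite_connected_colimits_def)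
  obtain X :: "'u set" where "finite X" "card X = 3"
    using infinite_arbitrarily_large[OF infinite_universe[OF U]] by blast
  then obtain o0 o1 o2 :: 'u where o: "o0 \<noteq> o1" "o0 \<noteq> o2" "o1 \<noteq> o2"
    by (auto simp: card_3_iff)
  note o' = o o[symmetric]
  \<comment> \<open>The three codes serve as objects and as arrows alike, since hom-sets may
    overlap: \<open>o0\<close> is every identity, \<open>o1\<close> and \<open>o2\<close> are the
    parallel arrows, and \<open>o1\<close> is also the arrow to \<open>o2\<close>. Two arrows other
    than identities never compose, so composition just returns the one that differs from
    \<open>o0\<close>.\<close>
  define J :: "('u, 'u) cat" where
    "J = \<lparr>Ob = {o0, o1, o2},
      Hom = (\<lambda>x y. if x = y then {o0} else if x = o0 \<and> y = o1 then {o1, o2}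
        else if x = o0 \<and> y = o2 then {o1} else {}),
      Ide = (\<lambda>_. o0), Cmp = (\<lambda>x y z b a. if a = o0 then b else a)\<rparr>"
  have J_simps: "Ob J = {o0, o1, o2}" "Ide J x = o0" "Cmp J x y z b a = (if a = o0 then b else a)"
    "Hom J x y = (if x = y then {o0} else if x = o0 \<and> y = o1 then {o1, o2}
        else if x = o0 \<and> y = o2 then {o1} else {})" for x y z a b
    by (simp_all add: J_def)
  have J: "category J"
    by unfold_locales (use o' in \<open>auto simp: J_simps split: if_splits\<close>)
  have "finite_cat J"
    using J by (auto simp: finite_cat_def J_simps)
  moreover have "connected_cat J"
  proof -
    let ?R = "{(v, w). v \<in> Ob J \<and> w \<in> Ob J \<and> (Hom J v w \<noteq> {} \<or> Hom J w v \<noteq> {})}"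
    have "(x, o0) \<in> ?R\<^sup>*" "(o0, x) \<in> ?R\<^sup>*" if "x \<in> Ob J" for x
      by (rule r_into_rtrancl, use that o' in \<open>auto simp: J_simps\<close>)+
    then show ?thesis
      unfolding connected_cat_def using J by (auto simp: J_simps intro: rtrancl_trans)
  qed
  moreover define D :: "('u, 'o, 'u, 'u) func" where
    "D = \<lparr>FOb = (\<lambda>x. if x = o0 then p else if x = o1 then q else r),
      FMor = (\<lambda>x y t. if x = y then Ide C (if x = o0 then p else if x = o1 then q else r)
        else if y = o1 then (if t = o1 then f else g) else n)\<rparr>"
  have D_simps: "FOb D o0 = p" "FOb D o1 = q" "FOb D o2 = r" "FMor D o0 o1 o1 = f" "FMor D o0 o1 o2 = g"
    "FMor D o0 o2 o1 = n" "FMor D o0 o0 t = Ide C p" "FMor D o1 o1 t = Ide C q" "FMor D o2 o2 t = Ide C r" for t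
    using o' by (simp_all add: D_def)
  have "is_functor J C D"
    unfolding is_functor_def is_functor_axioms_def
    using J * o' category_axioms by (auto simp: J_simps D_simps split: if_splits)
  ultimately obtain z \<iota> where colim: "is_colimit J C D z \<iota>"
    using C unfolding has_finite_connected_colimits_def by blast
  \<comment> \<open>The leg at \<open>o0\<close> is determined by the other two.\<close>
  have cocone_iff: "is_cocone J C D z' \<kappa> \<longleftrightarrow>
      span_cocone C p q r f g n z' (\<kappa> o1) (\<kappa> o2) \<and> \<kappa> o0 = Cmp C p r z' (\<kappa> o2) n" for z' \<kappa>
    unfolding is_cocone_def span_cocone_def using * o' by (auto simp: J_simps D_simps)
  show "\<exists>z u v. span_cocone C p q r f g n z u v \<and>
      (\<forall>z' u' v'. span_cocone C p q r f g n z' u' v' \<longrightarrow>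
        (\<exists>h\<in>Hom C z z'. Cmp C q z z' h u = u' \<and> Cmp C r z z' h v = v'))"
  proof (intro exI conjI allI impI)
    show "span_cocone C p q r f g n z (\<iota> o1) (\<iota> o2)"
      using colim by (simp add: is_colimit_def cocone_iff)
    fix z' u' v' assume s: "span_cocone C p q r f g n z' u' v'"
    define \<kappa> where "\<kappa> x = (if x = o0 then Cmp C p r z' v' n else if x = o1 then u' else v')" for x
    have \<kappa>: "\<kappa> o0 = Cmp C p r z' v' n" "\<kappa> o1 = u'" "\<kappa> o2 = v'" using o' by (simp_all add: \<kappa>_def)
    have "is_cocone J C D z' \<kappa>" using s by (simp add: cocone_iff \<kappa>)
    then obtain h where "h \<in> Hom C z z'" "\<forall>j\<in>Ob J. Cmp C (FOb D j) z z' h (\<iota> j) = \<kappa> j"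
      using colim unfolding is_colimit_def by blast
    then show "\<exists>h\<in>Hom C z z'. Cmp C q z z' h (\<iota> o1) = u' \<and> Cmp C r z z' h (\<iota> o2) = v'"
      by (auto simp: J_simps D_simps \<kappa>)
  qed
qed

section \<open>Algebras of a monad\<close>

lemma EM_simps:
  "x \<in> Ob (EM C T) \<longleftrightarrow> is_algebra C T (fst x) (snd x)"
  "Hom (EM C T) x y = {f \<in> Hom C (fst x) (fst y).
     Cmp C (FOb (Fun T) (fst x)) (fst x) (fst y) f (snd x)
     = Cmp C (FOb (Fun T) (fst x)) (FOb (Fun T) (fst y)) (fst y) (snd y) (FMor (Fun T) (fst x) (fst y) f)}"
  "Ide (EM C T) x = Ide C (fst x)"
  "Cmp (EM C T) x y z g f = Cmp C (fst x) (fst y) (fst z) g f"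
  by (simp_all add: EM_def case_prod_beta)

context monad
begin

lemma unit_in [simp]: "x \<in> Ob C \<Longrightarrow> Unit T x \<in> Hom C x (FOb (Fun T) x)"
  using unit.component_in by simp

lemma mult_in [simp]:
  "x \<in> Ob C \<Longrightarrow> Mult T x \<in> Hom C (FOb (Fun T) (FOb (Fun T) x)) (FOb (Fun T) x)"
  using mult.component_in by simp

lemma unit_nat:
  "\<lbrakk>x \<in> Ob C; y \<in> Ob C; f \<in> Hom C x y\<rbrakk> \<Longrightarrow>
    Cmp C x (FOb (Fun T) x) (FOb (Fun T) y) (FMor (Fun T) x y f) (Unit T x)
    = Cmp C x y (FOb (Fun T) y) (Unit T y) f"
  using unit.naturality by simp

lemma mult_nat:
  "\<lbrakk>x \<in> Ob C; y \<in> Ob C; f \<in> Hom C x y\<rbrakk> \<Longrightarrow>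
    Cmp C (FOb (Fun T) (FOb (Fun T) x)) (FOb (Fun T) x) (FOb (Fun T) y) (FMor (Fun T) x y f) (Mult T x)
    = Cmp C (FOb (Fun T) (FOb (Fun T) x)) (FOb (Fun T) (FOb (Fun T) y)) (FOb (Fun T) y) (Mult T y)
        (FMor (Fun T) (FOb (Fun T) x) (FOb (Fun T) y) (FMor (Fun T) x y f))"
  using mult.naturality by simp

lemma algebraD:
  assumes "x \<in> Ob (EM C T)"
  shows "fst x \<in> Ob C" "snd x \<in> Hom C (FOb (Fun T) (fst x)) (fst x)"
    "Cmp C (fst x) (FOb (Fun T) (fst x)) (fst x) (snd x) (Unit T (fst x)) = Ide C (fst x)"
    "Cmp C (FOb (Fun T) (FOb (Fun T) (fst x))) (FOb (Fun T) (fst x)) (fst x) (snd x) (Mult T (fst x))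
     = Cmp C (FOb (Fun T) (FOb (Fun T) (fst x))) (FOb (Fun T) (fst x)) (fst x) (snd x)
         (FMor (Fun T) (FOb (Fun T) (fst x)) (fst x) (snd x))"
  using assms by (simp_all add: EM_simps is_algebra_def)

lemma algebra_homD:
  assumes "f \<in> Hom (EM C T) x y"
  shows "f \<in> Hom C (fst x) (fst y)"
    "Cmp C (FOb (Fun T) (fst x)) (fst x) (fst y) f (snd x)
     = Cmp C (FOb (Fun T) (fst x)) (FOb (Fun T) (fst y)) (fst y) (snd y) (FMor (Fun T) (fst x) (fst y) f)"
  using assms by (simp_all add: EM_simps)

lemma category_EM: "category (EM C T)"
proof
  fix x assume "x \<in> Ob (EM C T)"
  note x = algebraD[OF this]
  then show "Ide (EM C T) x \<in> Hom (EM C T) x x" by (simp add: EM_simps)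
next
  fix x y z f g
  assume xyz: "x \<in> Ob (EM C T)" "y \<in> Ob (EM C T)" "z \<in> Ob (EM C T)"
    and fg: "f \<in> Hom (EM C T) x y" "g \<in> Hom (EM C T) y z"
  note [simp] = algebraD(1,2)[OF xyz(1)] algebraD(1,2)[OF xyz(2)] algebraD(1,2)[OF xyz(3)]
    algebra_homD(1)[OF fg(1)] algebra_homD(1)[OF fg(2)]
  let ?T = "FOb (Fun T)"
  have "Cmp C (?T (fst x)) (fst y) (fst z) g (Cmp C (?T (fst x)) (fst x) (fst y) f (snd x))
    = Cmp C (?T (fst x)) (?T (fst y)) (fst z) (Cmp C (?T (fst y)) (fst y) (fst z) g (snd y)) (FMor (Fun T) (fst x) (fst y) f)"
    unfolding algebra_homD(2)[OF fg(1)] by simp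
  then show "Cmp (EM C T) x y z g f \<in> Hom (EM C T) x z"
    unfolding algebra_homD(2)[OF fg(2)] by (simp add: EM_simps)
qed (simp_all add: EM_simps is_algebra_def)

lemma locally_small_EM:
  assumes "locally_small C"
  shows "locally_small (EM C T)"
  unfolding locally_small_def
proof (intro conjI ballI category_EM)
  fix x y assume "x \<in> Ob (EM C T)" "y \<in> Ob (EM C T)"
  then have "small (Hom C (fst x) (fst y))"
    using assms algebraD(1) by (simp add: locally_small_def)
  then show "small (Hom (EM C T) x y)"
    unfolding small_for_small_iff[symmetric] by (rule small_for_subset) (auto simp: EM_simps)
qed

lemma is_functor_forgetful: "is_functor (EM C T) C forgetful"
  using category_EM category_axioms
  by (auto simp: is_functor_def is_functor_axioms_def EM_simps is_algebra_def)

section \<open>Free algebras, and presentations along the forgetful functor\<close>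

definition free :: "'o \<Rightarrow> 'o \<times> 'm" where
  "free c = (FOb (Fun T) c, Mult T c)"

lemma free_in: "c \<in> Ob C \<Longrightarrow> free c \<in> Ob (EM C T)"
  using unit_left mult_assoc by (simp add: free_def EM_simps is_algebra_def)

lemma free_fmor_in:
  "\<lbrakk>c \<in> Ob C; d \<in> Ob C; t \<in> Hom C c d\<rbrakk> \<Longrightarrow> FMor (Fun T) c d t \<in> Hom (EM C T) (free c) (free d)"
  by (simp add: EM_simps free_def mult_nat)

text \<open>The adjunct \<open>F c -> x\<close> of \<open>k : c -> U x\<close>. Composition with the
  unit inverts it, by \<open>transpose_unit\<close> and \<open>transpose_of_unit\<close>.\<close>

definition transpose :: "'o \<Rightarrow> 'o \<times> 'm \<Rightarrow> 'm \<Rightarrow> 'm" where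
  "transpose c x k = Cmp C (FOb (Fun T) c) (FOb (Fun T) (fst x)) (fst x) (snd x) (FMor (Fun T) c (fst x) k)"

lemma transpose_in:
  assumes "c \<in> Ob C" "x \<in> Ob (EM C T)" "k \<in> Hom C c (fst x)"
  shows "transpose c x k \<in> Hom (EM C T) (free c) x"
proof -
  note x = algebraD[OF assms(2)]
  let ?T = "FOb (Fun T)" and ?F = "FMor (Fun T)"
  have "Cmp C (?T (?T c)) (?T c) (fst x) (transpose c x k) (Mult T c)
    = Cmp C (?T (?T c)) (?T (?T (fst x))) (fst x) (Cmp C (?T (?T (fst x))) (?T (fst x)) (fst x) (snd x) (Mult T (fst x)))
       (?F (?T c) (?T (fst x)) (?F c (fst x) k))"
    using assms x(1,2) by (simp add: transpose_def mult_nat)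
  also have "\<dots> = Cmp C (?T (?T c)) (?T (fst x)) (fst x) (snd x) (?F (?T c) (fst x) (transpose c x k))"
    unfolding x(4) using assms x(1,2) by (simp add: transpose_def)
  finally show ?thesis
    using assms x(1,2) by (simp add: EM_simps free_def) (simp add: transpose_def)
qed

lemma transpose_unit:
  assumes "c \<in> Ob C" "x \<in> Ob (EM C T)" "k \<in> Hom C c (fst x)"
  shows "Cmp C c (FOb (Fun T) c) (fst x) (transpose c x k) (Unit T c) = k"
proof -
  note x = algebraD[OF assms(2)]
  let ?T = "FOb (Fun T)"
  have "Cmp C c (?T c) (fst x) (transpose c x k) (Unit T c)
    = Cmp C c (fst x) (fst x) (Cmp C (fst x) (?T (fst x)) (fst x) (snd x) (Unit T (fst x))) k"
    using assms x(1,2) by (simp add: transpose_def unit_nat)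
  then show ?thesis using x assms by simp
qed

lemma transpose_of_unit:
  assumes "c \<in> Ob C" "x \<in> Ob (EM C T)" "k \<in> Hom (EM C T) (free c) x"
  shows "transpose c x (Cmp C c (FOb (Fun T) c) (fst x) k (Unit T c)) = k"
proof -
  note x = algebraD[OF assms(2)]
  let ?T = "FOb (Fun T)" and ?F = "FMor (Fun T)"
  have k: "k \<in> Hom C (?T c) (fst x)"
    "Cmp C (?T (?T c)) (?T c) (fst x) k (Mult T c) = Cmp C (?T (?T c)) (?T (fst x)) (fst x) (snd x) (?F (?T c) (fst x) k)"
    using algebra_homD[OF assms(3)] by (simp_all add: free_def)
  have "transpose c x (Cmp C c (?T c) (fst x) k (Unit T c))
    = Cmp C (?T c) (?T (?T c)) (fst x) (Cmp C (?T (?T c)) (?T (fst x)) (fst x) (snd x) (?F (?T c) (fst x) k)) (?F c (?T c) (Unit T c))"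
    using assms(1) x(1,2) k(1) by (simp add: transpose_def)
  also have "\<dots> = k"
    unfolding k(2)[symmetric] using assms(1) x(1,2) k(1) by (simp add: unit_right)
  finally show ?thesis .
qed

text \<open>This rests on \<open>C(c, U -) \<cong> C\<^sup>T(F c, -)\<close>.\<close>

theorem presents_forgetful:
  fixes P :: "('o, 'm set, 'm, 'm \<Rightarrow> 'm) func"
  assumes P: "set_functor C P" and M: "presents C P M"
  shows "presents (EM C T) (P \<circ>\<^sub>F forgetful)
    ((\<lambda>m. (free (fst m), FMor P (fst m) (FOb (Fun T) (fst m)) (Unit T (fst m)) (snd m))) ` M)"
    (is "presents _ ?P (?\<phi> ` M)")
proof -
  interpret P: set_functor C P by fact
  let ?T = "FOb (Fun T)"
  note el = presents_element[OF M]
  have \<phi>: "fst (?\<phi> m) = free (fst m)" "snd (?\<phi> m) = FMor P (fst m) (?T (fst m)) (Unit T (fst m)) (snd m)" for m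
    by simp_all
  \<comment> \<open>A generator is carried to the free algebra along the unit, so acting on it by
    \<open>k\<close> is acting on \<open>m\<close> by the adjunct of \<open>k\<close>.\<close>
  have act: "FMor ?P (fst (?\<phi> m)) x k (snd (?\<phi> m)) = FMor P (fst m) (fst x) (Cmp C (fst m) (?T (fst m)) (fst x) k (Unit T (fst m))) (snd m)"
    if "m \<in> M" "x \<in> Ob (EM C T)" "k \<in> Hom (EM C T) (fst (?\<phi> m)) x" for m x k
    using that el[OF that(1)] algebraD[OF that(2)] algebra_homD[OF that(3)] by (simp add: free_def)
  show ?thesis
    unfolding presents_def
  proof (intro conjI ballI impI)
    show "small_for TYPE('m) (?\<phi> ` M)"
      using M by (intro small_for_image) (simp add: presents_def)
    fix l assume "l \<in> ?\<phi> ` M"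
    then show "fst l \<in> Ob (EM C T)" "snd l \<in> FOb ?P (fst l)"
      using el by (auto simp: free_in) (auto simp: free_def)
  next
    fix x p assume x: "x \<in> Ob (EM C T)" "p \<in> FOb ?P x"
    then have "p \<in> FOb P (fst x)" by simp
    then obtain m k where m: "m \<in> M" "fst m \<in> Ob C" "k \<in> Hom C (fst m) (fst x)"
      "FMor P (fst m) (fst x) k (snd m) = p"
      by (rule presents_generates[OF M algebraD(1)[OF x(1)]])
    have "transpose (fst m) x k \<in> Hom (EM C T) (fst (?\<phi> m)) x"
      using transpose_in m x by simp
    moreover have "FMor ?P (fst (?\<phi> m)) x (transpose (fst m) x k) (snd (?\<phi> m)) = p"
      using act[OF m(1) x(1) calculation] transpose_unit[OF m(2) x(1) m(3)] m(4) by (simp only:)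
    ultimately show "\<exists>m\<in>?\<phi> ` M. \<exists>k\<in>Hom (EM C T) (fst m) x. FMor ?P (fst m) x k (snd m) = p"
      using m(1) by blast
  next
    fix x l l' k k'
    assume x: "x \<in> Ob (EM C T)" and l: "l \<in> ?\<phi> ` M" "l' \<in> ?\<phi> ` M"
      and k: "k \<in> Hom (EM C T) (fst l) x" "k' \<in> Hom (EM C T) (fst l') x"
      and eq: "FMor ?P (fst l) x k (snd l) = FMor ?P (fst l') x k' (snd l')"
    obtain m m' where m: "m \<in> M" "m' \<in> M" "l = ?\<phi> m" "l' = ?\<phi> m'" using l by blast
    note m_el = el[OF m(1)] el[OF m(2)]
    have k_free: "k \<in> Hom (EM C T) (free (fst m)) x" "k' \<in> Hom (EM C T) (free (fst m')) x"
      using k m by simp_all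
    \<comment> \<open>Passing to adjuncts moves the coincidence down to \<open>P\<close>, where a
      zigzag exists; transposing carries that zigzag back up.\<close>
    let ?k = "Cmp C (fst m) (?T (fst m)) (fst x) k (Unit T (fst m))"
      and ?k' = "Cmp C (fst m') (?T (fst m')) (fst x) k' (Unit T (fst m'))"
    have "?k \<in> Hom C (fst m) (fst x)" "?k' \<in> Hom C (fst m') (fst x)"
      using m_el algebraD[OF x] algebra_homD(1)[OF k_free(1)] algebra_homD(1)[OF k_free(2)]
      by (simp_all add: free_def)
    moreover have "FMor P (fst m) (fst x) ?k (snd m) = FMor P (fst m') (fst x) ?k' (snd m')"
      using eq k act x m by metis
    ultimately have "((m, ?k), (m', ?k')) \<in> zigzag C P M (fst x)"
      using presents_zigzag[OF M algebraD(1)[OF x] m(1,2)] by blast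
    then have "((\<lambda>(m, k). (?\<phi> m, transpose (fst m) x k)) (m, ?k), (\<lambda>(m, k). (?\<phi> m, transpose (fst m) x k)) (m', ?k'))
      \<in> zigzag (EM C T) ?P (?\<phi> ` M) x"
    proof (rule zigzag_map)
      fix a b assume "(a, b) \<in> step C P M (fst x)"
      then obtain n j n' j' t where s: "a = (n, j)" "b = (n', j')" "n \<in> M" "n' \<in> M"
        "j \<in> Hom C (fst n) (fst x)" "j' \<in> Hom C (fst n') (fst x)" "t \<in> Hom C (fst n) (fst n')"
        "FMor P (fst n) (fst n') t (snd n) = snd n'" "j = Cmp C (fst n) (fst n') (fst x) j' t"
        unfolding step_def by auto
      note n = el[OF s(3)] el[OF s(4)]
      \<comment> \<open>A step along \<open>t\<close> becomes a step along the free homomorphism on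
        \<open>t\<close>; it matches the generators by naturality of the unit.\<close>
      let ?t = "FMor (Fun T) (fst n) (fst n') t"
      have "FMor P (?T (fst n)) (?T (fst n')) ?t (FMor P (fst n) (?T (fst n)) (Unit T (fst n)) (snd n))
        = FMor P (fst n) (?T (fst n')) (Cmp C (fst n) (?T (fst n)) (?T (fst n')) ?t (Unit T (fst n))) (snd n)"
        using s n by simp
      also have "\<dots> = FMor P (fst n') (?T (fst n')) (Unit T (fst n')) (FMor P (fst n) (fst n') t (snd n))"
        unfolding unit_nat[OF conjunct1[OF n(1)] conjunct1[OF n(2)] s(7)] using s n by simp
      finally have t_act: "FMor ?P (fst (?\<phi> n)) (fst (?\<phi> n')) ?t (snd (?\<phi> n)) = snd (?\<phi> n')"
        using s(8) by (simp add: free_def)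
      have "transpose (fst n) x j = Cmp (EM C T) (free (fst n)) (free (fst n')) x (transpose (fst n') x j') ?t"
        using s n algebraD(1,2)[OF x] by (simp add: transpose_def EM_simps free_def)
      moreover have "transpose (fst n) x j \<in> Hom (EM C T) (fst (?\<phi> n)) x"
        "transpose (fst n') x j' \<in> Hom (EM C T) (fst (?\<phi> n')) x"
        "?t \<in> Hom (EM C T) (fst (?\<phi> n)) (fst (?\<phi> n'))"
        using s n x by (simp_all only: fst_conv transpose_in free_fmor_in)
      ultimately have "((?\<phi> n, transpose (fst n) x j), (?\<phi> n', transpose (fst n') x j')) \<in> step (EM C T) ?P (?\<phi> ` M) x"
        unfolding step_def using s(3,4) t_act by (auto simp del: comp_func_simps)
      then show "((\<lambda>(m, k). (?\<phi> m, transpose (fst m) x k)) a, (\<lambda>(m, k). (?\<phi> m, transpose (fst m) x k)) b)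
          \<in> zigzag (EM C T) ?P (?\<phi> ` M) x"
        unfolding s(1,2) by (simp add: zigzag_step)
    qed
    then show "((l, k), (l', k')) \<in> zigzag (EM C T) ?P (?\<phi> ` M) x"
      using transpose_of_unit[OF conjunct1[OF m_el(1)] x k_free(1)]
        transpose_of_unit[OF conjunct1[OF m_el(2)] x k_free(2)] m by simp
  qed
qed

text \<open>The forgetful functor creates limits: the limit in \<open>C\<close> carries exactly one
  structure map that makes its legs homomorphisms, and all equations into it are tested against the
  legs.\<close>

theorem complete_EM:
  assumes "complete C"
  shows "complete (EM C T)"
  unfolding complete_def
proof (intro conjI allI impI category_EM)
  fix J :: "('m, 'm) cat" and D
  assume J: "small_cat J" and D: "is_functor J (EM C T) D"
  interpret D: is_functor J "EM C T" D by fact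
  let ?D = "forgetful \<circ>\<^sub>F D" and ?T = "FOb (Fun T)" and ?F = "FMor (Fun T)"
  have D': "is_functor J C ?D" using D is_functor_forgetful by (rule is_functor_comp)
  then obtain x \<pi> where lim: "is_limit J C ?D x \<pi>"
    using assms J unfolding complete_def by blast
  define d where "d j = fst (FOb D j)" for j
  define \<alpha> where "\<alpha> j = snd (FOb D j)" for j
  have d [simp]: "d j \<in> Ob C" "\<alpha> j \<in> Hom C (?T (d j)) (d j)" if "j \<in> Ob J" for j
    using algebraD(1,2)[OF D.fob_in[OF that]] by (simp_all add: d_def \<alpha>_def)
  have alg: "Cmp C (d j) (?T (d j)) (d j) (\<alpha> j) (Unit T (d j)) = Ide C (d j)"
    "Cmp C (?T (?T (d j))) (?T (d j)) (d j) (\<alpha> j) (Mult T (d j))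
      = Cmp C (?T (?T (d j))) (?T (d j)) (d j) (\<alpha> j) (?F (?T (d j)) (d j) (\<alpha> j))" if "j \<in> Ob J" for j
    using algebraD(3,4)[OF D.fob_in[OF that]] by (simp_all add: d_def \<alpha>_def)
  have Df: "FMor D i j f \<in> Hom C (d i) (d j)"
    "Cmp C (?T (d i)) (d i) (d j) (FMor D i j f) (\<alpha> i) = Cmp C (?T (d i)) (?T (d j)) (d j) (\<alpha> j) (?F (d i) (d j) (FMor D i j f))"
    if "i \<in> Ob J" "j \<in> Ob J" "f \<in> Hom J i j" for i j f
    using algebra_homD[OF D.fmor_in[OF that]] by (simp_all add: d_def \<alpha>_def)
  have cone_iff: "is_cone J C ?D y \<rho> \<longleftrightarrow> y \<in> Ob C \<and> (\<forall>j\<in>Ob J. \<rho> j \<in> Hom C y (d j)) \<and>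
      (\<forall>i\<in>Ob J. \<forall>j\<in>Ob J. \<forall>f\<in>Hom J i j. Cmp C y (d i) (d j) (FMor D i j f) (\<rho> i) = \<rho> j)" for y \<rho>
    by (simp add: is_cone_def d_def)
  have cone: "is_cone J C ?D x \<pi>" using lim by (simp add: is_limit_def)
  then have x [simp]: "x \<in> Ob C" and \<pi> [simp]: "\<And>j. j \<in> Ob J \<Longrightarrow> \<pi> j \<in> Hom C x (d j)"
    and \<pi>_nat: "\<And>i j f. \<lbrakk>i \<in> Ob J; j \<in> Ob J; f \<in> Hom J i j\<rbrakk> \<Longrightarrow> Cmp C x (d i) (d j) (FMor D i j f) (\<pi> i) = \<pi> j"
    by (auto simp: cone_iff)
  have univ: "\<exists>!h. h \<in> Hom C y x \<and> (\<forall>j\<in>Ob J. Cmp C y x (d j) (\<pi> j) h = \<rho> j)" if "is_cone J C ?D y \<rho>" for y \<rho>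
    using lim that unfolding is_limit_def by (simp add: d_def)
  have monic: "h = h'" if y: "y \<in> Ob C" and h: "h \<in> Hom C y x" "h' \<in> Hom C y x"
    and eq: "\<And>j. j \<in> Ob J \<Longrightarrow> Cmp C y x (d j) (\<pi> j) h = Cmp C y x (d j) (\<pi> j) h'" for y h h'
  proof -
    have "Cmp C y (d i) (d j) (FMor D i j f) (Cmp C y x (d i) (\<pi> i) h) = Cmp C y x (d j) (\<pi> j) h"
      if "i \<in> Ob J" "j \<in> Ob J" "f \<in> Hom J i j" for i j f
      using that Df(1)[OF that] y h by (simp add: \<pi>_nat flip: assoc)
    then have "is_cone J C ?D y (\<lambda>j. Cmp C y x (d j) (\<pi> j) h)"
      using y h by (simp add: cone_iff)
    from univ[OF this] show ?thesis using h eq by metis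
  qed
  \<comment> \<open>The structure map of the limit is forced: leg \<open>j\<close> of a homomorphism
    requires \<open>\<pi> j \<cdot> \<xi> = \<alpha> j \<cdot> T (\<pi> j)\<close>, so
    \<open>\<xi>\<close> is what these composites induce.\<close>
  have "is_cone J C ?D (?T x) (\<lambda>j. Cmp C (?T x) (?T (d j)) (d j) (\<alpha> j) (?F x (d j) (\<pi> j)))"
    unfolding cone_iff
  proof (intro conjI ballI)
    fix i j f assume f: "i \<in> Ob J" "j \<in> Ob J" "f \<in> Hom J i j"
    have "Cmp C (?T x) (d i) (d j) (FMor D i j f) (Cmp C (?T x) (?T (d i)) (d i) (\<alpha> i) (?F x (d i) (\<pi> i)))
      = Cmp C (?T x) (?T (d i)) (d j) (Cmp C (?T (d i)) (d i) (d j) (FMor D i j f) (\<alpha> i)) (?F x (d i) (\<pi> i))"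
      using f Df(1)[OF f] by simp
    also have "\<dots> = Cmp C (?T x) (?T (d j)) (d j) (\<alpha> j) (?F x (d j) (Cmp C x (d i) (d j) (FMor D i j f) (\<pi> i)))"
      unfolding Df(2)[OF f] using f Df(1)[OF f] by simp
    finally show "Cmp C (?T x) (d i) (d j) (FMor D i j f) (Cmp C (?T x) (?T (d i)) (d i) (\<alpha> i) (?F x (d i) (\<pi> i)))
      = Cmp C (?T x) (?T (d j)) (d j) (\<alpha> j) (?F x (d j) (\<pi> j))"
      unfolding \<pi>_nat[OF f] .
  qed simp_all
  from univ[OF this] obtain \<xi> where \<xi> [simp]: "\<xi> \<in> Hom C (?T x) x"
    and \<pi>_\<xi>: "\<And>j. j \<in> Ob J \<Longrightarrow> Cmp C (?T x) x (d j) (\<pi> j) \<xi> = Cmp C (?T x) (?T (d j)) (d j) (\<alpha> j) (?F x (d j) (\<pi> j))"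
    by blast
  have algebra: "(x, \<xi>) \<in> Ob (EM C T)"
    unfolding EM_simps is_algebra_def fst_conv snd_conv
  proof (intro conjI)
    show "Cmp C x (?T x) x \<xi> (Unit T x) = Ide C x"
    proof (rule monic)
      fix j assume j: "j \<in> Ob J"
      have "Cmp C x x (d j) (\<pi> j) (Cmp C x (?T x) x \<xi> (Unit T x))
        = Cmp C x (?T x) (d j) (Cmp C (?T x) x (d j) (\<pi> j) \<xi>) (Unit T x)"
        using j by simp
      also have "\<dots> = Cmp C x (d j) (d j) (Cmp C (d j) (?T (d j)) (d j) (\<alpha> j) (Unit T (d j))) (\<pi> j)"
        unfolding \<pi>_\<xi>[OF j] using j by (simp add: unit_nat)
      also have "\<dots> = Cmp C x x (d j) (\<pi> j) (Ide C x)"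
        using j by (simp add: alg)
      finally show "Cmp C x x (d j) (\<pi> j) (Cmp C x (?T x) x \<xi> (Unit T x)) = Cmp C x x (d j) (\<pi> j) (Ide C x)" .
    qed simp_all
    show "Cmp C (?T (?T x)) (?T x) x \<xi> (Mult T x) = Cmp C (?T (?T x)) (?T x) x \<xi> (?F (?T x) x \<xi>)"
    proof (rule monic)
      fix j assume j: "j \<in> Ob J"
      have "Cmp C (?T (?T x)) x (d j) (\<pi> j) (Cmp C (?T (?T x)) (?T x) x \<xi> (Mult T x))
        = Cmp C (?T (?T x)) (?T x) (d j) (Cmp C (?T x) x (d j) (\<pi> j) \<xi>) (Mult T x)"
        using j by simp
      also have "\<dots> = Cmp C (?T (?T x)) (?T (?T (d j))) (d j) (Cmp C (?T (?T (d j))) (?T (d j)) (d j) (\<alpha> j) (Mult T (d j)))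
          (?F (?T x) (?T (d j)) (?F x (d j) (\<pi> j)))"
        unfolding \<pi>_\<xi>[OF j] using j by (simp add: mult_nat)
      also have "\<dots> = Cmp C (?T (?T x)) (?T (d j)) (d j) (\<alpha> j) (?F (?T x) (d j) (Cmp C (?T x) (?T (d j)) (d j) (\<alpha> j) (?F x (d j) (\<pi> j))))"
        unfolding alg(2)[OF j] using j by simp
      also have "\<dots> = Cmp C (?T (?T x)) (?T (d j)) (d j) (\<alpha> j) (?F (?T x) (d j) (Cmp C (?T x) x (d j) (\<pi> j) \<xi>))"
        unfolding \<pi>_\<xi>[OF j] ..
      also have "\<dots> = Cmp C (?T (?T x)) (?T x) (d j) (Cmp C (?T x) (?T (d j)) (d j) (\<alpha> j) (?F x (d j) (\<pi> j))) (?F (?T x) x \<xi>)"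
        using j by simp
      also have "\<dots> = Cmp C (?T (?T x)) x (d j) (\<pi> j) (Cmp C (?T (?T x)) (?T x) x \<xi> (?F (?T x) x \<xi>))"
        unfolding \<pi>_\<xi>[OF j, symmetric] using j by simp
      finally show "Cmp C (?T (?T x)) x (d j) (\<pi> j) (Cmp C (?T (?T x)) (?T x) x \<xi> (Mult T x))
        = Cmp C (?T (?T x)) x (d j) (\<pi> j) (Cmp C (?T (?T x)) (?T x) x \<xi> (?F (?T x) x \<xi>))" .
    qed simp_all
  qed simp_all
  have EM_cone_iff: "is_cone J (EM C T) D y \<rho> \<longleftrightarrow> y \<in> Ob (EM C T) \<and> is_cone J C ?D (fst y) \<rho> \<and>
      (\<forall>j\<in>Ob J. Cmp C (?T (fst y)) (fst y) (d j) (\<rho> j) (snd y)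
        = Cmp C (?T (fst y)) (?T (d j)) (d j) (\<alpha> j) (?F (fst y) (d j) (\<rho> j)))" for y \<rho>
    using algebraD(1)[of y] unfolding is_cone_def by (auto simp: EM_simps d_def \<alpha>_def)
  have "is_limit J (EM C T) D (x, \<xi>) \<pi>"
    unfolding is_limit_def
  proof (intro conjI allI impI)
    show "is_cone J (EM C T) D (x, \<xi>) \<pi>"
      unfolding EM_cone_iff using algebra cone \<pi>_\<xi> by simp
    fix y \<rho> assume y\<rho>: "is_cone J (EM C T) D y \<rho>"
    then have y: "y \<in> Ob (EM C T)" and \<rho>: "is_cone J C ?D (fst y) \<rho>"
      and \<rho>_alg: "\<And>j. j \<in> Ob J \<Longrightarrow> Cmp C (?T (fst y)) (fst y) (d j) (\<rho> j) (snd y)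
        = Cmp C (?T (fst y)) (?T (d j)) (d j) (\<alpha> j) (?F (fst y) (d j) (\<rho> j))"
      by (auto simp: EM_cone_iff)
    note [simp] = algebraD(1,2)[OF y]
    from univ[OF \<rho>] obtain h where h [simp]: "h \<in> Hom C (fst y) x"
      and \<pi>_h: "\<And>j. j \<in> Ob J \<Longrightarrow> Cmp C (fst y) x (d j) (\<pi> j) h = \<rho> j"
      and h_uniq: "\<And>h'. \<lbrakk>h' \<in> Hom C (fst y) x; \<And>j. j \<in> Ob J \<Longrightarrow> Cmp C (fst y) x (d j) (\<pi> j) h' = \<rho> j\<rbrakk> \<Longrightarrow> h' = h"
      by blast
    have "Cmp C (?T (fst y)) (fst y) x h (snd y) = Cmp C (?T (fst y)) (?T x) x \<xi> (?F (fst y) x h)"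
    proof (rule monic)
      fix j assume j: "j \<in> Ob J"
      have "Cmp C (?T (fst y)) x (d j) (\<pi> j) (Cmp C (?T (fst y)) (fst y) x h (snd y))
        = Cmp C (?T (fst y)) (fst y) (d j) (Cmp C (fst y) x (d j) (\<pi> j) h) (snd y)"
        using j by simp
      also have "\<dots> = Cmp C (?T (fst y)) (?T (d j)) (d j) (\<alpha> j) (?F (fst y) (d j) (Cmp C (fst y) x (d j) (\<pi> j) h))"
        unfolding \<pi>_h[OF j] by (rule \<rho>_alg[OF j])
      also have "\<dots> = Cmp C (?T (fst y)) (?T x) (d j) (Cmp C (?T x) (?T (d j)) (d j) (\<alpha> j) (?F x (d j) (\<pi> j))) (?F (fst y) x h)"
        using j by simp
      also have "\<dots> = Cmp C (?T (fst y)) x (d j) (\<pi> j) (Cmp C (?T (fst y)) (?T x) x \<xi> (?F (fst y) x h))"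
        unfolding \<pi>_\<xi>[OF j, symmetric] using j by simp
      finally show "Cmp C (?T (fst y)) x (d j) (\<pi> j) (Cmp C (?T (fst y)) (fst y) x h (snd y))
        = Cmp C (?T (fst y)) x (d j) (\<pi> j) (Cmp C (?T (fst y)) (?T x) x \<xi> (?F (fst y) x h))" .
    qed simp_all
    then show "\<exists>!h. h \<in> Hom (EM C T) y (x, \<xi>) \<and> (\<forall>j\<in>Ob J. Cmp (EM C T) y (x, \<xi>) (FOb D j) (\<pi> j) h = \<rho> j)"
      using \<pi>_h h_uniq by (intro ex1I[of _ h]) (auto simp: EM_simps d_def)
  qed (rule D)
  then show "\<exists>x \<pi>. is_limit J (EM C T) D x \<pi>" by blast
qed

end

section \<open>Pointwise right Kan extensions\<close>

text \<open>Cones with vertex \<open>y\<close> over \<open>K\<close> weighted by \<open>B(b, G -)\<close>.\<close>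

definition kan_cone ::
  "('a, 'm) cat \<Rightarrow> ('b, 'n) cat \<Rightarrow> ('a, 'b, 'm, 'n) func \<Rightarrow> ('a, 'b, 'm, 'n) func \<Rightarrow> 'b \<Rightarrow>
   'b \<Rightarrow> ('a \<Rightarrow> 'n \<Rightarrow> 'n) \<Rightarrow> bool" where
  "kan_cone A B G K b y \<rho> \<longleftrightarrow> y \<in> Ob B \<and>
     (\<forall>a\<in>Ob A. \<forall>f\<in>Hom B b (FOb G a). \<rho> a f \<in> Hom B y (FOb K a)) \<and>
     (\<forall>a\<in>Ob A. \<forall>a'\<in>Ob A. \<forall>t\<in>Hom A a a'. \<forall>f\<in>Hom B b (FOb G a).
        Cmp B y (FOb K a) (FOb K a') (FMor K a a' t) (\<rho> a f)
        = \<rho> a' (Cmp B b (FOb G a) (FOb G a') (FMor G a a' t) f))"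

definition kan_limit ::
  "('a, 'm) cat \<Rightarrow> ('b, 'n) cat \<Rightarrow> ('a, 'b, 'm, 'n) func \<Rightarrow> ('a, 'b, 'm, 'n) func \<Rightarrow> 'b \<Rightarrow>
   'b \<Rightarrow> ('a \<Rightarrow> 'n \<Rightarrow> 'n) \<Rightarrow> bool" where
  "kan_limit A B G K b r \<pi> \<longleftrightarrow> kan_cone A B G K b r \<pi> \<and>
     (\<forall>y \<rho>. kan_cone A B G K b y \<rho> \<longrightarrow>
        (\<exists>!h. h \<in> Hom B y r \<and>
          (\<forall>a\<in>Ob A. \<forall>f\<in>Hom B b (FOb G a). Cmp B y r (FOb K a) (\<pi> a f) h = \<rho> a f)))"

text \<open>Completeness covers small diagrams, while \<open>A\<close> may be large. A weighted cone
  is determined by its values at generators, and zigzags are the only constraint on them, so the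
  weighted limit is the limit of \<open>K\<close> over the elements in \<open>M\<close>.\<close>

lemma kan_limit_exists:
  fixes A :: "('a, 'u) cat" and B :: "('b, 'u) cat"
  assumes A: "locally_small A" and B: "locally_small B" "complete B"
    and G: "is_functor A B G" and K: "is_functor A B K" and b: "b \<in> Ob B"
    and M: "presents A (hom_func B b \<circ>\<^sub>F G) M"
  shows "\<exists>r \<pi>. kan_limit A B G K b r \<pi>"
proof -
  interpret G: is_functor A B G by fact
  interpret K: is_functor A B K by fact
  let ?P = "hom_func B b \<circ>\<^sub>F G"
  have P: "set_functor A ?P" using G set_functor_hom_func[OF B(1) b] by (rule set_functor_comp)
  interpret P: set_functor A ?P by fact
  have "small_for TYPE('u) M" using M by (simp add: presents_def)
  then obtain I :: "'u set" and e where I: "small I" "inj_on e I" "M = e ` I"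
    by (rule small_for_index)
  define c where "c i = fst (e i)" for i
  define x where "x i = snd (e i)" for i
  have el: "fst (e i) \<in> Ob A \<and> snd (e i) \<in> FOb ?P (fst (e i))" if "i \<in> I" for i
    using presents_element[OF M] that unfolding I(3) by auto
  then have c [simp]: "c i \<in> Ob A" "x i \<in> Hom B b (FOb G (c i))" if "i \<in> I" for i
    using that by (simp_all add: c_def x_def)
  \<comment> \<open>Not the opposite, since \<open>K\<close> is covariant in the object of
    \<open>A\<close>.\<close>
  define J where "J = elements_cat A ?P I e"
  have J: "small_cat J"
    unfolding J_def using P.small_cat_elements_cat[OF A I(1) el] .
  interpret J: category J
    using J by (simp add: small_cat_def locally_small_def)
  have J_simps [simp]: "Ob J = I" "Ide J i = Ide A (c i)" "Cmp J i j k g f = Cmp A (c i) (c j) (c k) g f" for i j k f g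
    by (simp_all add: J_def c_def)
  have J_hom [simp]: "Hom J i j = {t \<in> Hom A (c i) (c j). Cmp B b (FOb G (c i)) (FOb G (c j)) (FMor G (c i) (c j) t) (x i) = x j}"
    if "i \<in> I" for i j
    using c[OF that] by (auto simp: J_def c_def x_def)
  define D :: "('u, 'b, 'u, 'u) func" where
    "D = \<lparr>FOb = (\<lambda>i. FOb K (c i)), FMor = (\<lambda>i j t. FMor K (c i) (c j) t)\<rparr>"
  have D_simps [simp]: "FOb D i = FOb K (c i)" "FMor D i j t = FMor K (c i) (c j) t" for i j t
    by (simp_all add: D_def)
  have "is_functor J B D" by unfold_locales auto
  then obtain r p where lim: "is_limit J B D r p"
    using B(2) J unfolding complete_def by blast
  have cone: "is_cone J B D r p" using lim by (simp add: is_limit_def)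
  have r [simp]: "r \<in> Ob B" using cone by (simp add: is_cone_def)
  have p [simp]: "p i \<in> Hom B r (FOb K (c i))" if "i \<in> I" for i
    using cone that by (simp add: is_cone_def)
  have p_nat: "Cmp B r (FOb K (c i)) (FOb K (c j)) (FMor K (c i) (c j) t) (p i) = p j"
    if "i \<in> I" "j \<in> I" "t \<in> Hom A (c i) (c j)" "Cmp B b (FOb G (c i)) (FOb G (c j)) (FMor G (c i) (c j) t) (x i) = x j" for i j t
    using cone that by (simp add: is_cone_def)
  \<comment> \<open>A cone over the generators extends in one possible way, by the action of
    \<open>K\<close> on its legs; \<open>well\<close> shows that the value depends only on the
    represented arrow \<open>b -> G a\<close>.\<close>
  define val where "val a = (\<lambda>(m, k). let i = inv_into I e m in Cmp B r (FOb K (c i)) (FOb K a) (FMor K (c i) a k) (p i))" for a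
  have val: "val a (e i, k) = Cmp B r (FOb K (c i)) (FOb K a) (FMor K (c i) a k) (p i)" if "i \<in> I" for a i k
    using that I(2) by (simp add: val_def)
  have well: "val a (e i, k) = val a (e i', k')"
    if *: "i \<in> I" "i' \<in> I" "a \<in> Ob A" "k \<in> Hom A (c i) a" "k' \<in> Hom A (c i') a"
      and eq: "Cmp B b (FOb G (c i)) (FOb G a) (FMor G (c i) a k) (x i) = Cmp B b (FOb G (c i')) (FOb G a) (FMor G (c i') a k') (x i')"
    for i i' a k k'
  proof -
    have "((e i, k), (e i', k')) \<in> zigzag A ?P M a"
      using * eq c[OF *(1)] c[OF *(2)] by (intro presents_zigzag[OF M]) (auto simp: I(3) c_def x_def)
    then show ?thesis
    proof (rule zigzag_invariant)
      fix s q assume "(s, q) \<in> step A ?P M a"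
      then obtain j j' k k' t where s: "j \<in> I" "j' \<in> I" "s = (e j, k)" "q = (e j', k')"
        "k \<in> Hom A (c j) a" "k' \<in> Hom A (c j') a" "t \<in> Hom A (c j) (c j')"
        "FMor ?P (c j) (c j') t (x j) = x j'" "k = Cmp A (c j) (c j') a k' t"
        unfolding step_def I(3) c_def x_def by (auto simp del: comp_func_simps)
      then have "Cmp B b (FOb G (c j)) (FOb G (c j')) (FMor G (c j) (c j') t) (x j) = x j'" by simp
      from p_nat[OF s(1,2,7) this] show "val a s = val a q"
        using s \<open>a \<in> Ob A\<close> by (simp add: val)
    qed
  qed
  define \<pi> where "\<pi> a f = val a (SOME q. \<exists>i k. q = (e i, k) \<and> i \<in> I \<and> k \<in> Hom A (c i) a \<and>
      Cmp B b (FOb G (c i)) (FOb G a) (FMor G (c i) a k) (x i) = f)" for a f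
  have \<pi>: "\<pi> a (Cmp B b (FOb G (c i)) (FOb G a) (FMor G (c i) a k) (x i)) = Cmp B r (FOb K (c i)) (FOb K a) (FMor K (c i) a k) (p i)"
    if *: "i \<in> I" "a \<in> Ob A" "k \<in> Hom A (c i) a" for i a k
  proof -
    let ?f = "Cmp B b (FOb G (c i)) (FOb G a) (FMor G (c i) a k) (x i)"
    let ?R = "\<lambda>q. \<exists>i k. q = (e i, k) \<and> i \<in> I \<and> k \<in> Hom A (c i) a \<and>
      Cmp B b (FOb G (c i)) (FOb G a) (FMor G (c i) a k) (x i) = ?f"
    have "?R (Eps ?R)" by (rule someI[of ?R "(e i, k)"]) (use * in blast)
    then obtain i' k' where "Eps ?R = (e i', k')" "i' \<in> I" "k' \<in> Hom A (c i') a"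
      "Cmp B b (FOb G (c i')) (FOb G a) (FMor G (c i') a k') (x i') = ?f" by blast
    then show ?thesis using * well[of i' i a k' k] val[of i] by (simp add: \<pi>_def)
  qed
  have gen: "\<exists>i k. i \<in> I \<and> k \<in> Hom A (c i) a \<and> f = Cmp B b (FOb G (c i)) (FOb G a) (FMor G (c i) a k) (x i)"
    if a: "a \<in> Ob A" and f: "f \<in> Hom B b (FOb G a)" for a f
  proof -
    have "f \<in> FOb ?P a" using f by simp
    then obtain m k where m: "m \<in> M" "k \<in> Hom A (fst m) a" "FMor ?P (fst m) a k (snd m) = f"
      by (rule presents_generates[OF M a])
    then obtain i where i: "i \<in> I" "m = e i" unfolding I(3) by blast
    then show ?thesis using m c[OF i(1)] unfolding c_def x_def by auto
  qed
  have "kan_cone A B G K b r \<pi>"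
    unfolding kan_cone_def
  proof (intro conjI ballI)
    fix a f assume a: "a \<in> Ob A" and f: "f \<in> Hom B b (FOb G a)"
    then obtain i k where i: "i \<in> I" "k \<in> Hom A (c i) a" "f = Cmp B b (FOb G (c i)) (FOb G a) (FMor G (c i) a k) (x i)"
      using gen by blast
    then show "\<pi> a f \<in> Hom B r (FOb K a)" using a \<pi> by simp
    fix a' t assume t: "a' \<in> Ob A" "t \<in> Hom A a a'"
    then show "Cmp B r (FOb K a) (FOb K a') (FMor K a a' t) (\<pi> a f) = \<pi> a' (Cmp B b (FOb G a) (FOb G a') (FMor G a a' t) f)"
      using i a \<pi>[of i a k] \<pi>[of i a' "Cmp A (c i) a a' t k"] b by simp
  qed (rule r)
  moreover have "\<exists>!h. h \<in> Hom B y r \<and> (\<forall>a\<in>Ob A. \<forall>f\<in>Hom B b (FOb G a). Cmp B y r (FOb K a) (\<pi> a f) h = \<rho> a f)"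
    if \<rho>: "kan_cone A B G K b y \<rho>" for y \<rho>
  proof -
    have y [simp]: "y \<in> Ob B" using \<rho> by (simp add: kan_cone_def)
    have \<rho>_in [simp]: "\<rho> a f \<in> Hom B y (FOb K a)" if "a \<in> Ob A" "f \<in> Hom B b (FOb G a)" for a f
      using \<rho> that by (simp add: kan_cone_def)
    have \<rho>_nat: "Cmp B y (FOb K a) (FOb K a') (FMor K a a' t) (\<rho> a f) = \<rho> a' (Cmp B b (FOb G a) (FOb G a') (FMor G a a' t) f)"
      if "a \<in> Ob A" "a' \<in> Ob A" "t \<in> Hom A a a'" "f \<in> Hom B b (FOb G a)" for a a' t f
      using \<rho> that by (simp add: kan_cone_def)
    have "is_cone J B D y (\<lambda>i. \<rho> (c i) (x i))"
      by (auto simp: is_cone_def \<rho>_nat)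
    then have ex1: "\<exists>!h. h \<in> Hom B y r \<and> (\<forall>i\<in>I. Cmp B y r (FOb K (c i)) (p i) h = \<rho> (c i) (x i))"
      using lim unfolding is_limit_def by simp
    then obtain h where h: "h \<in> Hom B y r" "\<And>i. i \<in> I \<Longrightarrow> Cmp B y r (FOb K (c i)) (p i) h = \<rho> (c i) (x i)"
      by blast
    show ?thesis
    proof (intro ex1I[of _ h] conjI ballI)
      fix a f assume a: "a \<in> Ob A" and f: "f \<in> Hom B b (FOb G a)"
      then obtain i k where i: "i \<in> I" "k \<in> Hom A (c i) a" "f = Cmp B b (FOb G (c i)) (FOb G a) (FMor G (c i) a k) (x i)"
        using gen by blast
      then show "Cmp B y r (FOb K a) (\<pi> a f) h = \<rho> a f"
        using a h \<pi>[of i a k] \<rho>_nat[of "c i" a k "x i"] by simp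
    next
      fix h' assume h': "h' \<in> Hom B y r \<and> (\<forall>a\<in>Ob A. \<forall>f\<in>Hom B b (FOb G a). Cmp B y r (FOb K a) (\<pi> a f) h' = \<rho> a f)"
      have "Cmp B y r (FOb K (c i)) (p i) h' = \<rho> (c i) (x i)" if i: "i \<in> I" for i
      proof -
        \<comment> \<open>The identity represents the generator itself, so the extended cone
          restricts to the given limit cone.\<close>
        have "\<pi> (c i) (x i) = p i" using \<pi>[of i "c i" "Ide A (c i)"] i b by simp
        moreover have "Cmp B y r (FOb K (c i)) (\<pi> (c i) (x i)) h' = \<rho> (c i) (x i)" using h' i by simp
        ultimately show ?thesis by simp
      qed
      then show "h' = h" using ex1 h h' by blast
    qed (rule h(1))
  qed
  ultimately show ?thesis unfolding kan_limit_def by blast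
qed

section \<open>The extension functor assembled from chosen limits\<close>

locale pointwise_kan = G: is_functor A B G + K: is_functor A B K
  for A :: "('a, 'm) cat" and B :: "('b, 'n) cat" and G K :: "('a, 'b, 'm, 'n) func" +
  fixes r :: "'b \<Rightarrow> 'b" and \<pi> :: "'b \<Rightarrow> 'a \<Rightarrow> 'n \<Rightarrow> 'n"
  assumes limit: "b \<in> Ob B \<Longrightarrow> kan_limit A B G K b (r b) (\<pi> b)"
begin

lemma r_in [simp]: "b \<in> Ob B \<Longrightarrow> r b \<in> Ob B"
  using limit by (simp add: kan_limit_def kan_cone_def)

lemma \<pi>_in [simp]: "\<lbrakk>b \<in> Ob B; a \<in> Ob A; f \<in> Hom B b (FOb G a)\<rbrakk> \<Longrightarrow> \<pi> b a f \<in> Hom B (r b) (FOb K a)"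
  using limit by (simp add: kan_limit_def kan_cone_def)

lemma \<pi>_nat:
  "\<lbrakk>b \<in> Ob B; a \<in> Ob A; a' \<in> Ob A; t \<in> Hom A a a'; f \<in> Hom B b (FOb G a)\<rbrakk> \<Longrightarrow>
    Cmp B (r b) (FOb K a) (FOb K a') (FMor K a a' t) (\<pi> b a f)
    = \<pi> b a' (Cmp B b (FOb G a) (FOb G a') (FMor G a a' t) f)"
  using limit by (simp add: kan_limit_def kan_cone_def)

lemma \<pi>_factor:
  assumes "b \<in> Ob B" "kan_cone A B G K b y \<rho>"
  shows "\<exists>!h. h \<in> Hom B y (r b) \<and>
    (\<forall>a\<in>Ob A. \<forall>f\<in>Hom B b (FOb G a). Cmp B y (r b) (FOb K a) (\<pi> b a f) h = \<rho> a f)"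
  using limit assms by (simp add: kan_limit_def)

lemma \<pi>_monic:
  assumes b: "b \<in> Ob B" and y: "y \<in> Ob B" and h: "h \<in> Hom B y (r b)" "h' \<in> Hom B y (r b)"
    and eq: "\<And>a f. \<lbrakk>a \<in> Ob A; f \<in> Hom B b (FOb G a)\<rbrakk> \<Longrightarrow>
      Cmp B y (r b) (FOb K a) (\<pi> b a f) h = Cmp B y (r b) (FOb K a) (\<pi> b a f) h'"
  shows "h = h'"
proof -
  have "kan_cone A B G K b y (\<lambda>a f. Cmp B y (r b) (FOb K a) (\<pi> b a f) h)"
    using b y h by (auto simp: kan_cone_def simp flip: \<pi>_nat)
  from \<pi>_factor[OF b this] show ?thesis using h eq by metis
qed

definition R :: "('b, 'b, 'n, 'n) func" where
  "R = \<lparr>FOb = r, FMor = (\<lambda>b b' u. THE h. h \<in> Hom B (r b) (r b') \<and>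
     (\<forall>a\<in>Ob A. \<forall>f\<in>Hom B b' (FOb G a).
        Cmp B (r b) (r b') (FOb K a) (\<pi> b' a f) h = \<pi> b a (Cmp B b b' (FOb G a) f u)))\<rparr>"

text \<open>The leg at the identity. Every other leg is recovered from it by Yoneda:
  \<open>\<pi> b a f\<close> is \<open>\<epsilon> a\<close> after \<open>R f\<close>, which is
  \<open>\<epsilon>_R\<close>.\<close>

definition \<epsilon> :: "'a \<Rightarrow> 'n" where
  "\<epsilon> a = \<pi> (FOb G a) a (Ide B (FOb G a))"

lemma R_ob [simp]: "FOb R b = r b"
  by (simp add: R_def)

lemma R_mor:
  assumes b: "b \<in> Ob B" "b' \<in> Ob B" "u \<in> Hom B b b'"
  shows R_in: "FMor R b b' u \<in> Hom B (r b) (r b')"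
    and \<pi>_R: "\<lbrakk>a \<in> Ob A; f \<in> Hom B b' (FOb G a)\<rbrakk> \<Longrightarrow>
      Cmp B (r b) (r b') (FOb K a) (\<pi> b' a f) (FMor R b b' u) = \<pi> b a (Cmp B b b' (FOb G a) f u)"
proof -
  have "kan_cone A B G K b' (r b) (\<lambda>a f. \<pi> b a (Cmp B b b' (FOb G a) f u))"
    using b by (auto simp: kan_cone_def \<pi>_nat)
  from theI'[OF \<pi>_factor[OF b(2) this]]
  show "FMor R b b' u \<in> Hom B (r b) (r b')"
    and "\<lbrakk>a \<in> Ob A; f \<in> Hom B b' (FOb G a)\<rbrakk> \<Longrightarrow>
      Cmp B (r b) (r b') (FOb K a) (\<pi> b' a f) (FMor R b b' u) = \<pi> b a (Cmp B b b' (FOb G a) f u)"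
    by (simp_all add: R_def)
qed

lemma R_functor: "is_functor B B R"
proof
  fix b assume b: "b \<in> Ob B"
  show "FMor R b b (Ide B b) = Ide B (FOb R b)"
    by (rule \<pi>_monic[of b "r b"]) (use b in \<open>auto simp: \<pi>_R R_in\<close>)
next
  fix b b' b'' u v assume *: "b \<in> Ob B" "b' \<in> Ob B" "b'' \<in> Ob B" "u \<in> Hom B b b'" "v \<in> Hom B b' b''"
  show "FMor R b b'' (Cmp B b b' b'' v u) = Cmp B (FOb R b) (FOb R b') (FOb R b'') (FMor R b' b'' v) (FMor R b b' u)"
  proof (rule \<pi>_monic[of b'' "r b"])
    fix a f assume af: "a \<in> Ob A" "f \<in> Hom B b'' (FOb G a)"
    have "Cmp B (r b) (r b'') (FOb K a) (\<pi> b'' a f) (Cmp B (r b) (r b') (r b'') (FMor R b' b'' v) (FMor R b b' u))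
      = Cmp B (r b) (r b') (FOb K a) (Cmp B (r b') (r b'') (FOb K a) (\<pi> b'' a f) (FMor R b' b'' v)) (FMor R b b' u)"
      using * af by (simp add: R_in)
    also have "\<dots> = \<pi> b a (Cmp B b b'' (FOb G a) f (Cmp B b b' b'' v u))"
      using * af by (simp add: \<pi>_R)
    finally show "Cmp B (r b) (r b'') (FOb K a) (\<pi> b'' a f) (FMor R b b'' (Cmp B b b' b'' v u)) =
      Cmp B (r b) (r b'') (FOb K a) (\<pi> b'' a f) (Cmp B (FOb R b) (FOb R b') (FOb R b'') (FMor R b' b'' v) (FMor R b b' u))"
      using * af by (simp add: \<pi>_R)
  qed (use * in \<open>simp_all add: R_in\<close>)
qed (simp_all add: R_in)

sublocale R: is_functor B B R by (rule R_functor)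

lemma R_in' [simp]: "\<lbrakk>b \<in> Ob B; b' \<in> Ob B; u \<in> Hom B b b'\<rbrakk> \<Longrightarrow> FMor R b b' u \<in> Hom B (r b) (r b')"
  by (rule R_in)

lemma \<epsilon>_in [simp]: "a \<in> Ob A \<Longrightarrow> \<epsilon> a \<in> Hom B (r (FOb G a)) (FOb K a)"
  by (simp add: \<epsilon>_def)

lemma \<epsilon>_R:
  "\<lbrakk>b \<in> Ob B; a \<in> Ob A; f \<in> Hom B b (FOb G a)\<rbrakk> \<Longrightarrow>
    Cmp B (r b) (r (FOb G a)) (FOb K a) (\<epsilon> a) (FMor R b (FOb G a) f) = \<pi> b a f"
  by (simp add: \<epsilon>_def \<pi>_R)

lemma \<epsilon>_nat:
  "\<lbrakk>a \<in> Ob A; a' \<in> Ob A; t \<in> Hom A a a'\<rbrakk> \<Longrightarrow>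
    Cmp B (r (FOb G a)) (r (FOb G a')) (FOb K a') (\<epsilon> a') (FMor R (FOb G a) (FOb G a') (FMor G a a' t))
    = Cmp B (r (FOb G a)) (FOb K a) (FOb K a') (FMor K a a' t) (\<epsilon> a)"
  by (simp add: \<epsilon>_R) (simp add: \<epsilon>_def \<pi>_nat)

text \<open>Joint monicity expressed through \<open>R\<close> and \<open>\<epsilon>\<close> alone.
  Together with \<open>factor\<close> it replaces the limit property when the monad structure is
  built and its laws are checked.\<close>

lemma monic:
  assumes "b \<in> Ob B" "y \<in> Ob B" "h \<in> Hom B y (r b)" "h' \<in> Hom B y (r b)"
    and "\<And>a f. \<lbrakk>a \<in> Ob A; f \<in> Hom B b (FOb G a)\<rbrakk> \<Longrightarrow>
      Cmp B y (r (FOb G a)) (FOb K a) (\<epsilon> a) (Cmp B y (r b) (r (FOb G a)) (FMor R b (FOb G a) f) h)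
      = Cmp B y (r (FOb G a)) (FOb K a) (\<epsilon> a) (Cmp B y (r b) (r (FOb G a)) (FMor R b (FOb G a) f) h')"
  shows "h = h'"
proof (rule \<pi>_monic[OF assms(1-4)])
  fix a f assume af: "a \<in> Ob A" "f \<in> Hom B b (FOb G a)"
  show "Cmp B y (r b) (FOb K a) (\<pi> b a f) h = Cmp B y (r b) (FOb K a) (\<pi> b a f) h'"
    using assms(5)[OF af] af assms(1-4) by (simp flip: \<epsilon>_R)
qed

lemma factor:
  assumes "b \<in> Ob B" "kan_cone A B G K b y \<rho>"
  shows "\<exists>h\<in>Hom B y (r b). \<forall>a\<in>Ob A. \<forall>f\<in>Hom B b (FOb G a).
    Cmp B y (r (FOb G a)) (FOb K a) (\<epsilon> a) (Cmp B y (r b) (r (FOb G a)) (FMor R b (FOb G a) f) h) = \<rho> a f"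
proof -
  obtain h where h: "h \<in> Hom B y (r b)"
    "\<And>a f. \<lbrakk>a \<in> Ob A; f \<in> Hom B b (FOb G a)\<rbrakk> \<Longrightarrow> Cmp B y (r b) (FOb K a) (\<pi> b a f) h = \<rho> a f"
    using \<pi>_factor[OF assms] by blast
  have "y \<in> Ob B" using assms(2) by (simp add: kan_cone_def)
  then show ?thesis using h assms(1) by (intro bexI[of _ h]) (auto simp flip: \<epsilon>_R)
qed

text \<open>A transformation \<open>H G -> K\<close> is the same as a weighted cone with vertex
  \<open>H b\<close> for each \<open>b\<close>, naturally in \<open>b\<close>; the limits then
  supply the components of \<open>\<delta>\<close> one by one.\<close>

lemma right_kan: "is_right_kan_extension A B B G K R \<epsilon>"
  unfolding is_right_kan_extension_def
proof (intro conjI allI impI)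
  show nt: "nat_trans A B (R \<circ>\<^sub>F G) K \<epsilon>"
    by (intro nat_trans.intro nat_trans_axioms.intro is_functor_comp[OF G.is_functor_axioms R_functor])
      (auto simp: \<epsilon>_nat K.is_functor_axioms)
  fix H \<gamma> assume H: "is_functor B B H" and \<gamma>: "nat_trans A B (H \<circ>\<^sub>F G) K \<gamma>"
  interpret H: is_functor B B H by fact
  interpret \<gamma>: nat_trans A B "H \<circ>\<^sub>F G" K \<gamma> by fact
  have \<gamma>_in [simp]: "\<gamma> a \<in> Hom B (FOb H (FOb G a)) (FOb K a)" if "a \<in> Ob A" for a
    using \<gamma>.component_in[OF that] by simp
  have \<gamma>_nat: "Cmp B (FOb H (FOb G a)) (FOb K a) (FOb K a') (FMor K a a' t) (\<gamma> a)
      = Cmp B (FOb H (FOb G a)) (FOb H (FOb G a')) (FOb K a') (\<gamma> a') (FMor H (FOb G a) (FOb G a') (FMor G a a' t))"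
    if "a \<in> Ob A" "a' \<in> Ob A" "t \<in> Hom A a a'" for a a' t
    using \<gamma>.naturality[OF that] by simp
  \<comment> \<open>What \<open>\<pi> b a f\<close> after the sought component at \<open>b\<close>
    has to be, by naturality at \<open>f\<close> and the triangle with
    \<open>\<gamma>\<close>.\<close>
  define \<rho> where "\<rho> b a f = Cmp B (FOb H b) (FOb H (FOb G a)) (FOb K a) (\<gamma> a) (FMor H b (FOb G a) f)" for b a f
  have cone: "kan_cone A B G K b (FOb H b) (\<rho> b)" if "b \<in> Ob B" for b
    unfolding kan_cone_def
  proof (intro conjI ballI)
    fix a a' t f assume *: "a \<in> Ob A" "a' \<in> Ob A" "t \<in> Hom A a a'" "f \<in> Hom B b (FOb G a)"
    have "Cmp B (FOb H b) (FOb K a) (FOb K a') (FMor K a a' t) (\<rho> b a f)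
      = Cmp B (FOb H b) (FOb H (FOb G a)) (FOb K a') (Cmp B (FOb H (FOb G a)) (FOb K a) (FOb K a') (FMor K a a' t) (\<gamma> a)) (FMor H b (FOb G a) f)"
      using * that by (simp add: \<rho>_def)
    then show "Cmp B (FOb H b) (FOb K a) (FOb K a') (FMor K a a' t) (\<rho> b a f) = \<rho> b a' (Cmp B b (FOb G a) (FOb G a') (FMor G a a' t) f)"
      unfolding \<gamma>_nat[OF *(1-3)] using * that by (simp add: \<rho>_def)
  qed (use that in \<open>simp_all add: \<rho>_def\<close>)
  have "\<forall>b\<in>Ob B. \<exists>h. h \<in> Hom B (FOb H b) (r b) \<and> (\<forall>a\<in>Ob A. \<forall>f\<in>Hom B b (FOb G a).
      Cmp B (FOb H b) (r b) (FOb K a) (\<pi> b a f) h = \<rho> b a f)"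
    using \<pi>_factor[OF _ cone] by blast
  from bchoice[OF this] obtain \<delta>0 where \<delta>0: "\<forall>b\<in>Ob B. \<delta>0 b \<in> Hom B (FOb H b) (r b) \<and> (\<forall>a\<in>Ob A. \<forall>f\<in>Hom B b (FOb G a).
      Cmp B (FOb H b) (r b) (FOb K a) (\<pi> b a f) (\<delta>0 b) = \<rho> b a f)" ..
  \<comment> \<open>Arrows of \<open>functor_cat\<close> are extensional; without the restriction
    uniqueness would fail.\<close>
  define \<delta> where "\<delta> = restrict \<delta>0 (Ob B)"
  have \<delta>_in [simp]: "\<delta> b \<in> Hom B (FOb H b) (r b)" if "b \<in> Ob B" for b
    using \<delta>0 that by (simp add: \<delta>_def)
  have \<pi>_\<delta>: "Cmp B (FOb H b) (r b) (FOb K a) (\<pi> b a f) (\<delta> b) = \<rho> b a f"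
    if "b \<in> Ob B" "a \<in> Ob A" "f \<in> Hom B b (FOb G a)" for b a f
    using \<delta>0 that by (simp add: \<delta>_def)
  have "nat_trans B B H R \<delta>"
  proof (intro nat_trans.intro nat_trans_axioms.intro H R_functor)
    fix b b' u assume u: "b \<in> Ob B" "b' \<in> Ob B" "u \<in> Hom B b b'"
    show "Cmp B (FOb H b) (FOb H b') (FOb R b') (\<delta> b') (FMor H b b' u) = Cmp B (FOb H b) (FOb R b) (FOb R b') (FMor R b b' u) (\<delta> b)"
    proof (rule \<pi>_monic[of b' "FOb H b"])
      fix a f assume af: "a \<in> Ob A" "f \<in> Hom B b' (FOb G a)"
      have "Cmp B (FOb H b) (r b') (FOb K a) (\<pi> b' a f) (Cmp B (FOb H b) (FOb H b') (r b') (\<delta> b') (FMor H b b' u))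
        = Cmp B (FOb H b) (FOb H b') (FOb K a) (Cmp B (FOb H b') (r b') (FOb K a) (\<pi> b' a f) (\<delta> b')) (FMor H b b' u)"
        using u af by simp
      also have "\<dots> = \<rho> b a (Cmp B b b' (FOb G a) f u)"
        using u af by (simp add: \<pi>_\<delta>) (simp add: \<rho>_def)
      also have "\<dots> = Cmp B (FOb H b) (r b) (FOb K a) (Cmp B (r b) (r b') (FOb K a) (\<pi> b' a f) (FMor R b b' u)) (\<delta> b)"
        using u af by (simp add: \<pi>_R \<pi>_\<delta>)
      also have "\<dots> = Cmp B (FOb H b) (r b') (FOb K a) (\<pi> b' a f) (Cmp B (FOb H b) (r b) (r b') (FMor R b b' u) (\<delta> b))"
        using u af by simp
      finally show "Cmp B (FOb H b) (r b') (FOb K a) (\<pi> b' a f) (Cmp B (FOb H b) (FOb H b') (FOb R b') (\<delta> b') (FMor H b b' u))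
        = Cmp B (FOb H b) (r b') (FOb K a) (\<pi> b' a f) (Cmp B (FOb H b) (FOb R b) (FOb R b') (FMor R b b' u) (\<delta> b))"
        by simp
    qed (use u in simp_all)
  qed simp
  moreover have "Cmp B (FOb H (FOb G a)) (FOb R (FOb G a)) (FOb K a) (\<epsilon> a) (\<delta> (FOb G a)) = \<gamma> a" if "a \<in> Ob A" for a
    using that by (simp add: \<epsilon>_def \<pi>_\<delta>) (simp add: \<rho>_def)
  moreover have "\<delta>' = \<delta>" if \<delta>': "\<delta>' \<in> Hom (functor_cat B B) H R"
      "\<forall>a\<in>Ob A. Cmp B (FOb H (FOb G a)) (FOb R (FOb G a)) (FOb K a) (\<epsilon> a) (\<delta>' (FOb G a)) = \<gamma> a" for \<delta>'
  proof (rule extensionalityI[of _ "Ob B"])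
    interpret \<delta>': nat_trans B B H R \<delta>' using \<delta>' by simp
    have \<delta>'_in [simp]: "\<delta>' b \<in> Hom B (FOb H b) (r b)" if "b \<in> Ob B" for b
      using \<delta>'.component_in[OF that] by simp
    fix b assume b: "b \<in> Ob B"
    show "\<delta>' b = \<delta> b"
    proof (rule \<pi>_monic[of b "FOb H b"])
      fix a f assume af: "a \<in> Ob A" "f \<in> Hom B b (FOb G a)"
      \<comment> \<open>Splitting the leg into \<open>\<epsilon> a\<close> and \<open>R f\<close>
        lets naturality of \<open>\<delta>'\<close> reduce everything to its values at objects
        \<open>G a\<close>, which the triangle prescribes.\<close>
      have "Cmp B (FOb H b) (r b) (FOb K a) (\<pi> b a f) (\<delta>' b)
        = Cmp B (FOb H b) (r (FOb G a)) (FOb K a) (\<epsilon> a) (Cmp B (FOb H b) (r b) (r (FOb G a)) (FMor R b (FOb G a) f) (\<delta>' b))"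
        using b af by (simp flip: \<epsilon>_R)
      also have "\<dots> = Cmp B (FOb H b) (FOb H (FOb G a)) (FOb K a) (Cmp B (FOb H (FOb G a)) (r (FOb G a)) (FOb K a) (\<epsilon> a) (\<delta>' (FOb G a))) (FMor H b (FOb G a) f)"
        using b af \<delta>'.naturality[of b "FOb G a" f] by simp
      also have "\<dots> = \<rho> b a f" using \<delta>'(2) af by (simp add: \<rho>_def)
      finally show "Cmp B (FOb H b) (r b) (FOb K a) (\<pi> b a f) (\<delta>' b) = Cmp B (FOb H b) (r b) (FOb K a) (\<pi> b a f) (\<delta> b)"
        using b af by (simp add: \<pi>_\<delta>)
    qed (use b in simp_all)
  qed (use \<delta>' in \<open>simp_all add: \<delta>_def\<close>)
  ultimately show "\<exists>!\<delta>. \<delta> \<in> Hom (functor_cat B B) H R \<and>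
      (\<forall>a\<in>Ob A. Cmp B (FOb H (FOb G a)) (FOb R (FOb G a)) (FOb K a) (\<epsilon> a) (\<delta> (FOb G a)) = \<gamma> a)"
    by (intro ex1I[of _ \<delta>]) (auto simp: \<delta>_def)
qed (rule G.is_functor_axioms K.is_functor_axioms R_functor)+

end

section \<open>The pushforward monad\<close>

locale pushforward = T: monad A T + pointwise_kan A B G "G \<circ>\<^sub>F Fun T" r \<pi>
  for A :: "('a, 'm) cat" and B :: "('b, 'n) cat" and G :: "('a, 'b, 'm, 'n) func" and T r \<pi>
begin

abbreviation "GT a \<equiv> FOb G (FOb (Fun T) a)"
abbreviation "GTm a a' t \<equiv> FMor G (FOb (Fun T) a) (FOb (Fun T) a') (FMor (Fun T) a a' t)"
abbreviation "GTT a \<equiv> FOb G (FOb (Fun T) (FOb (Fun T) a))"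
abbreviation "G\<mu> a \<equiv> FMor G (FOb (Fun T) (FOb (Fun T) a)) (FOb (Fun T) a) (Mult T a)"
abbreviation "G\<eta> a \<equiv> FMor G a (FOb (Fun T) a) (Unit T a)"

text \<open>The unit condition of \<open>is_pushforward\<close>, moved along an arrow
  \<open>f : b -> G a\<close> by naturality. The case \<open>b = G a\<close> with \<open>f\<close>
  the identity is the condition itself, and by \<open>monic\<close> the family of all
  \<open>f\<close> determines \<open>h\<close>.\<close>

definition unit_spec where
  "unit_spec b h \<longleftrightarrow> h \<in> Hom B b (r b) \<and> (\<forall>a\<in>Ob A. \<forall>f\<in>Hom B b (FOb G a).
    Cmp B b (r (FOb G a)) (GT a) (\<epsilon> a) (Cmp B b (r b) (r (FOb G a)) (FMor R b (FOb G a) f) h)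
    = Cmp B b (FOb G a) (GT a) (G\<eta> a) f)"

text \<open>The same for the multiplication: naturality gathers the two copies of \<open>R f\<close>
  into \<open>R\<close> of the composite of \<open>\<epsilon> a\<close> with
  \<open>R f\<close>.\<close>

definition mult_spec where
  "mult_spec b h \<longleftrightarrow> h \<in> Hom B (r (r b)) (r b) \<and> (\<forall>a\<in>Ob A. \<forall>f\<in>Hom B b (FOb G a).
    Cmp B (r (r b)) (r (FOb G a)) (GT a) (\<epsilon> a) (Cmp B (r (r b)) (r b) (r (FOb G a)) (FMor R b (FOb G a) f) h)
    = Cmp B (r (r b)) (GTT a) (GT a) (G\<mu> a)
       (Cmp B (r (r b)) (r (GT a)) (GTT a) (\<epsilon> (FOb (Fun T) a))
         (FMor R (r b) (GT a) (Cmp B (r b) (r (FOb G a)) (GT a) (\<epsilon> a) (FMor R b (FOb G a) f)))))"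

definition S where
  "S = \<lparr>Fun = R, Unit = (\<lambda>b. SOME h. unit_spec b h), Mult = (\<lambda>b. SOME h. mult_spec b h)\<rparr>"

lemma Fun_S [simp]: "Fun S = R"
  by (simp add: S_def)

lemma \<epsilon>_in' [simp]: "a \<in> Ob A \<Longrightarrow> \<epsilon> a \<in> Hom B (r (FOb G a)) (GT a)"
  using \<epsilon>_in by simp

text \<open>Naturality with a trailing \<open>h\<close>, the form in which it occurs inside
  composites nested to the right.\<close>

lemma \<epsilon>_nat':
  assumes "a \<in> Ob A" "a' \<in> Ob A" "t \<in> Hom A a a'" "y \<in> Ob B" "h \<in> Hom B y (r (FOb G a))"
  shows "Cmp B y (r (FOb G a')) (GT a') (\<epsilon> a') (Cmp B y (r (FOb G a)) (r (FOb G a')) (FMor R (FOb G a) (FOb G a') (FMor G a a' t)) h)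
    = Cmp B y (GT a) (GT a') (GTm a a' t) (Cmp B y (r (FOb G a)) (GT a) (\<epsilon> a) h)"
proof -
  have "Cmp B y (r (FOb G a')) (GT a') (\<epsilon> a') (Cmp B y (r (FOb G a)) (r (FOb G a')) (FMor R (FOb G a) (FOb G a') (FMor G a a' t)) h)
    = Cmp B y (r (FOb G a)) (GT a') (Cmp B (r (FOb G a)) (r (FOb G a')) (GT a') (\<epsilon> a') (FMor R (FOb G a) (FOb G a') (FMor G a a' t))) h"
    using assms by simp
  also have "Cmp B (r (FOb G a)) (r (FOb G a')) (GT a') (\<epsilon> a') (FMor R (FOb G a) (FOb G a') (FMor G a a' t))
    = Cmp B (r (FOb G a)) (GT a) (GT a') (GTm a a' t) (\<epsilon> a)"
    using \<epsilon>_nat[OF assms(1-3)] by simp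
  finally show ?thesis using assms by simp
qed

text \<open>Applies an equation of \<open>A\<close> under \<open>G\<close> in the midst of a
  composite nested to the right; naturality and associativity of \<open>T\<close> come in this
  way.\<close>

lemma G_comm_square:
  assumes "w \<in> Ob A" "x \<in> Ob A" "x' \<in> Ob A" "z \<in> Ob A" "f \<in> Hom A w x" "g \<in> Hom A x z"
    "f' \<in> Hom A w x'" "g' \<in> Hom A x' z" "Cmp A w x z g f = Cmp A w x' z g' f'"
    "y \<in> Ob B" "h \<in> Hom B y (FOb G w)"
  shows "Cmp B y (FOb G x) (FOb G z) (FMor G x z g) (Cmp B y (FOb G w) (FOb G x) (FMor G w x f) h)
    = Cmp B y (FOb G x') (FOb G z) (FMor G x' z g') (Cmp B y (FOb G w) (FOb G x') (FMor G w x' f') h)"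
proof -
  have "Cmp B y (FOb G x) (FOb G z) (FMor G x z g) (Cmp B y (FOb G w) (FOb G x) (FMor G w x f) h)
    = Cmp B y (FOb G w) (FOb G z) (FMor G w z (Cmp A w x z g f)) h"
    using assms(1-8,10,11) by simp
  then show ?thesis unfolding assms(9) using assms(1-8,10,11) by simp
qed

lemma Unit_S:
  assumes "b \<in> Ob B"
  shows "unit_spec b (Unit S b)"
proof -
  have "kan_cone A B G (G \<circ>\<^sub>F Fun T) b b (\<lambda>a f. Cmp B b (FOb G a) (GT a) (G\<eta> a) f)"
    unfolding kan_cone_def
  proof (intro conjI ballI)
    fix a a' t f assume *: "a \<in> Ob A" "a' \<in> Ob A" "t \<in> Hom A a a'" "f \<in> Hom B b (FOb G a)"
    show "Cmp B b (FOb (G \<circ>\<^sub>F Fun T) a) (FOb (G \<circ>\<^sub>F Fun T) a') (FMor (G \<circ>\<^sub>F Fun T) a a' t) (Cmp B b (FOb G a) (GT a) (G\<eta> a) f)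
      = Cmp B b (FOb G a') (GT a') (G\<eta> a') (Cmp B b (FOb G a) (FOb G a') (FMor G a a' t) f)"
      using * assms by simp (rule G_comm_square, auto simp: T.unit_nat)
  qed (use assms in simp_all)
  from factor[OF assms this] have "\<exists>h. unit_spec b h"
    by (auto simp: unit_spec_def)
  then show ?thesis by (simp add: S_def someI_ex)
qed

text \<open>The family in \<open>mult_spec\<close> is a weighted cone: naturality of
  \<open>Mult T\<close>, then of \<open>\<epsilon>\<close> at \<open>T t\<close> and at
  \<open>t\<close>, moves \<open>t\<close> inwards past all factors.\<close>

lemma Mult_S:
  assumes "b \<in> Ob B"
  shows "mult_spec b (Mult S b)"
proof -
  have "kan_cone A B G (G \<circ>\<^sub>F Fun T) b (r (r b)) (\<lambda>a f. Cmp B (r (r b)) (GTT a) (GT a) (G\<mu> a)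
       (Cmp B (r (r b)) (r (GT a)) (GTT a) (\<epsilon> (FOb (Fun T) a))
         (FMor R (r b) (GT a) (Cmp B (r b) (r (FOb G a)) (GT a) (\<epsilon> a) (FMor R b (FOb G a) f)))))"
    unfolding kan_cone_def
  proof (intro conjI ballI)
    fix a a' t f assume *: "a \<in> Ob A" "a' \<in> Ob A" "t \<in> Hom A a a'" "f \<in> Hom B b (FOb G a)"
    let ?T = "FOb (Fun T)" and ?t = "FMor (Fun T) a a' t"
    let ?g = "Cmp B (r b) (r (FOb G a)) (GT a) (\<epsilon> a) (FMor R b (FOb G a) f)"
    have "Cmp B (r (r b)) (GT a) (GT a') (GTm a a' t) (Cmp B (r (r b)) (GTT a) (GT a) (G\<mu> a)
        (Cmp B (r (r b)) (r (GT a)) (GTT a) (\<epsilon> (?T a)) (FMor R (r b) (GT a) ?g)))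
      = Cmp B (r (r b)) (GTT a') (GT a') (G\<mu> a') (Cmp B (r (r b)) (GTT a) (GTT a') (GTm (?T a) (?T a') ?t)
        (Cmp B (r (r b)) (r (GT a)) (GTT a) (\<epsilon> (?T a)) (FMor R (r b) (GT a) ?g)))"
      using * assms by (intro G_comm_square) (simp_all add: T.mult_nat)
    also have "\<dots> = Cmp B (r (r b)) (GTT a') (GT a') (G\<mu> a') (Cmp B (r (r b)) (r (GT a')) (GTT a') (\<epsilon> (?T a'))
        (FMor R (r b) (GT a') (Cmp B (r b) (GT a) (GT a') (GTm a a' t) ?g)))"
      using * assms \<epsilon>_nat'[of "?T a" "?T a'" ?t "r (r b)" "FMor R (r b) (GT a) ?g"] by simp
    also have "Cmp B (r b) (GT a) (GT a') (GTm a a' t) ?g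
      = Cmp B (r b) (r (FOb G a')) (GT a') (\<epsilon> a') (FMor R b (FOb G a') (Cmp B b (FOb G a) (FOb G a') (FMor G a a' t) f))"
      using * assms \<epsilon>_nat'[of a a' t "r b" "FMor R b (FOb G a) f"] by simp
    finally show "Cmp B (r (r b)) (FOb (G \<circ>\<^sub>F Fun T) a) (FOb (G \<circ>\<^sub>F Fun T) a') (FMor (G \<circ>\<^sub>F Fun T) a a' t) (Cmp B (r (r b)) (GTT a) (GT a) (G\<mu> a)
        (Cmp B (r (r b)) (r (GT a)) (GTT a) (\<epsilon> (?T a)) (FMor R (r b) (GT a) ?g)))
      = Cmp B (r (r b)) (GTT a') (GT a') (G\<mu> a') (Cmp B (r (r b)) (r (GT a')) (GTT a') (\<epsilon> (?T a'))
        (FMor R (r b) (GT a') (Cmp B (r b) (r (FOb G a')) (GT a') (\<epsilon> a') (FMor R b (FOb G a') (Cmp B b (FOb G a) (FOb G a') (FMor G a a' t) f)))))"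
      by simp
  qed (use assms in simp_all)
  from factor[OF assms this] have "\<exists>h. mult_spec b h"
    by (auto simp: mult_spec_def)
  then show ?thesis by (simp add: S_def someI_ex)
qed

lemma Unit_S_in [simp]: "b \<in> Ob B \<Longrightarrow> Unit S b \<in> Hom B b (r b)"
  using Unit_S by (simp add: unit_spec_def)

lemma Mult_S_in [simp]: "b \<in> Ob B \<Longrightarrow> Mult S b \<in> Hom B (r (r b)) (r b)"
  using Mult_S by (simp add: mult_spec_def)

lemma \<epsilon>_Unit:
  assumes "b \<in> Ob B" "a \<in> Ob A" "f \<in> Hom B b (FOb G a)" "y \<in> Ob B" "h \<in> Hom B y b"
  shows "Cmp B y (r (FOb G a)) (GT a) (\<epsilon> a) (Cmp B y (r b) (r (FOb G a)) (FMor R b (FOb G a) f) (Cmp B y b (r b) (Unit S b) h))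
    = Cmp B y (FOb G a) (GT a) (G\<eta> a) (Cmp B y b (FOb G a) f h)"
proof -
  have "Cmp B y (r (FOb G a)) (GT a) (\<epsilon> a) (Cmp B y (r b) (r (FOb G a)) (FMor R b (FOb G a) f) (Cmp B y b (r b) (Unit S b) h))
    = Cmp B y b (GT a) (Cmp B b (r (FOb G a)) (GT a) (\<epsilon> a) (Cmp B b (r b) (r (FOb G a)) (FMor R b (FOb G a) f) (Unit S b))) h"
    using assms by simp
  also have "Cmp B b (r (FOb G a)) (GT a) (\<epsilon> a) (Cmp B b (r b) (r (FOb G a)) (FMor R b (FOb G a) f) (Unit S b))
    = Cmp B b (FOb G a) (GT a) (G\<eta> a) f"
    using Unit_S[OF assms(1)] assms by (simp add: unit_spec_def)
  finally show ?thesis using assms by simp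
qed

lemma \<epsilon>_Mult:
  assumes "b \<in> Ob B" "a \<in> Ob A" "f \<in> Hom B b (FOb G a)" "y \<in> Ob B" "h \<in> Hom B y (r (r b))"
  shows "Cmp B y (r (FOb G a)) (GT a) (\<epsilon> a) (Cmp B y (r b) (r (FOb G a)) (FMor R b (FOb G a) f) (Cmp B y (r (r b)) (r b) (Mult S b) h))
    = Cmp B y (GTT a) (GT a) (G\<mu> a)
       (Cmp B y (r (GT a)) (GTT a) (\<epsilon> (FOb (Fun T) a))
         (Cmp B y (r (r b)) (r (GT a)) (FMor R (r b) (GT a) (Cmp B (r b) (r (FOb G a)) (GT a) (\<epsilon> a) (FMor R b (FOb G a) f))) h))"
proof -
  have "Cmp B y (r (FOb G a)) (GT a) (\<epsilon> a) (Cmp B y (r b) (r (FOb G a)) (FMor R b (FOb G a) f) (Cmp B y (r (r b)) (r b) (Mult S b) h))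
    = Cmp B y (r (r b)) (GT a) (Cmp B (r (r b)) (r (FOb G a)) (GT a) (\<epsilon> a) (Cmp B (r (r b)) (r b) (r (FOb G a)) (FMor R b (FOb G a) f) (Mult S b))) h"
    using assms by simp
  also have "Cmp B (r (r b)) (r (FOb G a)) (GT a) (\<epsilon> a) (Cmp B (r (r b)) (r b) (r (FOb G a)) (FMor R b (FOb G a) f) (Mult S b))
    = Cmp B (r (r b)) (GTT a) (GT a) (G\<mu> a)
       (Cmp B (r (r b)) (r (GT a)) (GTT a) (\<epsilon> (FOb (Fun T) a))
         (FMor R (r b) (GT a) (Cmp B (r b) (r (FOb G a)) (GT a) (\<epsilon> a) (FMor R b (FOb G a) f))))"
    using Mult_S[OF assms(1)] assms(2,3) by (simp only: mult_spec_def)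
  finally show ?thesis using assms by simp
qed

lemma \<epsilon>_Unit_id:
  assumes "b \<in> Ob B" "a \<in> Ob A" "f \<in> Hom B b (FOb G a)"
  shows "Cmp B b (r (FOb G a)) (GT a) (\<epsilon> a) (Cmp B b (r b) (r (FOb G a)) (FMor R b (FOb G a) f) (Unit S b))
    = Cmp B b (FOb G a) (GT a) (G\<eta> a) f"
  using \<epsilon>_Unit[OF assms assms(1) G.cod.ide_in_hom[OF assms(1)]] assms by simp

lemma \<epsilon>_Mult_id:
  assumes "b \<in> Ob B" "a \<in> Ob A" "f \<in> Hom B b (FOb G a)"
  shows "Cmp B (r (r b)) (r (FOb G a)) (GT a) (\<epsilon> a) (Cmp B (r (r b)) (r b) (r (FOb G a)) (FMor R b (FOb G a) f) (Mult S b))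
    = Cmp B (r (r b)) (GTT a) (GT a) (G\<mu> a)
       (Cmp B (r (r b)) (r (GT a)) (GTT a) (\<epsilon> (FOb (Fun T) a))
         (FMor R (r b) (GT a) (Cmp B (r b) (r (FOb G a)) (GT a) (\<epsilon> a) (FMor R b (FOb G a) f))))"
  using Mult_S[OF assms(1)] assms(2,3) by (simp only: mult_spec_def)

lemma G_retract:
  assumes "w \<in> Ob A" "x \<in> Ob A" "f \<in> Hom A w x" "g \<in> Hom A x w" "Cmp A w x w g f = Ide A w"
    "y \<in> Ob B" "h \<in> Hom B y (FOb G w)"
  shows "Cmp B y (FOb G x) (FOb G w) (FMor G x w g) (Cmp B y (FOb G w) (FOb G x) (FMor G w x f) h) = h"
proof -
  have "Cmp B y (FOb G x) (FOb G w) (FMor G x w g) (Cmp B y (FOb G w) (FOb G x) (FMor G w x f) h)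
    = Cmp B y (FOb G w) (FOb G w) (FMor G w w (Cmp A w x w g f)) h"
    using assms(1-4,6,7) by simp
  then show ?thesis unfolding assms(5) using assms by simp
qed

text \<open>Every law is an equation into some \<open>r b\<close>, so \<open>monic\<close> tests it
  against \<open>\<epsilon> a\<close> after \<open>R f\<close>. There the specifications trade the
  structure of \<open>S\<close> for that of \<open>T\<close> under \<open>G\<close>, and the
  matching law of \<open>T\<close> finishes.\<close>

lemma monad_S: "monad B S"
proof (intro monad.intro nat_trans.intro nat_trans_axioms.intro monad_axioms.intro)
  show "is_functor B B (Fun S)" "is_functor B B id_func" "is_functor B B (Fun S \<circ>\<^sub>F Fun S)"
    using R_functor is_functor_comp is_functor_id G.cod.category_axioms by auto
  then show "is_functor B B (Fun S)" by simp
  show "category B" by (rule G.cod.category_axioms)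
next
  fix b b' u assume u: "b \<in> Ob B" "b' \<in> Ob B" "u \<in> Hom B b b'"
  have "Cmp B b b' (r b') (Unit S b') u = Cmp B b (r b) (r b') (FMor R b b' u) (Unit S b)"
  proof (rule monic[of b' b])
    fix a f assume af: "a \<in> Ob A" "f \<in> Hom B b' (FOb G a)"
    show "Cmp B b (r (FOb G a)) (FOb (G \<circ>\<^sub>F Fun T) a) (\<epsilon> a) (Cmp B b (r b') (r (FOb G a)) (FMor R b' (FOb G a) f) (Cmp B b b' (r b') (Unit S b') u))
      = Cmp B b (r (FOb G a)) (FOb (G \<circ>\<^sub>F Fun T) a) (\<epsilon> a) (Cmp B b (r b') (r (FOb G a)) (FMor R b' (FOb G a) f) (Cmp B b (r b) (r b') (FMor R b b' u) (Unit S b)))"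
      using \<epsilon>_Unit_id[of b a "Cmp B b b' (FOb G a) f u"] u af by (simp add: \<epsilon>_Unit)
  qed (use u in simp_all)
  then show "Cmp B (FOb id_func b) (FOb id_func b') (FOb (Fun S) b') (Unit S b') (FMor id_func b b' u)
    = Cmp B (FOb id_func b) (FOb (Fun S) b) (FOb (Fun S) b') (FMor (Fun S) b b' u) (Unit S b)" by simp
  have "Cmp B (r (r b)) (r (r b')) (r b') (Mult S b') (FMor R (r b) (r b') (FMor R b b' u))
    = Cmp B (r (r b)) (r b) (r b') (FMor R b b' u) (Mult S b)"
  proof (rule monic[of b' "r (r b)"])
    fix a f assume af: "a \<in> Ob A" "f \<in> Hom B b' (FOb G a)"
    show "Cmp B (r (r b)) (r (FOb G a)) (FOb (G \<circ>\<^sub>F Fun T) a) (\<epsilon> a) (Cmp B (r (r b)) (r b') (r (FOb G a)) (FMor R b' (FOb G a) f) (Cmp B (r (r b)) (r (r b')) (r b') (Mult S b') (FMor R (r b) (r b') (FMor R b b' u))))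
      = Cmp B (r (r b)) (r (FOb G a)) (FOb (G \<circ>\<^sub>F Fun T) a) (\<epsilon> a) (Cmp B (r (r b)) (r b') (r (FOb G a)) (FMor R b' (FOb G a) f) (Cmp B (r (r b)) (r b) (r b') (FMor R b b' u) (Mult S b)))"
      using \<epsilon>_Mult_id[of b a "Cmp B b b' (FOb G a) f u"] u af by (simp add: \<epsilon>_Mult)
  qed (use u in simp_all)
  then show "Cmp B (FOb (Fun S \<circ>\<^sub>F Fun S) b) (FOb (Fun S \<circ>\<^sub>F Fun S) b') (FOb (Fun S) b') (Mult S b') (FMor (Fun S \<circ>\<^sub>F Fun S) b b' u)
    = Cmp B (FOb (Fun S \<circ>\<^sub>F Fun S) b) (FOb (Fun S) b) (FOb (Fun S) b') (FMor (Fun S) b b' u) (Mult S b)" by simp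
next
  fix b assume b: "b \<in> Ob B"
  show "Unit S b \<in> Hom B (FOb id_func b) (FOb (Fun S) b)"
    "Mult S b \<in> Hom B (FOb (Fun S \<circ>\<^sub>F Fun S) b) (FOb (Fun S) b)"
    using b by simp_all
  have "Cmp B (r b) (r (r b)) (r b) (Mult S b) (Unit S (r b)) = Ide B (r b)"
  proof (rule monic[of b "r b"])
    fix a f assume af: "a \<in> Ob A" "f \<in> Hom B b (FOb G a)"
    let ?g = "Cmp B (r b) (r (FOb G a)) (GT a) (\<epsilon> a) (FMor R b (FOb G a) f)"
    have "Cmp B (r b) (r (FOb G a)) (GT a) (\<epsilon> a) (Cmp B (r b) (r b) (r (FOb G a)) (FMor R b (FOb G a) f) (Cmp B (r b) (r (r b)) (r b) (Mult S b) (Unit S (r b))))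
      = Cmp B (r b) (GTT a) (GT a) (G\<mu> a) (Cmp B (r b) (r (GT a)) (GTT a) (\<epsilon> (FOb (Fun T) a))
         (Cmp B (r b) (r (r b)) (r (GT a)) (FMor R (r b) (GT a) ?g) (Unit S (r b))))"
      using b af by (intro \<epsilon>_Mult) simp_all
    also have "\<dots> = Cmp B (r b) (GTT a) (GT a) (G\<mu> a) (Cmp B (r b) (GT a) (GTT a) (G\<eta> (FOb (Fun T) a)) ?g)"
      using b af by (subst \<epsilon>_Unit_id) simp_all
    also have "\<dots> = ?g"
      using b af by (intro G_retract) (simp_all add: T.unit_left)
    finally show "Cmp B (r b) (r (FOb G a)) (FOb (G \<circ>\<^sub>F Fun T) a) (\<epsilon> a) (Cmp B (r b) (r b) (r (FOb G a)) (FMor R b (FOb G a) f) (Cmp B (r b) (r (r b)) (r b) (Mult S b) (Unit S (r b))))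
      = Cmp B (r b) (r (FOb G a)) (FOb (G \<circ>\<^sub>F Fun T) a) (\<epsilon> a) (Cmp B (r b) (r b) (r (FOb G a)) (FMor R b (FOb G a) f) (Ide B (r b)))"
      using b af by simp
  qed (use b in simp_all)
  then show "Cmp B (FOb (Fun S) b) (FOb (Fun S) (FOb (Fun S) b)) (FOb (Fun S) b) (Mult S b) (Unit S (FOb (Fun S) b)) = Ide B (FOb (Fun S) b)"
    by simp
  have "Cmp B (r b) (r (r b)) (r b) (Mult S b) (FMor R b (r b) (Unit S b)) = Ide B (r b)"
  proof (rule monic[of b "r b"])
    fix a f assume af: "a \<in> Ob A" "f \<in> Hom B b (FOb G a)"
    let ?g = "Cmp B (r b) (r (FOb G a)) (GT a) (\<epsilon> a) (FMor R b (FOb G a) f)"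
    have "Cmp B (r b) (r (FOb G a)) (GT a) (\<epsilon> a) (Cmp B (r b) (r b) (r (FOb G a)) (FMor R b (FOb G a) f) (Cmp B (r b) (r (r b)) (r b) (Mult S b) (FMor R b (r b) (Unit S b))))
      = Cmp B (r b) (GTT a) (GT a) (G\<mu> a) (Cmp B (r b) (r (GT a)) (GTT a) (\<epsilon> (FOb (Fun T) a))
         (Cmp B (r b) (r (r b)) (r (GT a)) (FMor R (r b) (GT a) ?g) (FMor R b (r b) (Unit S b))))"
      using b af by (intro \<epsilon>_Mult) simp_all
    also have "\<dots> = Cmp B (r b) (GTT a) (GT a) (G\<mu> a) (Cmp B (r b) (r (GT a)) (GTT a) (\<epsilon> (FOb (Fun T) a))
         (FMor R b (GT a) (Cmp B b (r (FOb G a)) (GT a) (\<epsilon> a) (Cmp B b (r b) (r (FOb G a)) (FMor R b (FOb G a) f) (Unit S b)))))"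
      using b af by simp
    also have "\<dots> = Cmp B (r b) (GTT a) (GT a) (G\<mu> a) (Cmp B (r b) (GT a) (GTT a) (GTm a (FOb (Fun T) a) (Unit T a)) ?g)"
      unfolding \<epsilon>_Unit_id[OF b af] using b af by (simp add: \<epsilon>_nat')
    also have "\<dots> = ?g"
      using b af by (intro G_retract) (simp_all add: T.unit_right)
    finally show "Cmp B (r b) (r (FOb G a)) (FOb (G \<circ>\<^sub>F Fun T) a) (\<epsilon> a) (Cmp B (r b) (r b) (r (FOb G a)) (FMor R b (FOb G a) f) (Cmp B (r b) (r (r b)) (r b) (Mult S b) (FMor R b (r b) (Unit S b))))
      = Cmp B (r b) (r (FOb G a)) (FOb (G \<circ>\<^sub>F Fun T) a) (\<epsilon> a) (Cmp B (r b) (r b) (r (FOb G a)) (FMor R b (FOb G a) f) (Ide B (r b)))"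
      using b af by simp
  qed (use b in simp_all)
  then show "Cmp B (FOb (Fun S) b) (FOb (Fun S) (FOb (Fun S) b)) (FOb (Fun S) b) (Mult S b) (FMor (Fun S) b (FOb (Fun S) b) (Unit S b)) = Ide B (FOb (Fun S) b)"
    by simp
  have "Cmp B (r (r (r b))) (r (r b)) (r b) (Mult S b) (Mult S (r b))
    = Cmp B (r (r (r b))) (r (r b)) (r b) (Mult S b) (FMor R (r (r b)) (r b) (Mult S b))"
  proof (rule monic[of b "r (r (r b))"])
    fix a f assume af: "a \<in> Ob A" "f \<in> Hom B b (FOb G a)"
    let ?T = "FOb (Fun T)"
    let ?y = "r (r (r b))"
    let ?g = "Cmp B (r b) (r (FOb G a)) (GT a) (\<epsilon> a) (FMor R b (FOb G a) f)"
    \<comment> \<open>\<open>?g\<close>, \<open>?h\<close> and \<open>?k\<close> turn one, two and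
      three applications of \<open>R\<close> to \<open>b\<close> into as many applications of
      \<open>T\<close> under \<open>G\<close>.\<close>
    let ?h = "Cmp B (r (r b)) (r (GT a)) (GTT a) (\<epsilon> (?T a)) (FMor R (r b) (GT a) ?g)"
    let ?k = "Cmp B ?y (r (GTT a)) (GTT (?T a)) (\<epsilon> (?T (?T a))) (FMor R (r (r b)) (GTT a) ?h)"
    have "Cmp B ?y (r (FOb G a)) (GT a) (\<epsilon> a) (Cmp B ?y (r b) (r (FOb G a)) (FMor R b (FOb G a) f) (Cmp B ?y (r (r b)) (r b) (Mult S b) (Mult S (r b))))
      = Cmp B ?y (GTT a) (GT a) (G\<mu> a) (Cmp B ?y (r (GT a)) (GTT a) (\<epsilon> (?T a))
         (Cmp B ?y (r (r b)) (r (GT a)) (FMor R (r b) (GT a) ?g) (Mult S (r b))))"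
      using b af by (intro \<epsilon>_Mult) simp_all
    also have "\<dots> = Cmp B ?y (GTT a) (GT a) (G\<mu> a) (Cmp B ?y (GTT (?T a)) (GTT a) (G\<mu> (?T a)) ?k)"
      using b af by (subst \<epsilon>_Mult_id) simp_all
    also have "\<dots> = Cmp B ?y (GTT a) (GT a) (G\<mu> a) (Cmp B ?y (GTT (?T a)) (GTT a) (GTm (?T (?T a)) (?T a) (Mult T a)) ?k)"
      using b af by (intro G_comm_square) (simp_all add: T.mult_assoc)
    also have "\<dots> = Cmp B ?y (GTT a) (GT a) (G\<mu> a) (Cmp B ?y (r (GT a)) (GTT a) (\<epsilon> (?T a))
         (FMor R (r (r b)) (GT a) (Cmp B (r (r b)) (GTT a) (GT a) (G\<mu> a) ?h)))"
      using b af \<epsilon>_nat'[of "?T (?T a)" "?T a" "Mult T a" ?y "FMor R (r (r b)) (GTT a) ?h"] by simp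
    also have "\<dots> = Cmp B ?y (GTT a) (GT a) (G\<mu> a) (Cmp B ?y (r (GT a)) (GTT a) (\<epsilon> (?T a))
         (Cmp B ?y (r (r b)) (r (GT a)) (FMor R (r b) (GT a) ?g) (FMor R (r (r b)) (r b) (Mult S b))))"
      unfolding \<epsilon>_Mult_id[OF b af, symmetric] using b af by simp
    also have "\<dots> = Cmp B ?y (r (FOb G a)) (GT a) (\<epsilon> a) (Cmp B ?y (r b) (r (FOb G a)) (FMor R b (FOb G a) f) (Cmp B ?y (r (r b)) (r b) (Mult S b) (FMor R (r (r b)) (r b) (Mult S b))))"
      using b af by (intro \<epsilon>_Mult[symmetric]) simp_all
    finally show "Cmp B ?y (r (FOb G a)) (FOb (G \<circ>\<^sub>F Fun T) a) (\<epsilon> a) (Cmp B ?y (r b) (r (FOb G a)) (FMor R b (FOb G a) f) (Cmp B ?y (r (r b)) (r b) (Mult S b) (Mult S (r b))))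
      = Cmp B ?y (r (FOb G a)) (FOb (G \<circ>\<^sub>F Fun T) a) (\<epsilon> a) (Cmp B ?y (r b) (r (FOb G a)) (FMor R b (FOb G a) f) (Cmp B ?y (r (r b)) (r b) (Mult S b) (FMor R (r (r b)) (r b) (Mult S b))))"
      by simp
  qed (use b in simp_all)
  then show "Cmp B (FOb (Fun S) (FOb (Fun S) (FOb (Fun S) b))) (FOb (Fun S) (FOb (Fun S) b)) (FOb (Fun S) b) (Mult S b) (Mult S (FOb (Fun S) b))
    = Cmp B (FOb (Fun S) (FOb (Fun S) (FOb (Fun S) b))) (FOb (Fun S) (FOb (Fun S) b)) (FOb (Fun S) b) (Mult S b) (FMor (Fun S) (FOb (Fun S) (FOb (Fun S) b)) (FOb (Fun S) b) (Mult S b))"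
    by simp
qed

theorem pushforward_S: "is_pushforward A B G T S \<epsilon>"
  unfolding is_pushforward_def
proof (intro conjI ballI)
  show "is_right_kan_extension A B B G (G \<circ>\<^sub>F Fun T) (Fun S) \<epsilon>"
    using right_kan by simp
  show "monad B S" by (rule monad_S)
  fix a assume a: "a \<in> Ob A"
  show "Cmp B (FOb G a) (FOb (Fun S) (FOb G a)) (GT a) (\<epsilon> a) (Unit S (FOb G a)) = G\<eta> a"
    using \<epsilon>_Unit_id[of "FOb G a" a "Ide B (FOb G a)"] a by simp
  show "Cmp B (FOb (Fun S) (FOb (Fun S) (FOb G a))) (FOb (Fun S) (FOb G a)) (GT a) (\<epsilon> a) (Mult S (FOb G a))
    = Cmp B (FOb (Fun S) (FOb (Fun S) (FOb G a))) (GTT a) (GT a) (G\<mu> a)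
       (Cmp B (FOb (Fun S) (FOb (Fun S) (FOb G a))) (FOb (Fun S) (GT a)) (GTT a) (\<epsilon> (FOb (Fun T) a))
         (FMor (Fun S) (FOb (Fun S) (FOb G a)) (GT a) (\<epsilon> a)))"
    using \<epsilon>_Mult_id[of "FOb G a" a "Ide B (FOb G a)"] a by simp
qed

end

section \<open>Existence of the pushforward\<close>

lemma pushforward_exists:
  fixes A :: "('a, 'u) cat" and B :: "('b, 'u) cat"
  assumes U: "size_universe TYPE('u)" and A: "locally_small A" and B: "locally_small B" "complete B"
    and G: "representably_small A B G" and T: "monad A T"
  shows "\<exists>S \<epsilon>. is_pushforward A B G T S \<epsilon>"
proof -
  interpret G: is_functor A B G using G by (simp add: representably_small_def)
  interpret T: monad A T by fact
  have K: "is_functor A B (G \<circ>\<^sub>F Fun T)"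
    using T.unit.target.is_functor_axioms G.is_functor_axioms by (rule is_functor_comp)
  have "\<exists>p. kan_limit A B G (G \<circ>\<^sub>F Fun T) b (fst p) (snd p)" if b: "b \<in> Ob B" for b
  proof -
    have "small_functor A (hom_func B b \<circ>\<^sub>F G)"
      using G b by (simp add: representably_small_def)
    then obtain M where "presents A (hom_func B b \<circ>\<^sub>F G) M"
      by (rule presents_of_small_functor[OF U A])
    from kan_limit_exists[OF A B G.is_functor_axioms K b this] show ?thesis by simp
  qed
  then have "\<forall>b\<in>Ob B. \<exists>p. kan_limit A B G (G \<circ>\<^sub>F Fun T) b (fst p) (snd p)" by blast
  from bchoice[OF this] obtain p
    where p: "\<forall>b\<in>Ob B. kan_limit A B G (G \<circ>\<^sub>F Fun T) b (fst (p b)) (snd (p b))" ..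
  interpret pushforward A B G T "\<lambda>b. fst (p b)" "\<lambda>b. snd (p b)"
    using p K by (intro pushforward.intro pointwise_kan.intro pointwise_kan_axioms.intro
        T.monad_axioms G.is_functor_axioms) auto
  show ?thesis using pushforward_S by blast
qed

section \<open>The lifted functor between categories of algebras\<close>

lemma algebra_lift_simps [simp]:
  "FOb (algebra_lift B G T S \<epsilon>) x = (FOb G (fst x),
     Cmp B (FOb (Fun S) (FOb G (fst x))) (FOb G (FOb (Fun T) (fst x))) (FOb G (fst x))
       (FMor G (FOb (Fun T) (fst x)) (fst x) (snd x)) (\<epsilon> (fst x)))"
  "FMor (algebra_lift B G T S \<epsilon>) x y f = FMor G (fst x) (fst y) f"
  by (simp_all add: algebra_lift_def case_prod_beta)

text \<open>The two compatibility conditions and naturality make \<open>\<epsilon>\<close> a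
  morphism of monads over \<open>G\<close>, and such a morphism carries algebras to algebras; this
  holds for whichever pushforward is given.\<close>

lemma is_functor_algebra_lift:
  assumes G: "is_functor A B G" and T: "monad A T" and S: "is_pushforward A B G T S \<epsilon>"
  shows "is_functor (EM A T) (EM B S) (algebra_lift B G T S \<epsilon>)" (is "is_functor _ _ ?L")
proof -
  interpret G: is_functor A B G by fact
  interpret T: monad A T by fact
  interpret S: monad B S using S by (simp add: is_pushforward_def)
  interpret \<epsilon>: nat_trans A B "Fun S \<circ>\<^sub>F G" "G \<circ>\<^sub>F Fun T" \<epsilon>
    using S by (simp add: is_pushforward_def is_right_kan_extension_def)
  let ?S = "FOb (Fun S)" and ?SF = "FMor (Fun S)" and ?T = "FOb (Fun T)" and ?TF = "FMor (Fun T)"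
    and ?G = "FOb G" and ?GF = "FMor G"
  have \<epsilon>_in [simp]: "\<epsilon> a \<in> Hom B (?S (?G a)) (?G (?T a))" if "a \<in> Ob A" for a
    using \<epsilon>.component_in[OF that] by simp
  have \<epsilon>_nat: "Cmp B (?S (?G a)) (?S (?G a')) (?G (?T a')) (\<epsilon> a') (?SF (?G a) (?G a') (?GF a a' t))
      = Cmp B (?S (?G a)) (?G (?T a)) (?G (?T a')) (?GF (?T a) (?T a') (?TF a a' t)) (\<epsilon> a)"
    if "a \<in> Ob A" "a' \<in> Ob A" "t \<in> Hom A a a'" for a a' t
    using \<epsilon>.naturality[OF that] by simp
  have \<epsilon>_unit: "Cmp B (?G a) (?S (?G a)) (?G (?T a)) (\<epsilon> a) (Unit S (?G a)) = ?GF a (?T a) (Unit T a)"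
    and \<epsilon>_mult: "Cmp B (?S (?S (?G a))) (?S (?G a)) (?G (?T a)) (\<epsilon> a) (Mult S (?G a))
      = Cmp B (?S (?S (?G a))) (?G (?T (?T a))) (?G (?T a)) (?GF (?T (?T a)) (?T a) (Mult T a))
         (Cmp B (?S (?S (?G a))) (?S (?G (?T a))) (?G (?T (?T a))) (\<epsilon> (?T a)) (?SF (?S (?G a)) (?G (?T a)) (\<epsilon> a)))"
    if "a \<in> Ob A" for a
    using S that by (simp_all add: is_pushforward_def)
  have L_ob: "FOb ?L x \<in> Ob (EM B S)" if x: "x \<in> Ob (EM A T)" for x
  proof -
    obtain a \<alpha> where ax: "x = (a, \<alpha>)" by fastforce
    note x' = T.algebraD[OF x, unfolded ax fst_conv snd_conv]
    note [simp] = x'(1,2)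
    let ?\<alpha> = "Cmp B (?S (?G a)) (?G (?T a)) (?G a) (?GF (?T a) a \<alpha>) (\<epsilon> a)"
    have "Cmp B (?G a) (?S (?G a)) (?G a) ?\<alpha> (Unit S (?G a)) = ?GF a a (Cmp A a (?T a) a \<alpha> (Unit T a))"
      by (simp add: \<epsilon>_unit)
    then have unit: "Cmp B (?G a) (?S (?G a)) (?G a) ?\<alpha> (Unit S (?G a)) = Ide B (?G a)"
      unfolding x'(3) by simp
    have "Cmp B (?S (?S (?G a))) (?S (?G a)) (?G a) ?\<alpha> (Mult S (?G a))
      = Cmp B (?S (?S (?G a))) (?G (?T (?T a))) (?G a) (?GF (?T (?T a)) a (Cmp A (?T (?T a)) (?T a) a \<alpha> (Mult T a)))
         (Cmp B (?S (?S (?G a))) (?S (?G (?T a))) (?G (?T (?T a))) (\<epsilon> (?T a)) (?SF (?S (?G a)) (?G (?T a)) (\<epsilon> a)))"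
      by (simp add: \<epsilon>_mult)
    \<comment> \<open>Associativity of \<open>\<alpha>\<close> trades \<open>Mult T a\<close> for
      \<open>T \<alpha>\<close>, which naturality of \<open>\<epsilon>\<close> at
      \<open>\<alpha>\<close> then carries over to \<open>S\<close>.\<close>
    also have "\<dots> = Cmp B (?S (?S (?G a))) (?G (?T a)) (?G a) (?GF (?T a) a \<alpha>)
        (Cmp B (?S (?S (?G a))) (?S (?G (?T a))) (?G (?T a))
          (Cmp B (?S (?G (?T a))) (?G (?T (?T a))) (?G (?T a)) (?GF (?T (?T a)) (?T a) (?TF (?T a) a \<alpha>)) (\<epsilon> (?T a)))
          (?SF (?S (?G a)) (?G (?T a)) (\<epsilon> a)))"
      unfolding x'(4) by simp
    also have "\<dots> = Cmp B (?S (?S (?G a))) (?S (?G a)) (?G a) ?\<alpha> (?SF (?S (?G a)) (?G a) ?\<alpha>)"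
      unfolding \<epsilon>_nat[of "?T a" a \<alpha>, simplified, symmetric] by simp
    finally show ?thesis
      using unit by (simp add: EM_simps is_algebra_def ax)
  qed
  have L_hom: "FMor ?L x y f \<in> Hom (EM B S) (FOb ?L x) (FOb ?L y)"
    if x: "x \<in> Ob (EM A T)" and y: "y \<in> Ob (EM A T)" and f: "f \<in> Hom (EM A T) x y" for x y f
  proof -
    obtain a \<alpha> where ax: "x = (a, \<alpha>)" by fastforce
    obtain b \<beta> where bx: "y = (b, \<beta>)" by fastforce
    note x' = T.algebraD(1,2)[OF x, unfolded ax fst_conv snd_conv]
    note y' = T.algebraD(1,2)[OF y, unfolded bx fst_conv snd_conv]
    note f' = T.algebra_homD[OF f, unfolded ax bx fst_conv snd_conv]
    note [simp] = x' y' f'(1)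
    have "Cmp B (?S (?G a)) (?G a) (?G b) (?GF a b f) (Cmp B (?S (?G a)) (?G (?T a)) (?G a) (?GF (?T a) a \<alpha>) (\<epsilon> a))
      = Cmp B (?S (?G a)) (?G (?T a)) (?G b) (?GF (?T a) b (Cmp A (?T a) a b f \<alpha>)) (\<epsilon> a)"
      by simp
    also have "\<dots> = Cmp B (?S (?G a)) (?G (?T b)) (?G b) (?GF (?T b) b \<beta>)
        (Cmp B (?S (?G a)) (?G (?T a)) (?G (?T b)) (?GF (?T a) (?T b) (?TF a b f)) (\<epsilon> a))"
      unfolding f'(2) by simp
    also have "\<dots> = Cmp B (?S (?G a)) (?S (?G b)) (?G b) (Cmp B (?S (?G b)) (?G (?T b)) (?G b) (?GF (?T b) b \<beta>) (\<epsilon> b))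
        (?SF (?G a) (?G b) (?GF a b f))"
      unfolding \<epsilon>_nat[of a b f, simplified, symmetric] by simp
    finally show ?thesis by (simp add: EM_simps ax bx)
  qed
  show ?thesis
  proof (intro is_functor.intro is_functor_axioms.intro T.category_EM S.category_EM L_ob L_hom)
    fix x assume "x \<in> Ob (EM A T)"
    from T.algebraD(1)[OF this]
    show "FMor ?L x x (Ide (EM A T) x) = Ide (EM B S) (FOb ?L x)" by (simp add: EM_simps)
  next
    fix x y z f g
    assume *: "x \<in> Ob (EM A T)" "y \<in> Ob (EM A T)" "z \<in> Ob (EM A T)" "f \<in> Hom (EM A T) x y" "g \<in> Hom (EM A T) y z"
    show "FMor ?L x z (Cmp (EM A T) x y z g f)
        = Cmp (EM B S) (FOb ?L x) (FOb ?L y) (FOb ?L z) (FMor ?L y z g) (FMor ?L x y f)"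
      using *(1-3)[THEN T.algebraD(1)] *(4,5)[THEN T.algebra_homD(1)] by (simp add: EM_simps)
  qed
qed

text \<open>\<open>B\<^sup>S((b, \<beta>), G' -)\<close> is the equalizer of the two maps \<open>y \<mapsto> y \<cdot> \<beta>\<close> and
  \<open>y \<mapsto> G \<alpha> \<cdot> \<epsilon>\<^sub>a \<cdot> S y\<close> from \<open>B(b, G U -)\<close> to \<open>B(S b, G U -)\<close>.\<close>

lemma representably_small_algebra_lift:
  fixes A :: "('a, 'u) cat" and B :: "('b, 'u) cat"
  assumes U: "size_universe TYPE('u)" and A: "locally_small A" and B: "locally_small B"
    and G: "representably_small A B G" and T: "monad A T" and S: "is_pushforward A B G T S \<epsilon>"
    and colim: "has_finite_connected_colimits (EM A T)"
  shows "representably_small (EM A T) (EM B S) (algebra_lift B G T S \<epsilon>)"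
proof -
  let ?L = "algebra_lift B G T S \<epsilon>"
  interpret G: is_functor A B G using G by (simp add: representably_small_def)
  interpret T: monad A T by fact
  interpret S: monad B S using S by (simp add: is_pushforward_def)
  interpret L: is_functor "EM A T" "EM B S" ?L
    using is_functor_algebra_lift[OF G.is_functor_axioms T S] .
  interpret F: is_functor "EM A T" A forgetful by (rule T.is_functor_forgetful)
  have lsA: "locally_small (EM A T)" using T.locally_small_EM[OF A] .
  have lsB: "locally_small (EM B S)" using S.locally_small_EM[OF B] .
  have span: "has_span_colimits (EM A T)"
    using has_span_colimits_of_finite_connected[OF U colim] .
  have hom_sf: "set_functor A (hom_func B b \<circ>\<^sub>F G)" if "b \<in> Ob B" for b
    using G.is_functor_axioms set_functor_hom_func[OF B that] by (rule set_functor_comp)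
  \<comment> \<open>Used at \<open>b\<close> for the domain and at \<open>S b\<close> for the
    codomain of the two maps.\<close>
  have hom_presented: "\<exists>M. presents (EM A T) (hom_func B b \<circ>\<^sub>F G \<circ>\<^sub>F forgetful) M" if b: "b \<in> Ob B" for b
  proof -
    have "small_functor A (hom_func B b \<circ>\<^sub>F G)"
      using G b by (simp add: representably_small_def)
    then obtain M where "presents A (hom_func B b \<circ>\<^sub>F G) M"
      by (rule presents_of_small_functor[OF U A])
    from T.presents_forgetful[OF hom_sf[OF b] this] show ?thesis by blast
  qed
  have "small_functor (EM A T) (hom_func (EM B S) y \<circ>\<^sub>F ?L)" if y: "y \<in> Ob (EM B S)" for y
  proof -
    obtain b \<beta> where y': "y = (b, \<beta>)" by fastforce
    have b [simp]: "b \<in> Ob B" "\<beta> \<in> Hom B (FOb (Fun S) b) b"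
      using S.algebraD(1,2)[OF y] y' by simp_all
    let ?P = "hom_func B b \<circ>\<^sub>F G \<circ>\<^sub>F forgetful :: ('a \<times> 'u, _, _, _) func"
    let ?Q = "hom_func B (FOb (Fun S) b) \<circ>\<^sub>F G \<circ>\<^sub>F forgetful :: ('a \<times> 'u, _, _, _) func"
    let ?E = "hom_func (EM B S) y \<circ>\<^sub>F ?L"
    have P: "set_functor (EM A T) ?P" and Q: "set_functor (EM A T) ?Q"
      by (rule set_functor_comp[OF F.is_functor_axioms hom_sf], simp)+
    have E: "set_functor (EM A T) ?E"
      using L.is_functor_axioms set_functor_hom_func[OF lsB y] by (rule set_functor_comp)
    obtain M where M: "presents (EM A T) ?P M" using hom_presented[OF b(1)] by blast
    obtain N where N: "presents (EM A T) ?Q N" using hom_presented[of "FOb (Fun S) b"] by auto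
    define u where "u x p = Cmp B (FOb (Fun S) b) b (FOb G (fst x)) p \<beta>" for x :: "'a \<times> 'u" and p
    define v where "v x p = Cmp B (FOb (Fun S) b) (FOb (Fun S) (FOb G (fst x))) (FOb G (fst x))
      (snd (FOb ?L x)) (FMor (Fun S) b (FOb G (fst x)) p)" for x :: "'a \<times> 'u" and p
    have L_in [simp]: "snd (FOb ?L x) \<in> Hom B (FOb (Fun S) (FOb G (fst x))) (FOb G (fst x))"
      if "x \<in> Ob (EM A T)" for x
      using S.algebraD(2)[OF L.fob_in[OF that]] by simp
    have L_hom: "Cmp B (FOb (Fun S) (FOb G (fst x))) (FOb G (fst x)) (FOb G (fst x')) (FMor G (fst x) (fst x') f) (snd (FOb ?L x))
      = Cmp B (FOb (Fun S) (FOb G (fst x))) (FOb (Fun S) (FOb G (fst x'))) (FOb G (fst x')) (snd (FOb ?L x'))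
         (FMor (Fun S) (FOb G (fst x)) (FOb G (fst x')) (FMor G (fst x) (fst x') f))"
      if "x \<in> Ob (EM A T)" "x' \<in> Ob (EM A T)" "f \<in> Hom (EM A T) x x'" for x x' f
      using S.algebra_homD(2)[OF L.fmor_in[OF that]] by simp
    have "\<exists>M. presents (EM A T) ?E M"
    proof (rule presents_equalizer[OF U lsA span P M Q N, of u v ?E])
      fix x p assume "x \<in> Ob (EM A T)" "p \<in> FOb ?P x"
      note * = T.algebraD(1)[OF this(1)] L_in[OF this(1)] this(2)
      show "u x p \<in> FOb ?Q x" using * by (simp add: u_def)
      show "v x p \<in> FOb ?Q x" using * by (simp add: v_def del: algebra_lift_simps)
    next
      fix x x' f p assume "x \<in> Ob (EM A T)" "x' \<in> Ob (EM A T)" "f \<in> Hom (EM A T) x x'" "p \<in> FOb ?P x"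
      note * = T.algebraD(1)[OF this(1)] T.algebraD(1)[OF this(2)] T.algebra_homD(1)[OF this(3)]
        L_in[OF this(1)] L_in[OF this(2)] L_hom[OF this(1-3)]
      have p: "p \<in> Hom B b (FOb G (fst x))" using \<open>p \<in> FOb ?P x\<close> by simp
      show "u x' (FMor ?P x x' f p) = FMor ?Q x x' f (u x p)"
        using *(1-5) p by (simp add: u_def del: algebra_lift_simps)
      \<comment> \<open>Naturality of \<open>v\<close> holds because \<open>G f\<close> is a
        homomorphism between the lifted algebras, which is \<open>L_hom\<close>; the composite is
        regrouped until that equation shows.\<close>
      have "v x' (FMor ?P x x' f p) = Cmp B (FOb (Fun S) b) (FOb (Fun S) (FOb G (fst x))) (FOb G (fst x'))
        (Cmp B (FOb (Fun S) (FOb G (fst x))) (FOb (Fun S) (FOb G (fst x'))) (FOb G (fst x')) (snd (FOb ?L x'))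
          (FMor (Fun S) (FOb G (fst x)) (FOb G (fst x')) (FMor G (fst x) (fst x') f))) (FMor (Fun S) b (FOb G (fst x)) p)"
        using *(1-5) p by (simp add: v_def del: algebra_lift_simps)
      also have "\<dots> = FMor ?Q x x' f (v x p)"
        unfolding *(6)[symmetric] using *(1-5) p by (simp add: v_def del: algebra_lift_simps)
      finally show "v x' (FMor ?P x x' f p) = FMor ?Q x x' f (v x p)" .
    next
      fix x assume "x \<in> Ob (EM A T)"
      \<comment> \<open>The equation \<open>u x p = v x p\<close> is the homomorphism condition of
        \<open>EM B S\<close> for \<open>p\<close>.\<close>
      show "FOb ?E x = {p \<in> FOb ?P x. u x p = v x p}"
        by (auto simp: EM_simps u_def v_def y')
    next
      fix x x' f p assume *: "x \<in> Ob (EM A T)" "x' \<in> Ob (EM A T)" "f \<in> Hom (EM A T) x x'" "p \<in> FOb ?E x"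
      then have "p \<in> Hom (EM B S) y (FOb ?L x)" by simp
      then have "p \<in> Hom B b (FOb G (fst x))" by (simp add: EM_simps y')
      then show "FMor ?E x x' f p = FMor ?P x x' f p"
        using \<open>p \<in> Hom (EM B S) y (FOb ?L x)\<close> by (simp add: y') (simp add: EM_simps)
    qed blast
    then show ?thesis
      using set_functor.small_functor_of_presents[OF E lsA] by blast
  qed
  then show ?thesis
    unfolding representably_small_def using L.is_functor_axioms by blast
qed

text \<open>All pushforwards are quantified over, since a right Kan extension is unique only up to
  isomorphism; existence is a separate conjunct.\<close>

theorem proposition2p6:
  fixes A :: "('a, 'u) cat" and B :: "('b, 'u) cat"
    and G :: "('a, 'b, 'u, 'u) func" and T :: "('a, 'u) mnd"
  assumes "size_universe TYPE('u)"
    and "locally_small A" and "locally_small B"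
    and "complete B"
    and "representably_small A B G"
    and "monad A T"
  shows "(\<exists>S \<epsilon>. is_pushforward A B G T S \<epsilon>) \<and>
    (\<forall>S \<epsilon>. is_pushforward A B G T S \<epsilon> \<longrightarrow>
       is_functor (EM A T) (EM B S) (algebra_lift B G T S \<epsilon>) \<and>
       forgetful \<circ>\<^sub>F algebra_lift B G T S \<epsilon> = G \<circ>\<^sub>F (forgetful :: ('a \<times> 'u, 'a, 'u, 'u) func) \<and>
       (has_finite_connected_colimits (EM A T) \<longrightarrow>
          complete (EM B S) \<and>
          representably_small (EM A T) (EM B S) (algebra_lift B G T S \<epsilon>)))"
proof (intro conjI allI impI)
  show "\<exists>S \<epsilon>. is_pushforward A B G T S \<epsilon>"
    using assms by (rule pushforward_exists)
  fix S \<epsilon> assume S: "is_pushforward A B G T S \<epsilon>"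
  show "is_functor (EM A T) (EM B S) (algebra_lift B G T S \<epsilon>)"
    using assms(5,6) S by (intro is_functor_algebra_lift) (simp_all add: representably_small_def)
  show "forgetful \<circ>\<^sub>F algebra_lift B G T S \<epsilon> = G \<circ>\<^sub>F (forgetful :: ('a \<times> 'u, 'a, 'u, 'u) func)"
    by (simp add: comp_func_def)
  assume colim: "has_finite_connected_colimits (EM A T)"
  show "complete (EM B S)"
    using S assms(4) by (intro monad.complete_EM) (simp_all add: is_pushforward_def)
  show "representably_small (EM A T) (EM B S) (algebra_lift B G T S \<epsilon>)"
    using assms(1-3,5,6) S colim by (rule representably_small_algebra_lift)
qed

end
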